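(* The singular level sets in the phase space of the Boltzmann system consist of: (1) a single closed orbit corresponding to the limiting motion on the wall along the minor axis of the ellipse $\mathcal E_+$, for each $(E,D)$ such that $D+2E=0$ and $0<D<2$; (2) a single closed orbit, corresponding to a $2$-periodic trajectory on an ellipse whose minor axis is placed along the wall, for each $(E,D)$ such that $1+2DE+4E^2=0$ and $D>2$; (3) a single closed orbit corresponding to a periodic trajectory lying on the $x_2$-axis and bounded by the point $(0,-1/E)$, when $D=2$ and $-1<E<-\frac12$; (4) a closed orbit and a separatrix, when $D=2$ and $-\frac12<E<0$; the closed orbit corresponds to a periodic trajectory lying on the $x_2$-axis and bounded by the point $\mathcal F(0,2)$ and the wall, and the separatrix contains the trajectories with elliptic arcs that contain the point $\mathcal F(0,2)$.
   Context: The Boltzmann system: a unit-mass particle moves in the plane with coordinates $(x_1,x_2)$ under the Kepler potential $-1/|\mathbf r|$ with centre of gravity at the origin, on the side $x_2\ge1$ of the wall $x_2=1$, and is reflected elastically at the wall (speed preserved, angle of incidence equals angle of reflection). Let $E=|\mathbf p|^2/2-1/|\mathbf r|$ be the energy, $L$ the angular momentum, and $\mathbf A=(A_1,A_2)=\mathbf p\times\mathbf L-\mathbf r/|\mathbf r|$ the Laplace–Runge–Lenz vector. $E$ and $D:=L^2-2A_2$ are integrals of motion; a level set is the set of points of the phase space with given values $(E,D)$. Each arc of a trajectory lies on the Kepler conic $x_1^2+x_2^2=(D+2A_2-A_1x_1-A_2x_2)^2$. Only real values of $E$, $D$ and bounded real motion are considered, i.e. the arcs are parts of ellipses or degenerate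 to straight segments ($E<0$); motion along the wall is included as a limiting case. A level set is singular if at least one of the conditions $D^2\neq4$, $1+2ED+4E^2\neq0$, $D+2E\neq0$ fails. The pairs $(E,D)$ corresponding to such motion form the infinite region $\mathcal R$ of the $(E,D)$-plane bounded by the curves $1+2DE+4E^2=0$, $E=0$, $D+2E=0$, $D=2$, together with its boundary curves; explicitly, $\mathcal R$ consists of the $(E,D)$ with $-1<E<0$, $D+2E>0$, and with $D<2$ if $E\le-\frac12$, respectively $1+2DE+4E^2>0$ if $-\frac12<E<0$. The singular level sets are placed on the boundary of $\mathcal R$ and, within $\mathcal R$, on the line $D=2$. With $R\ge0$, $R^2=1+2DE+4E^2$, the conic $\mathcal E_+$ is $$\frac{x_1^2}{\left(\frac{R+1}{2E}\right)^2-1}+\frac{(x_2-1)^2}{\left(\frac{R+1}{2E}\right)^2}=1.$$ The point $\mathcal F(0,2)$ is symmetric to the centre of gravity with respect to the wall. A trajectory is $2$-periodic if it closes after two reflections.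
   Formalization: In (4) the closed orbit is bounded by the wall and (0,-1/E), with F(0,2) strictly inside; (2) is stated for -1/2<E<0; the pairs (E,D)=(-1,2) and (-1/2,2), singular with nonempty level sets but in none of (1)-(4), are added to the list. *)

theory Defs
  imports "HOL-Analysis.Analysis"
begin

type_synonym plane = "real \<times> real"

text \<open>A phase point is a pair (position, momentum).\<close>

type_synonym phase = "plane \<times> plane"

definition wall :: "plane set" where
  "wall = {x. snd x = 1}"

definition table :: "plane set" where
  "table = {x. snd x \<ge> 1}"

definition reflect :: "plane \<Rightarrow> plane" where
  "reflect p = (fst p, - snd p)"

text \<open>
  At the wall, the incoming momentum p and the outgoing momentum \<^term>\<open>reflect p\<close> represent the same
  state of the system. Instead of forming the quotient we keep both representatives and let the
  sets of states (level sets, orbits) be closed under this identification.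
\<close>

definition phase_space :: "phase set" where
  "phase_space = {z. fst z \<in> table}"

subsection \<open>Integrals of motion\<close>

definition energy :: "phase \<Rightarrow> real" where
  "energy z = (norm (snd z))\<^sup>2 / 2 - 1 / norm (fst z)"

definition ang_mom :: "phase \<Rightarrow> real" where
  "ang_mom z = fst (fst z) * snd (snd z) - snd (fst z) * fst (snd z)"

text \<open>The cross product of (p1, p2, 0) and (0, 0, L) is (p2 L, - p1 L, 0).\<close>

definition lrl :: "phase \<Rightarrow> plane" where
  "lrl z = (snd (snd z) * ang_mom z, - fst (snd z) * ang_mom z) - fst z /\<^sub>R norm (fst z)"

definition D_int :: "phase \<Rightarrow> real" where
  "D_int z = (ang_mom z)\<^sup>2 - 2 * snd (lrl z)"

definition level_set :: "real \<Rightarrow> real \<Rightarrow> phase set" where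
  "level_set E D = {z \<in> phase_space. energy z = E \<and> D_int z = D}"

definition singular_values :: "real \<Rightarrow> real \<Rightarrow> bool" where
  "singular_values E D \<longleftrightarrow> \<not> (D\<^sup>2 \<noteq> 4 \<and> 1 + 2 * E * D + 4 * E\<^sup>2 \<noteq> 0 \<and> D + 2 * E \<noteq> 0)"

subsection \<open>Trajectories\<close>

definition kepler_force :: "plane \<Rightarrow> plane" where
  "kepler_force x = - (x /\<^sub>R (norm x) ^ 3)"

definition hits :: "(real \<Rightarrow> phase) \<Rightarrow> real set" where
  "hits z = {t. fst (z t) \<in> wall}"

text \<open>
  The momentum is normalised to be right-continuous: at a reflection time it is the outgoing one.
  Tangential contact needs no extra clause: the force at the wall points strictly out of the table,
  so a particle of the table at the wall with p2 = 0 cannot leave the wall.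
\<close>

definition bouncing_trajectory :: "(real \<Rightarrow> phase) \<Rightarrow> bool" where
  "bouncing_trajectory z \<longleftrightarrow>
     (\<forall>t. z t \<in> phase_space) \<and>
     (\<forall>a b. finite (hits z \<inter> {a..b})) \<and>
     continuous_on UNIV (\<lambda>t. fst (z t)) \<and>
     (\<forall>t. t \<notin> hits z \<longrightarrow>
        (z has_vector_derivative (snd (z t), kepler_force (fst (z t)))) (at t)) \<and>
     (\<forall>t \<in> hits z.
        ((\<lambda>s. snd (z s)) \<longlongrightarrow> snd (z t)) (at_right t) \<and>
        ((\<lambda>s. snd (z s)) \<longlongrightarrow> reflect (snd (z t))) (at_left t))"

text \<open>
  The limiting motion along the wall: reflections do not change p1, so when the height of the
  bounces tends to 0, only the component of the force tangent to the wall survives.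
\<close>

definition wall_trajectory :: "(real \<Rightarrow> phase) \<Rightarrow> bool" where
  "wall_trajectory z \<longleftrightarrow>
     (\<forall>t. fst (z t) \<in> wall \<and> snd (snd (z t)) = 0 \<and>
        (z has_vector_derivative (snd (z t), (fst (kepler_force (fst (z t))), 0))) (at t))"

definition trajectory :: "(real \<Rightarrow> phase) \<Rightarrow> bool" where
  "trajectory z \<longleftrightarrow> bouncing_trajectory z \<or> wall_trajectory z"

definition orbit :: "(real \<Rightarrow> phase) \<Rightarrow> phase set" where
  "orbit z = range z \<union> {(x, reflect p) | x p. (x, p) \<in> range z \<and> x \<in> wall}"

definition positions :: "(real \<Rightarrow> phase) \<Rightarrow> plane set" where
  "positions z = range (\<lambda>t. fst (z t))"

definition has_period :: "(real \<Rightarrow> phase) \<Rightarrow> real \<Rightarrow> bool" where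
  "has_period z T \<longleftrightarrow> T > 0 \<and> (\<forall>t. z (t + T) = z t)"

text \<open>A closed orbit is the orbit of a periodic trajectory; equilibria are not counted.\<close>

definition periodic_trajectory :: "(real \<Rightarrow> phase) \<Rightarrow> bool" where
  "periodic_trajectory z \<longleftrightarrow> trajectory z \<and> (\<exists>T. has_period z T) \<and> \<not> z constant_on UNIV"

text \<open>The trajectory closes for the first time after n reflections.\<close>

definition n_periodic :: "nat \<Rightarrow> (real \<Rightarrow> phase) \<Rightarrow> bool" where
  "n_periodic n z \<longleftrightarrow> bouncing_trajectory z \<and>
     (\<exists>T. has_period z T \<and> (\<forall>S. has_period z S \<longrightarrow> T \<le> S) \<and> card (hits z \<inter> {0..<T}) = n)"

text \<open>
  The separatrix of a closed orbit: the states outside the closed orbit whose trajectories are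
  asymptotic to it both in the future and in the past.
\<close>

definition separatrix :: "phase set \<Rightarrow> phase set" where
  "separatrix \<gamma> = {w \<in> phase_space - \<gamma>. \<exists>z. trajectory z \<and> w \<in> orbit z \<and>
     ((\<lambda>t. infdist (z t) \<gamma>) \<longlongrightarrow> 0) at_top \<and> ((\<lambda>t. infdist (z t) \<gamma>) \<longlongrightarrow> 0) at_bot}"

subsection \<open>Ellipses\<close>

definition ellipse :: "plane \<Rightarrow> plane \<Rightarrow> real \<Rightarrow> plane set" where
  "ellipse f1 f2 s = {x. dist x f1 + dist x f2 = s}"

text \<open>The straight segments (s equal to the distance of the foci) are excluded.\<close>

definition is_ellipse :: "plane set \<Rightarrow> bool" where
  "is_ellipse C \<longleftrightarrow> (\<exists>f1 f2 s. dist f1 f2 < s \<and> C = ellipse f1 f2 s)"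

text \<open>
  Ellipses with axes parallel to the coordinate axes: centre c, squared semi-axes u (horizontal)
  and v (vertical).
\<close>

definition axis_ellipse :: "plane \<Rightarrow> real \<Rightarrow> real \<Rightarrow> plane set" where
  "axis_ellipse c u v = {x. (fst x - fst c)\<^sup>2 / u + (snd x - snd c)\<^sup>2 / v = 1}"

definition is_minor_axis :: "plane set \<Rightarrow> plane set \<Rightarrow> bool" where
  "is_minor_axis M C \<longleftrightarrow> (\<exists>c u v. u > 0 \<and> v > 0 \<and> C = axis_ellipse c u v \<and>
     (u < v \<and> M = closed_segment (c - (sqrt u, 0)) (c + (sqrt u, 0)) \<or>
      v < u \<and> M = closed_segment (c - (0, sqrt v)) (c + (0, sqrt v))))"

definition E_plus :: "real \<Rightarrow> real \<Rightarrow> plane set" where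
  "E_plus E D = (let R = sqrt (1 + 2 * D * E + 4 * E\<^sup>2) in
     {x. (fst x)\<^sup>2 / (((R + 1) / (2 * E))\<^sup>2 - 1) + (snd x - 1)\<^sup>2 / ((R + 1) / (2 * E))\<^sup>2 = 1})"

definition F_pt :: plane where
  "F_pt = (0, 2)"

text \<open>The pieces of the path between two consecutive reflections.\<close>

definition arcs :: "(real \<Rightarrow> phase) \<Rightarrow> plane set set" where
  "arcs z = {(\<lambda>t. fst (z t)) ` {a..b} | a b.
     a \<in> hits z \<and> b \<in> hits z \<and> a < b \<and> hits z \<inter> {a<..<b} = {}}"

definition elliptic_arc :: "plane set \<Rightarrow> bool" where
  "elliptic_arc A \<longleftrightarrow> (\<exists>C. is_ellipse C \<and> A \<subseteq> C)"

end

theory Submission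
  imports Defs
begin

text \<open>
  Three identities decide which level sets are singular and what they look like. First, D + 2 E is a
  sum of nonnegative terms that vanishes only for motion along the wall (\<open>D_plus_2E\<close>). Second, the
  second focus A / E of the Kepler conic lies on a circle about the mirror point F = (0, 2) of the
  centre, and 1 + 2 E D + 4 E^2 is E^2 times the square of its radius (\<open>lrl_circle\<close>); if it
  vanishes, all arcs lie on one ellipse with foci (0, 0) and F. Third, if D = 2, then
  4 A1^2 + L^4 = 4 (2 E + 1) L^2 (\<open>lrl_ang_mom_quartic\<close>). So L = 0 if E < - 1/2, and L = 0 means
  motion on the vertical axis.

  The trajectories are constructed explicitly. In the fictitious time s with dt = r ds a Kepler motion
  is a harmonic oscillation. The vertical momentum is periodic in s and decreases above the wall, so
  every flight ends on the wall (\<open>height_returns\<close>). If D + 2 E > 0, it ends transversally, the return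
  map of the outgoing wall states is onto, and the flight times are bounded below. Hence every outgoing
  state has a bi-infinite sequence of flights, and these are glued to a bouncing trajectory. Since every
  point of a level set lies on a flight from the wall (\<open>level_set_cover\<close>), a level set is a single
  orbit if one itinerary visits all its outgoing states. On the ellipse with foci (0, 0) and F there are
  two such states, exchanged by the return map; on the vertical axis there is one. The motion along the
  wall is obtained from a parametrisation of its energy curve by an angle and the inverse function of
  the time.

  For D = 2 and E > - 1/2 every arc off the vertical axis starts and ends on different sides of the
  axis, and it can cross the axis only at F (\<open>flight_passes_F\<close>). Let \<phi> be the angle between the velocity
  at F and the vertical. The wall states form a rational curve, and in a suitable parameter of it a
  reflection multiplies tan (\<phi> / 2) by the constant - (w + v)^2 < - 1, where w^2 = 2 + 2 E and
  v^2 = 1 + 2 E (\<open>tau_refl_state\<close>). So its absolute value tends to infinity in the future and to 0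
  in the past.
  In both directions L tends to 0, and by compactness of the level set the trajectory tends to the
  vertical orbit. Conversely, a trajectory asymptotic to the vertical orbit has the same integrals of
  motion, and a trajectory with elliptic arcs never meets the vertical orbit, because an ellipse
  contains no segment.
\<close>

section \<open>The integrals of motion\<close>

lemma norm_plane: "norm (x :: plane) = sqrt ((fst x)\<^sup>2 + (snd x)\<^sup>2)"
  by (simp add: norm_prod_def)

lemma norm_plane_sq: "(norm (x :: plane))\<^sup>2 = (fst x)\<^sup>2 + (snd x)\<^sup>2"
  by (simp add: norm_plane)

lemma snd_le_norm: "snd (x :: plane) \<le> norm x"
  unfolding norm_plane by (rule real_le_rsqrt) simp

lemma table_norm_ge_1: "snd x \<ge> 1 \<Longrightarrow> norm (x :: plane) \<ge> 1"
  using snd_le_norm[of x] by linarith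

definition cross :: "plane \<Rightarrow> plane \<Rightarrow> real" where
  "cross u v = fst u * snd v - snd u * fst v"

lemma ang_mom_cross: "ang_mom w = cross (fst w) (snd w)"
  by (simp add: ang_mom_def cross_def)

lemma cross_linear:
  "cross (u + v) w = cross u w + cross v w" "cross u (v + w) = cross u v + cross u w"
  "cross (c *\<^sub>R u) v = c * cross u v" "cross u (c *\<^sub>R v) = c * cross u v"
  "cross (u - v) w = cross u w - cross v w" "cross u (v - w) = cross u v - cross u w"
  "cross u u = 0" "cross u v = - cross v u"
  by (simp_all add: cross_def algebra_simps)

lemma lagrange_identity: "(u \<bullet> v)\<^sup>2 + (cross u v)\<^sup>2 = (u \<bullet> u) * (v \<bullet> v)" for u v :: plane
  by (simp add: cross_def inner_prod_def power2_eq_square algebra_simps)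

lemma lrl_coords:
  "fst (lrl w) = snd (snd w) * ang_mom w - fst (fst w) / norm (fst w)"
  "snd (lrl w) = - fst (snd w) * ang_mom w - snd (fst w) / norm (fst w)"
  by (simp_all add: lrl_def divide_inverse mult.commute)

lemma momentum_sq: "snd w \<bullet> snd w = 2 * energy w + 2 / norm (fst w)"
  by (simp add: energy_def dot_square_norm field_simps)

text \<open>By the expansion p \<times> (x \<times> p) = (p \<bullet> p) x - (x \<bullet> p) p. In this form the
  vector needs no coordinates, and its products with position and momentum come from the Lagrange
  identity.\<close>

lemma lrl_momentum_form:
  "lrl w = (snd w \<bullet> snd w - 1 / norm (fst w)) *\<^sub>R fst w - (fst w \<bullet> snd w) *\<^sub>R snd w"
  by (rule prod_eqI)
    (simp_all add: lrl_coords ang_mom_def inner_prod_def algebra_simps divide_inverse)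

text \<open>The first product is the polar equation of the conic; the third says that the norm of the vector is
  the eccentricity.\<close>

lemma lrl_products:
  assumes "fst w \<noteq> 0"
  shows "lrl w \<bullet> fst w = (ang_mom w)\<^sup>2 - norm (fst w)"
    and "lrl w \<bullet> snd w = - (fst w \<bullet> snd w) / norm (fst w)"
    and "lrl w \<bullet> lrl w = 1 + 2 * energy w * (ang_mom w)\<^sup>2"
    and "cross (lrl w) (fst w) = ang_mom w * (fst w \<bullet> snd w)"
    and "cross (lrl w) (snd w) = ang_mom w * (2 * energy w + 1 / norm (fst w))"
proof -
  define r where "r = norm (fst w)"
  define x where "x = fst w"
  define p where "p = snd w"
  define \<sigma> where "\<sigma> = x \<bullet> p"
  define L where "L = cross x p"
  define P where "P = p \<bullet> p"
  have r: "r > 0" and xx: "x \<bullet> x = r * r"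
    using assms by (auto simp: r_def x_def dot_square_norm power2_eq_square)
  have LP: "L\<^sup>2 = r * r * P - \<sigma>\<^sup>2"
    using lagrange_identity[of x p] xx by (simp add: P_def \<sigma>_def L_def)
  have A: "lrl w = (P - 1 / r) *\<^sub>R x - \<sigma> *\<^sub>R p"
    by (simp add: lrl_momentum_form P_def r_def \<sigma>_def x_def p_def)
  have Ax: "lrl w \<bullet> x = L\<^sup>2 - r"
  proof -
    have "lrl w \<bullet> x = (P - 1 / r) * (r * r) - \<sigma> * \<sigma>"
      by (simp add: A inner_diff_left xx \<sigma>_def inner_commute[of p x])
    also have "(P - 1 / r) * (r * r) = r * r * P - r" using r by (simp add: field_simps)
    finally show ?thesis using LP by (simp add: power2_eq_square)
  qed
  then show "lrl w \<bullet> fst w = (ang_mom w)\<^sup>2 - norm (fst w)"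
    by (simp add: ang_mom_cross L_def x_def p_def r_def)
  have Ap: "lrl w \<bullet> p = - \<sigma> / r"
  proof -
    have "lrl w \<bullet> p = (P - 1 / r) * \<sigma> - \<sigma> * P"
      by (simp add: A inner_diff_left P_def \<sigma>_def)
    then show ?thesis by (simp add: left_diff_distrib)
  qed
  then show "lrl w \<bullet> snd w = - (fst w \<bullet> snd w) / norm (fst w)"
    by (simp add: p_def r_def \<sigma>_def x_def)
  have PE: "P = 2 * energy w + 2 / r"
    by (simp add: P_def p_def r_def momentum_sq)
  have "lrl w \<bullet> lrl w = (P - 1 / r) * (L\<^sup>2 - r) + \<sigma>\<^sup>2 / r"
    using Ax Ap by (subst (2) A) (simp add: inner_diff_right power2_eq_square)
  also have "\<dots> = (P - 1 / r) * (L\<^sup>2 - r) + (r * r * P - L\<^sup>2) / r"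
    using LP by simp
  also have "\<dots> = 1 + (P - 2 / r) * L\<^sup>2"
    using r by (simp add: field_simps)
  finally show "lrl w \<bullet> lrl w = 1 + 2 * energy w * (ang_mom w)\<^sup>2"
    by (simp add: PE L_def ang_mom_cross x_def p_def)
  show "cross (lrl w) (fst w) = ang_mom w * (fst w \<bullet> snd w)"
    unfolding A x_def[symmetric] ang_mom_cross p_def[symmetric] \<sigma>_def[symmetric]
    by (simp add: cross_def algebra_simps)
  have "cross (lrl w) p = L * (P - 1 / r)"
    unfolding A by (simp add: cross_linear(3,5,7) L_def)
  then show "cross (lrl w) (snd w) = ang_mom w * (2 * energy w + 1 / norm (fst w))"
    by (simp add: PE L_def ang_mom_cross x_def p_def r_def)
qed

text \<open>The second focus of the conic is A / E, so it moves on a circle about the mirror point (0, 2) of the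
  centre of gravity. On the singular set 1 + 2 E D + 4 E^2 = 0 this circle is a point.\<close>

lemma lrl_circle:
  assumes "fst w \<noteq> 0"
  shows "(fst (lrl w))\<^sup>2 + (snd (lrl w) - 2 * energy w)\<^sup>2 =
      1 + 2 * energy w * D_int w + 4 * (energy w)\<^sup>2"
  using lrl_products(3)[OF assms]
  by (simp add: D_int_def inner_prod_def power2_eq_square algebra_simps)

text \<open>On the table this is a sum of nonnegative terms. It vanishes only when the particle is on the wall
  and moves along it.\<close>

lemma D_plus_2E:
  assumes "fst w \<noteq> 0"
  shows "D_int w + 2 * energy w = (ang_mom w + fst (snd w))\<^sup>2 + (snd (snd w))\<^sup>2
      + 2 * (snd (fst w) - 1) / norm (fst w)"
  using momentum_sq[of w] assms
  by (simp add: D_int_def lrl_coords inner_prod_def power2_eq_square field_simps)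

section \<open>The Kepler flow in fictitious time\<close>

text \<open>With the fictitious time s, dt = r ds, a Kepler motion of negative energy becomes linear:
  x'' = - k^2 x - A and r'' = - k^2 r + 1, where k is the frequency below. So x oscillates about
  - A / k^2 and r about 1 / k^2; the four functions after it are the coefficients of cosine
  and sine.\<close>

definition freq :: "phase \<Rightarrow> real" where
  "freq w = sqrt (- 2 * energy w)"

definition cos_amp :: "phase \<Rightarrow> plane" where
  "cos_amp w = fst w + (1 / (freq w)\<^sup>2) *\<^sub>R lrl w"

definition sin_amp :: "phase \<Rightarrow> plane" where
  "sin_amp w = (norm (fst w) / freq w) *\<^sub>R snd w"

definition cos_rad :: "phase \<Rightarrow> real" where
  "cos_rad w = norm (fst w) - 1 / (freq w)\<^sup>2"

definition sin_rad :: "phase \<Rightarrow> real" where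
  "sin_rad w = (fst w \<bullet> snd w) / freq w"

text \<open>These relations between the coefficients of a state are stable under the rotations that generate
  the motion, and they determine the invariants of the state. So the conservation laws and the group
  property of the explicit flow become algebra: a state gives a frame, a frame is rotated, a frame
  gives back a state.\<close>

definition kepler_frame :: "real \<Rightarrow> real \<Rightarrow> plane \<Rightarrow> plane \<Rightarrow> plane \<Rightarrow> real \<Rightarrow> real \<Rightarrow> bool" where
  "kepler_frame k L A \<xi> \<eta> \<alpha> \<beta> \<longleftrightarrow>
     \<xi> \<bullet> \<xi> = \<alpha>\<^sup>2 + L\<^sup>2 / k\<^sup>2 \<and> \<eta> \<bullet> \<eta> = \<beta>\<^sup>2 + L\<^sup>2 / k\<^sup>2 \<and> \<xi> \<bullet> \<eta> = \<alpha> * \<beta> \<and>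
     A \<bullet> \<xi> = - \<alpha> \<and> A \<bullet> \<eta> = - \<beta> \<and> A \<bullet> A = 1 - k\<^sup>2 * L\<^sup>2 \<and>
     A = (- (k ^ 4)) *\<^sub>R (\<alpha> *\<^sub>R \<xi> + \<beta> *\<^sub>R \<eta>) \<and>
     cross A \<xi> = k * L * \<beta> \<and> cross A \<eta> = - (k * L * \<alpha>) \<and> cross \<xi> \<eta> = L / k ^ 3 \<and>
     \<alpha>\<^sup>2 + \<beta>\<^sup>2 = 1 / k ^ 4 - L\<^sup>2 / k\<^sup>2"

lemma freq_sq: "energy w < 0 \<Longrightarrow> (freq w)\<^sup>2 = - 2 * energy w"
  and freq_pos: "energy w < 0 \<Longrightarrow> freq w > 0"
  by (simp_all add: freq_def)

lemma state_kepler_frame: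
  assumes "fst w \<noteq> 0" "energy w < 0"
  shows "kepler_frame (freq w) (ang_mom w) (lrl w) (cos_amp w) (sin_amp w) (cos_rad w) (sin_rad w)"
proof -
  define k where "k = freq w"
  define r where "r = norm (fst w)"
  define x where "x = fst w"
  define p where "p = snd w"
  define A where "A = lrl w"
  define L where "L = ang_mom w"
  define \<sigma> where "\<sigma> = x \<bullet> p"
  have k: "k > 0" "2 * energy w = - (k\<^sup>2)"
    using assms freq_pos freq_sq[of w] by (auto simp: k_def)
  have r: "r > 0" using assms by (simp add: r_def)
  have xx: "x \<bullet> x = r\<^sup>2" by (simp add: x_def r_def dot_square_norm)
  have pp: "p \<bullet> p = 2 / r - k\<^sup>2" using momentum_sq[of w] k by (simp add: p_def r_def)
  have LL: "L\<^sup>2 = 2 * r - k\<^sup>2 * r\<^sup>2 - \<sigma>\<^sup>2"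
  proof -
    have "\<sigma>\<^sup>2 + L\<^sup>2 = r\<^sup>2 * (2 / r - k\<^sup>2)"
      using lagrange_identity[of x p] xx pp
      by (simp add: L_def ang_mom_cross x_def[symmetric] p_def[symmetric] \<sigma>_def)
    also have "\<dots> = 2 * r - k\<^sup>2 * r\<^sup>2" using r by (simp add: field_simps power2_eq_square)
    finally show ?thesis by simp
  qed
  note pr = lrl_products[OF assms(1), unfolded k, folded k_def r_def x_def p_def A_def L_def \<sigma>_def]
  have \<xi>: "cos_amp w = x + (1 / k\<^sup>2) *\<^sub>R A" and \<eta>: "sin_amp w = (r / k) *\<^sub>R p"
    and \<alpha>: "cos_rad w = r - 1 / k\<^sup>2" and \<beta>: "sin_rad w = \<sigma> / k"
    by (simp_all add: cos_amp_def sin_amp_def cos_rad_def sin_rad_def k_def r_def x_def p_def A_def \<sigma>_def)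
  have A: "A = (1 / r - k\<^sup>2) *\<^sub>R x - \<sigma> *\<^sub>R p"
    using lrl_momentum_form[of w] pp by (simp add: A_def x_def p_def r_def \<sigma>_def)
  have xA: "x \<bullet> A = L\<^sup>2 - r" using pr(1) by (simp add: inner_commute)
  have xp: "x \<bullet> p = \<sigma>" by (simp add: \<sigma>_def)
  have cxp: "cross x p = L" by (simp add: L_def ang_mom_cross x_def p_def)
  have 1: "cos_amp w \<bullet> cos_amp w = (cos_rad w)\<^sup>2 + L\<^sup>2 / k\<^sup>2"
    using k unfolding \<xi> \<alpha>
    by (simp add: inner_add_left inner_add_right xx pr xA) (simp add: field_simps power2_eq_square)
  have 2: "sin_amp w \<bullet> sin_amp w = (sin_rad w)\<^sup>2 + L\<^sup>2 / k\<^sup>2"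
  proof -
    have "(\<sigma> / k)\<^sup>2 = (2 * r - k\<^sup>2 * r\<^sup>2 - L\<^sup>2) / k\<^sup>2"
      by (simp add: power_divide LL)
    then show ?thesis
      unfolding \<eta> \<beta> using k(1) r
      by (simp add: pp) (simp add: field_simps power2_eq_square)
  qed
  have 3: "cos_amp w \<bullet> sin_amp w = cos_rad w * sin_rad w"
    unfolding \<xi> \<eta> \<alpha> \<beta> using k r
    by (simp add: inner_add_left pr xp) (simp add: field_simps power2_eq_square)
  have 4: "A \<bullet> cos_amp w = - cos_rad w"
    unfolding \<xi> \<alpha> using k r
    by (simp add: inner_add_right pr) (simp add: field_simps power2_eq_square)
  have 5: "A \<bullet> sin_amp w = - sin_rad w"
    unfolding \<eta> \<beta> using k r by (simp add: pr xp)
  have 6: "A = (- (k ^ 4)) *\<^sub>R (cos_rad w *\<^sub>R cos_amp w + sin_rad w *\<^sub>R sin_amp w)"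
  proof -
    have e1: "- (k ^ 4) * ((r - 1 / k\<^sup>2) * (1 / k\<^sup>2)) = - (k\<^sup>2 * r - 1)"
      using k by (simp add: field_simps power2_eq_square power4_eq_xxxx)
    have e2: "- (k ^ 4) * (r - 1 / k\<^sup>2) = - (k\<^sup>2 * (k\<^sup>2 * r - 1))"
      using k by (simp add: field_simps power2_eq_square power4_eq_xxxx)
    have e3: "- (k ^ 4) * (\<sigma> / k * (r / k)) = - (k\<^sup>2 * r * \<sigma>)"
      using k by (simp add: field_simps power2_eq_square power4_eq_xxxx)
    have "(- (k ^ 4)) *\<^sub>R (cos_rad w *\<^sub>R cos_amp w + sin_rad w *\<^sub>R sin_amp w) =
        - ((k\<^sup>2 * (k\<^sup>2 * r - 1)) *\<^sub>R x + (k\<^sup>2 * r - 1) *\<^sub>R A + (k\<^sup>2 * r * \<sigma>) *\<^sub>R p)"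
      unfolding \<xi> \<eta> \<alpha> \<beta>
      by (simp only: scaleR_add_right scaleR_scaleR mult.assoc e1 e2 e3[unfolded mult.assoc]
          scaleR_minus_left minus_add_distrib)
    also have "\<dots> = A - k\<^sup>2 *\<^sub>R ((k\<^sup>2 * r - 1) *\<^sub>R x + r *\<^sub>R A + (r * \<sigma>) *\<^sub>R p)"
      by (simp add: algebra_simps)
    also have "(k\<^sup>2 * r - 1) *\<^sub>R x + r *\<^sub>R A + (r * \<sigma>) *\<^sub>R p = 0"
      unfolding A using r by (simp add: algebra_simps)
    finally show ?thesis by simp
  qed
  have 7: "cross A (cos_amp w) = k * L * sin_rad w"
    unfolding \<xi> \<beta> using k by (simp add: cross_linear(2,4,7) pr xp)
  have 8: "cross A (sin_amp w) = - (k * L * cos_rad w)"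
    unfolding \<eta> \<alpha> using k r
    by (simp add: cross_linear(2,4,7) pr) (simp add: field_simps power2_eq_square)
  have 9: "cross (cos_amp w) (sin_amp w) = L / k ^ 3"
    unfolding \<xi> \<eta> using k r
    by (simp add: cross_linear(1,3,4,7) pr cxp) (simp add: field_simps power2_eq_square power3_eq_cube)
  have 10: "(cos_rad w)\<^sup>2 + (sin_rad w)\<^sup>2 = 1 / k ^ 4 - L\<^sup>2 / k\<^sup>2"
  proof -
    have "(\<sigma> / k)\<^sup>2 = (2 * r - k\<^sup>2 * r\<^sup>2 - L\<^sup>2) / k\<^sup>2"
      by (simp add: power_divide LL)
    then show ?thesis
      unfolding \<alpha> \<beta> using k(1) r
      by simp (simp add: field_simps power2_eq_square power4_eq_xxxx)
  qed
  show ?thesis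
    unfolding kepler_frame_def k_def[symmetric] L_def[symmetric] A_def[symmetric]
    using 1 2 3 4 5 pr(3) 6 7 8 9 10 by simp
qed

lemma kepler_frame_state:
  assumes fr: "kepler_frame k L A \<xi> \<eta> \<alpha> \<beta>" and k: "k > 0" and r: "r = \<alpha> + 1 / k\<^sup>2" "r > 0"
    and w: "w = (\<xi> - (1 / k\<^sup>2) *\<^sub>R A, (k / r) *\<^sub>R \<eta>)"
  shows "norm (fst w) = r" "energy w = - k\<^sup>2 / 2" "freq w = k" "ang_mom w = L" "lrl w = A"
    "cos_amp w = \<xi>" "sin_amp w = \<eta>" "cos_rad w = \<alpha>" "sin_rad w = \<beta>"
proof -
  have F: "\<xi> \<bullet> \<xi> = \<alpha>\<^sup>2 + L\<^sup>2 / k\<^sup>2" "\<eta> \<bullet> \<eta> = \<beta>\<^sup>2 + L\<^sup>2 / k\<^sup>2" "\<xi> \<bullet> \<eta> = \<alpha> * \<beta>"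
     "A \<bullet> \<xi> = - \<alpha>" "A \<bullet> \<eta> = - \<beta>" "A \<bullet> A = 1 - k\<^sup>2 * L\<^sup>2"
     "A = (- (k ^ 4)) *\<^sub>R (\<alpha> *\<^sub>R \<xi> + \<beta> *\<^sub>R \<eta>)"
     "cross A \<xi> = k * L * \<beta>" "cross A \<eta> = - (k * L * \<alpha>)" "cross \<xi> \<eta> = L / k ^ 3"
     "\<alpha>\<^sup>2 + \<beta>\<^sup>2 = 1 / k ^ 4 - L\<^sup>2 / k\<^sup>2"
    using fr unfolding kepler_frame_def by blast+
  have \<alpha>: "\<alpha> = r - 1 / k\<^sup>2" using r by simp
  have "fst w \<bullet> fst w = r\<^sup>2"
    unfolding w using k F(4)
    by (simp add: inner_diff_left inner_diff_right F(1,6) inner_commute[of \<xi> A] r(1))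
      (simp add: field_simps power2_eq_square)
  then show n: "norm (fst w) = r"
    using r by (simp add: norm_eq_sqrt_inner)
  have \<sigma>: "fst w \<bullet> snd w = k * \<beta>"
    unfolding w using k r(2) F(5)
    by (simp add: inner_diff_left F(3) \<alpha>) (simp add: field_simps power2_eq_square)
  have \<beta>: "\<beta>\<^sup>2 = 1 / k ^ 4 - L\<^sup>2 / k\<^sup>2 - (r - 1 / k\<^sup>2)\<^sup>2"
    using F(11) \<alpha> by simp
  have P: "snd w \<bullet> snd w = 2 / r - k\<^sup>2"
    unfolding w using k r(2)
    by (simp add: F(2) \<beta>) (simp add: field_simps power2_eq_square power4_eq_xxxx)
  show E: "energy w = - k\<^sup>2 / 2"
    using momentum_sq[of w] P n by simp
  show fw: "freq w = k" using k by (simp add: freq_def E real_sqrt_abs)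
  show "ang_mom w = L"
    unfolding ang_mom_cross w using k r(2)
    by (simp add: cross_linear(3,4,5) F(9,10) \<alpha>)
      (simp add: field_simps power2_eq_square power3_eq_cube)
  have "lrl w = (1 / r - k\<^sup>2) *\<^sub>R fst w - (k * \<beta>) *\<^sub>R snd w"
    using lrl_momentum_form[of w] by (simp add: P n \<sigma>)
  also have "\<dots> = A"
  proof -
    have "r *\<^sub>R ((1 / r - k\<^sup>2) *\<^sub>R fst w - (k * \<beta>) *\<^sub>R snd w) =
      (1 - k\<^sup>2 * r) *\<^sub>R (\<xi> - (1 / k\<^sup>2) *\<^sub>R A) - (k\<^sup>2 * \<beta>) *\<^sub>R \<eta>"
      using r(2) by (simp add: w scaleR_diff_right right_diff_distrib power2_eq_square mult_ac)
    also have "1 - k\<^sup>2 * r = - (k\<^sup>2 * \<alpha>)" using k by (simp add: \<alpha> field_simps)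
    also have "(- (k\<^sup>2 * \<alpha>)) *\<^sub>R (\<xi> - (1 / k\<^sup>2) *\<^sub>R A) - (k\<^sup>2 * \<beta>) *\<^sub>R \<eta> =
       \<alpha> *\<^sub>R A - k\<^sup>2 *\<^sub>R (\<alpha> *\<^sub>R \<xi> + \<beta> *\<^sub>R \<eta>)"
      using k by (simp add: algebra_simps)
    also have "k\<^sup>2 *\<^sub>R (\<alpha> *\<^sub>R \<xi> + \<beta> *\<^sub>R \<eta>) = (- 1 / k\<^sup>2) *\<^sub>R A"
      using k by (subst F(7)) (simp add: power2_eq_square power4_eq_xxxx)
    also have "\<alpha> *\<^sub>R A - (- 1 / k\<^sup>2) *\<^sub>R A = r *\<^sub>R A"
      by (simp add: r(1) scaleR_add_left)
    finally show ?thesis using r(2) by simp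
  qed
  finally show l: "lrl w = A" .
  show "cos_amp w = \<xi>" unfolding cos_amp_def fw l by (simp add: w)
  show "sin_amp w = \<eta>" unfolding sin_amp_def fw n using k r(2) by (simp add: w)
  show "cos_rad w = \<alpha>" by (simp add: cos_rad_def fw n \<alpha>)
  show "sin_rad w = \<beta>" using k by (simp add: sin_rad_def fw \<sigma>)
qed

text \<open>A common rotation of (\<xi>, \<eta>) and (\<alpha>, \<beta>) turns each relation into a linear combination of the
  relations.\<close>

lemma kepler_frame_rotate:
  assumes fr: "kepler_frame k L A \<xi> \<eta> \<alpha> \<beta>" and cs: "c\<^sup>2 + d\<^sup>2 = 1"
  shows "kepler_frame k L A (c *\<^sub>R \<xi> + d *\<^sub>R \<eta>) (c *\<^sub>R \<eta> - d *\<^sub>R \<xi>) (c * \<alpha> + d * \<beta>) (c * \<beta> - d * \<alpha>)"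
proof -
  have F: "\<xi> \<bullet> \<xi> = \<alpha>\<^sup>2 + L\<^sup>2 / k\<^sup>2" "\<eta> \<bullet> \<eta> = \<beta>\<^sup>2 + L\<^sup>2 / k\<^sup>2" "\<xi> \<bullet> \<eta> = \<alpha> * \<beta>"
     "A \<bullet> \<xi> = - \<alpha>" "A \<bullet> \<eta> = - \<beta>" "A \<bullet> A = 1 - k\<^sup>2 * L\<^sup>2"
     "A = (- (k ^ 4)) *\<^sub>R (\<alpha> *\<^sub>R \<xi> + \<beta> *\<^sub>R \<eta>)"
     "cross A \<xi> = k * L * \<beta>" "cross A \<eta> = - (k * L * \<alpha>)" "cross \<xi> \<eta> = L / k ^ 3"
     "\<alpha>\<^sup>2 + \<beta>\<^sup>2 = 1 / k ^ 4 - L\<^sup>2 / k\<^sup>2"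
    using fr unfolding kepler_frame_def by blast+
  have F': "\<eta> \<bullet> \<xi> = \<alpha> * \<beta>" "cross \<eta> \<xi> = - (L / k ^ 3)"
    using F(3,10) cross_linear(8)[of \<eta> \<xi>] by (simp_all add: inner_commute)
  have c: "c * c = 1 - d * d" using cs by (simp add: power2_eq_square)
  define M where "M = L\<^sup>2 / k\<^sup>2"
  define N where "N = L / k ^ 3"
  have c': "c * (c * u) = u - d * (d * u)" for u
    using c by (metis left_diff_distrib mult.assoc mult_1)
  note sm = inner_add_left inner_add_right inner_diff_left inner_diff_right F(1-6) F'
      cross_linear(1-7) F(8-10) M_def[symmetric] N_def[symmetric] power2_eq_square[of \<alpha>]
      power2_eq_square[of \<beta>] power2_eq_square[of "_ + _"] power2_eq_square[of "_ - _"]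
  have 6: "A = (- (k ^ 4)) *\<^sub>R ((c * \<alpha> + d * \<beta>) *\<^sub>R (c *\<^sub>R \<xi> + d *\<^sub>R \<eta>) + (c * \<beta> - d * \<alpha>) *\<^sub>R (c *\<^sub>R \<eta> - d *\<^sub>R \<xi>))"
  proof -
    have "(c * \<alpha> + d * \<beta>) *\<^sub>R (c *\<^sub>R \<xi> + d *\<^sub>R \<eta>) + (c * \<beta> - d * \<alpha>) *\<^sub>R (c *\<^sub>R \<eta> - d *\<^sub>R \<xi>)
        = (c\<^sup>2 + d\<^sup>2) *\<^sub>R (\<alpha> *\<^sub>R \<xi> + \<beta> *\<^sub>R \<eta>)"
      by (simp add: algebra_simps power2_eq_square)
    then show ?thesis using F(7) cs by simp
  qed
  have 10: "(c * \<alpha> + d * \<beta>)\<^sup>2 + (c * \<beta> - d * \<alpha>)\<^sup>2 = 1 / k ^ 4 - L\<^sup>2 / k\<^sup>2"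
  proof -
    have "(c * \<alpha> + d * \<beta>)\<^sup>2 + (c * \<beta> - d * \<alpha>)\<^sup>2 = (c\<^sup>2 + d\<^sup>2) * (\<alpha>\<^sup>2 + \<beta>\<^sup>2)"
      by (simp add: algebra_simps power2_eq_square)
    then show ?thesis using F(11) cs by simp
  qed
  show ?thesis
    unfolding kepler_frame_def
    apply (intro conjI)
    subgoal by (simp add: sm) (simp add: algebra_simps c c')
    subgoal by (simp add: sm) (simp add: algebra_simps c c')
    subgoal by (simp add: sm) (simp add: algebra_simps c c')
    subgoal by (simp add: sm)
    subgoal by (simp add: sm)
    subgoal by (simp add: sm)
    subgoal by (rule 6)
    subgoal by (simp add: sm) (simp add: algebra_simps c c')
    subgoal by (simp add: sm) (simp add: algebra_simps c c')
    subgoal by (simp add: sm) (simp add: algebra_simps c c')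
    subgoal by (rule 10)
    done
qed

definition flow_cos :: "phase \<Rightarrow> real \<Rightarrow> plane" where
  "flow_cos w s = cos (freq w * s) *\<^sub>R cos_amp w + sin (freq w * s) *\<^sub>R sin_amp w"

definition flow_sin :: "phase \<Rightarrow> real \<Rightarrow> plane" where
  "flow_sin w s = cos (freq w * s) *\<^sub>R sin_amp w - sin (freq w * s) *\<^sub>R cos_amp w"

definition flow_rad :: "phase \<Rightarrow> real \<Rightarrow> real" where
  "flow_rad w s = cos (freq w * s) * cos_rad w + sin (freq w * s) * sin_rad w + 1 / (freq w)\<^sup>2"

definition flow :: "phase \<Rightarrow> real \<Rightarrow> phase" where
  "flow w s = (flow_cos w s - (1 / (freq w)\<^sup>2) *\<^sub>R lrl w, (freq w / flow_rad w s) *\<^sub>R flow_sin w s)"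

lemma flow_frame:
  assumes "fst w \<noteq> 0" "energy w < 0"
  shows "kepler_frame (freq w) (ang_mom w) (lrl w) (flow_cos w s) (flow_sin w s)
     (cos (freq w * s) * cos_rad w + sin (freq w * s) * sin_rad w)
     (cos (freq w * s) * sin_rad w - sin (freq w * s) * cos_rad w)"
  unfolding flow_cos_def flow_sin_def
  by (rule kepler_frame_rotate[OF state_kepler_frame[OF assms]]) simp

text \<open>The two explicit formulas are compatible up to sign. The sign is right since the amplitude of r is
  at most its mean value 1 / k^2.\<close>

lemma norm_flow:
  assumes "fst w \<noteq> 0" "energy w < 0"
  shows "norm (fst (flow w s)) = flow_rad w s"
proof -
  define k where "k = freq w"
  define \<alpha> where "\<alpha> = cos (k * s) * cos_rad w + sin (k * s) * sin_rad w"
  define \<beta> where "\<beta> = cos (k * s) * sin_rad w - sin (k * s) * cos_rad w"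
  note fr = flow_frame[OF assms, of s, folded k_def, folded \<alpha>_def \<beta>_def, unfolded kepler_frame_def]
  have k: "k > 0" using assms freq_pos by (simp add: k_def)
  have fr_rad: "flow_rad w s = \<alpha> + 1 / k\<^sup>2"
    by (simp add: flow_rad_def \<alpha>_def k_def)
  have F: "flow_cos w s \<bullet> flow_cos w s = \<alpha>\<^sup>2 + (ang_mom w)\<^sup>2 / k\<^sup>2"
    "lrl w \<bullet> flow_cos w s = - \<alpha>" "lrl w \<bullet> lrl w = 1 - k\<^sup>2 * (ang_mom w)\<^sup>2"
    "\<alpha>\<^sup>2 + \<beta>\<^sup>2 = 1 / k ^ 4 - (ang_mom w)\<^sup>2 / k\<^sup>2"
    using fr by blast+
  have "fst (flow w s) \<bullet> fst (flow w s) = (\<alpha> + 1 / k\<^sup>2)\<^sup>2"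
    using k
    by (simp add: F flow_def k_def[symmetric] inner_diff_left inner_diff_right inner_commute[of "flow_cos w s" "lrl w"])
      (simp add: field_simps power2_eq_square)
  moreover have "\<alpha> + 1 / k\<^sup>2 \<ge> 0"
  proof -
    have "\<alpha>\<^sup>2 \<le> 1 / k ^ 4"
      using F(4) zero_le_power2[of \<beta>] divide_nonneg_nonneg[OF zero_le_power2[of "ang_mom w"] zero_le_power2[of k]]
      by linarith
    then have "\<alpha>\<^sup>2 \<le> (1 / k\<^sup>2)\<^sup>2" by (simp add: power_divide flip: power_mult)
    then have "\<bar>\<alpha>\<bar> \<le> 1 / k\<^sup>2" by (metis abs_le_square_iff abs_of_nonneg zero_le_divide_1_iff zero_le_power2)
    then show ?thesis by linarith
  qed
  ultimately show ?thesis by (simp add: norm_eq_sqrt_inner fr_rad)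
qed

lemma flow_invariants:
  assumes "fst w \<noteq> 0" "energy w < 0" "fst (flow w s) \<noteq> 0"
  shows "energy (flow w s) = energy w" "freq (flow w s) = freq w" "ang_mom (flow w s) = ang_mom w"
    "lrl (flow w s) = lrl w" "D_int (flow w s) = D_int w"
    "flow (flow w s) t = flow w (s + t)"
proof -
  have pos: "flow_rad w s > 0" using norm_flow[OF assms(1,2), of s] assms(3) by (metis zero_less_norm_iff)
  have k: "freq w > 0" using assms freq_pos by simp
  have [simp]: "freq w \<noteq> 0" using k by simp
  note * = kepler_frame_state[OF flow_frame[OF assms(1,2), of s] k _ pos, of "flow w s"]
  have **: "energy (flow w s) = - (freq w)\<^sup>2 / 2" "freq (flow w s) = freq w" "ang_mom (flow w s) = ang_mom w"
    "lrl (flow w s) = lrl w" "cos_amp (flow w s) = flow_cos w s" "sin_amp (flow w s) = flow_sin w s"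
    "cos_rad (flow w s) = cos (freq w * s) * cos_rad w + sin (freq w * s) * sin_rad w"
     "sin_rad (flow w s) = cos (freq w * s) * sin_rad w - sin (freq w * s) * cos_rad w"
    by (rule *; simp add: flow_rad_def flow_def)+
  show "energy (flow w s) = energy w" using **(1) freq_sq[OF assms(2)] by simp
  show "freq (flow w s) = freq w" "ang_mom (flow w s) = ang_mom w" "lrl (flow w s) = lrl w" by fact+
  then show "D_int (flow w s) = D_int w" by (simp add: D_int_def)
  have add: "freq w * (s + t) = freq w * s + freq w * t" by (simp add: algebra_simps)
  have "flow_cos (flow w s) t = flow_cos w (s + t)"
    unfolding flow_cos_def[of "flow w s"] ** flow_cos_def[of w] flow_sin_def[of w] add cos_add sin_add
    by (simp add: algebra_simps)
  moreover have "flow_sin (flow w s) t = flow_sin w (s + t)"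
    unfolding flow_sin_def[of "flow w s"] ** flow_cos_def[of w] flow_sin_def[of w] add cos_add sin_add
    by (simp add: algebra_simps)
  moreover have "flow_rad (flow w s) t = flow_rad w (s + t)"
    unfolding flow_rad_def ** add cos_add sin_add by (simp add: algebra_simps)
  ultimately show "flow (flow w s) t = flow w (s + t)"
    unfolding flow_def[of "flow w s" t] flow_def[of w "s + t"] ** by simp
qed

lemma flow_0: "fst w \<noteq> 0 \<Longrightarrow> energy w < 0 \<Longrightarrow> flow w 0 = w"
  using freq_pos[of w]
  by (simp add: flow_def flow_cos_def flow_sin_def flow_rad_def cos_amp_def sin_amp_def cos_rad_def prod_eq_iff)

lemma flow_periodic: "freq w \<noteq> 0 \<Longrightarrow> flow w (s + 2 * pi / freq w) = flow w s"
  by (simp add: flow_def flow_cos_def flow_sin_def flow_rad_def distrib_left)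

lemma flow_reverse:
  "flow (fst w, - snd w) s = (fst (flow w (- s)), - snd (flow w (- s)))"
proof -
  have "energy (fst w, - snd w) = energy w" by (simp add: energy_def)
  then have k: "freq (fst w, - snd w) = freq w" by (simp add: freq_def)
  have l: "lrl (fst w, - snd w) = lrl w" by (simp add: lrl_def ang_mom_def algebra_simps)
  have "cos_amp (fst w, - snd w) = cos_amp w" "sin_amp (fst w, - snd w) = - sin_amp w"
    "cos_rad (fst w, - snd w) = cos_rad w" "sin_rad (fst w, - snd w) = - sin_rad w"
    by (simp_all add: cos_amp_def sin_amp_def cos_rad_def sin_rad_def k l)
  then show ?thesis
    by (simp add: flow_def flow_cos_def flow_sin_def flow_rad_def k l algebra_simps)
qed

lemma flow_pos_derivative:
  "((\<lambda>s. fst (flow w s)) has_vector_derivative freq w *\<^sub>R flow_sin w s) (at s)"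
  unfolding flow_def flow_cos_def flow_sin_def fst_conv
  by (auto intro!: derivative_eq_intros simp: algebra_simps)

lemma flow_rad_derivative:
  "(flow_rad w has_real_derivative
     freq w * (cos (freq w * s) * sin_rad w - sin (freq w * s) * cos_rad w)) (at s)"
  unfolding flow_rad_def
  by (auto intro!: derivative_eq_intros simp: algebra_simps)

lemma flow_sin_derivative:
  "(flow_sin w has_vector_derivative - (freq w *\<^sub>R flow_cos w s)) (at s)"
  unfolding flow_cos_def flow_sin_def
  by (auto intro!: derivative_eq_intros simp: algebra_simps)

text \<open>The factor on the right is dt / ds. The equation for the momentum amounts to the relation of the
  frame that expresses A by the coefficients.\<close>

lemma flow_derivative:
  assumes w: "fst w \<noteq> 0" "energy w < 0" and s: "fst (flow w s) \<noteq> 0"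
  shows "(flow w has_vector_derivative
     flow_rad w s *\<^sub>R (snd (flow w s), kepler_force (fst (flow w s)))) (at s)"
proof -
  define k where "k = freq w"
  define \<rho> where "\<rho> = flow_rad w s"
  define \<alpha> where "\<alpha> = cos (k * s) * cos_rad w + sin (k * s) * sin_rad w"
  define \<beta> where "\<beta> = cos (k * s) * sin_rad w - sin (k * s) * cos_rad w"
  define \<xi> where "\<xi> = flow_cos w s"
  define \<eta> where "\<eta> = flow_sin w s"
  have k: "k > 0" using assms freq_pos by (simp add: k_def)
  have \<rho>: "\<rho> > 0" using norm_flow[OF w, of s] s by (metis zero_less_norm_iff \<rho>_def)
  have \<alpha>: "\<rho> = \<alpha> + 1 / k\<^sup>2" by (simp add: \<rho>_def flow_rad_def \<alpha>_def k_def)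
  note fr = flow_frame[OF w, of s, folded k_def, folded \<alpha>_def \<beta>_def \<xi>_def \<eta>_def, unfolded kepler_frame_def]
  have dk: "((\<lambda>s. k / flow_rad w s) has_real_derivative - (k * (k * \<beta>)) / \<rho>\<^sup>2) (at s)"
  proof -
    have "flow_rad w s \<noteq> 0" using \<rho> by (simp add: \<rho>_def)
    from DERIV_cmult[OF DERIV_inverse'[OF flow_rad_derivative this], of k]
    show ?thesis by (simp add: \<rho>_def k_def \<beta>_def power2_eq_square divide_inverse mult_ac)
  qed
  have "((\<lambda>s. (k / flow_rad w s) *\<^sub>R flow_sin w s) has_vector_derivative
      (k / \<rho>) *\<^sub>R - (k *\<^sub>R \<xi>) + (- (k * (k * \<beta>)) / \<rho>\<^sup>2) *\<^sub>R \<eta>) (at s)"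
    using has_vector_derivative_scaleR[OF dk flow_sin_derivative]
    by (simp add: \<rho>_def \<eta>_def \<xi>_def k_def)
  also have "(k / \<rho>) *\<^sub>R - (k *\<^sub>R \<xi>) + (- (k * (k * \<beta>)) / \<rho>\<^sup>2) *\<^sub>R \<eta> =
      (- 1 / \<rho>\<^sup>2) *\<^sub>R ((\<rho> * k\<^sup>2) *\<^sub>R \<xi> + (k\<^sup>2 * \<beta>) *\<^sub>R \<eta>)"
  proof -
    have "(k / \<rho>) *\<^sub>R - (k *\<^sub>R \<xi>) = (- (k / \<rho> * k)) *\<^sub>R \<xi>" by simp
    also have "- (k / \<rho> * k) = - 1 / \<rho>\<^sup>2 * (\<rho> * k\<^sup>2)"
      using \<rho> by (simp add: power2_eq_square)
    finally show ?thesis by (simp add: scaleR_add_right power2_eq_square)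
  qed
  also have "(\<rho> * k\<^sup>2) *\<^sub>R \<xi> + (k\<^sup>2 * \<beta>) *\<^sub>R \<eta> = \<xi> + k\<^sup>2 *\<^sub>R (\<alpha> *\<^sub>R \<xi> + \<beta> *\<^sub>R \<eta>)"
  proof -
    have "\<rho> * k\<^sup>2 = 1 + k\<^sup>2 * \<alpha>" using k by (simp add: \<alpha> field_simps)
    then show ?thesis by (simp only: scaleR_add_left scaleR_add_right scaleR_scaleR scaleR_one add.assoc)
  qed
  also have "k\<^sup>2 *\<^sub>R (\<alpha> *\<^sub>R \<xi> + \<beta> *\<^sub>R \<eta>) = (- 1 / k\<^sup>2) *\<^sub>R lrl w"
  proof -
    have "lrl w = (- (k ^ 4)) *\<^sub>R (\<alpha> *\<^sub>R \<xi> + \<beta> *\<^sub>R \<eta>)" using fr by blast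
    moreover have "k\<^sup>2 = (- 1 / k\<^sup>2) * (- (k ^ 4))"
      using k by (simp add: power2_eq_square power4_eq_xxxx)
    ultimately show ?thesis by (metis scaleR_scaleR)
  qed
  also have "\<xi> + (- 1 / k\<^sup>2) *\<^sub>R lrl w = fst (flow w s)"
    by (simp add: flow_def \<xi>_def k_def)
  also have "(- 1 / \<rho>\<^sup>2) *\<^sub>R fst (flow w s) = \<rho> *\<^sub>R kepler_force (fst (flow w s))"
    using \<rho> by (simp add: kepler_force_def norm_flow[OF w] \<rho>_def[symmetric] field_simps power2_eq_square power3_eq_cube)
  finally have "((\<lambda>s. snd (flow w s)) has_vector_derivative \<rho> *\<^sub>R kepler_force (fst (flow w s))) (at s)"
    by (simp add: flow_def k_def)
  moreover have "((\<lambda>s. fst (flow w s)) has_vector_derivative \<rho> *\<^sub>R snd (flow w s)) (at s)"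
    using flow_pos_derivative[of w s] \<rho> by (simp add: flow_def \<rho>_def)
  ultimately show ?thesis
    using has_vector_derivative_Pair[of "\<lambda>s. fst (flow w s)" _ s UNIV "\<lambda>s. snd (flow w s)"]
    by (simp add: \<rho>_def)
qed

section \<open>Change of time\<close>

text \<open>F is the physical time as a function of a parameter s with dt = h(s) ds, and g reads off the
  parameter at a given time.\<close>

definition is_clock :: "(real \<Rightarrow> real) \<Rightarrow> (real \<Rightarrow> real) \<Rightarrow> (real \<Rightarrow> real) \<Rightarrow> bool" where
  "is_clock h F g \<longleftrightarrow> (\<forall>s. (F has_real_derivative h s) (at s)) \<and> F 0 = 0 \<and>
     (\<forall>s. g (F s) = s) \<and> (\<forall>t. F (g t) = t) \<and> (\<forall>t. (g has_real_derivative 1 / h (g t)) (at t))"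

text \<open>A positive lower bound for h makes its antiderivative a bijection of the line.\<close>

lemma clock_exists:
  fixes h :: "real \<Rightarrow> real"
  assumes cont: "\<And>s. isCont h s" and c: "c > 0" "\<And>s. c \<le> h s"
  shows "\<exists>F g. is_clock h F g"
proof -
  have hpos: "h s > 0" for s using c(1) c(2)[of s] by linarith
  obtain F0 where F0: "(F0 has_vector_derivative h x) (at x)" for x
    using einterval_antiderivative[of "-\<infinity>" "\<infinity>" h] cont by auto
  define F where "F s = F0 s - F0 0" for s
  have F: "(F has_real_derivative h s) (at s)" for s
    using F0[of s] unfolding F_def has_real_derivative_iff_has_vector_derivative
    by (auto intro!: derivative_eq_intros)
  have cF: "isCont F s" for s using F DERIV_isCont by blast
  have grow: "F b - F a \<ge> c * (b - a)" if ab: "a < b" for a b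
  proof -
    obtain z where "F b - F a = (b - a) * h z" using MVT2[OF ab, of F h] F by blast
    then show ?thesis using mult_left_mono[OF c(2)[of z], of "b - a"] ab by (simp add: mult.commute)
  qed
  have inj: "F a < F b" if "a < b" for a b
    using grow[OF that] mult_pos_pos[OF c(1), of "b - a"] that by linarith
  have surj: "\<exists>s. F s = t" for t
  proof -
    have "F (\<bar>t\<bar> / c) \<ge> \<bar>t\<bar>"
      using grow[of 0 "\<bar>t\<bar> / c"] c(1) by (cases "t = 0") (auto simp: F_def)
    moreover have "F (- \<bar>t\<bar> / c) \<le> - \<bar>t\<bar>"
      using grow[of "- \<bar>t\<bar> / c" 0] c(1) by (cases "t = 0") (auto simp: F_def field_simps)
    ultimately have "F (- \<bar>t\<bar> / c) \<le> t" "t \<le> F (\<bar>t\<bar> / c)" by linarith+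
    moreover have "- \<bar>t\<bar> / c \<le> \<bar>t\<bar> / c" using c(1) by (simp add: divide_right_mono)
    ultimately show ?thesis
      using IVT[of F "- \<bar>t\<bar> / c" t "\<bar>t\<bar> / c"] cF by blast
  qed
  define g where "g t = (THE s. F s = t)" for t
  have gF: "g (F s) = s" for s
    unfolding g_def by (rule the_equality) (rule refl, metis inj linorder_neq_iff order_less_irrefl)
  have Fg: "F (g t) = t" for t using surj[of t] gF by metis
  have "isCont g t" for t
    using isCont_inverse_function2[where x = "g t" and a = "g t - 1" and b = "g t + 1" and g = g and f = F]
      gF cF Fg by auto
  then have "(g has_real_derivative inverse (h (g t))) (at t)" for t
    using DERIV_inverse_function[where f = F and g = g and x = t and D = "h (g t)" and a = "t - 1" and b = "t + 1"]
      F hpos[of "g t"] Fg by auto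
  then have "is_clock h F g"
    unfolding is_clock_def using F gF Fg by (simp add: F_def inverse_eq_divide)
  then show ?thesis by blast
qed

lemma clock_mono:
  assumes "is_clock h F g" "\<And>s. h s > 0"
  shows "F a < F b \<longleftrightarrow> a < b"
proof -
  have "F a < F b" if ab: "a < b" for a b
  proof -
    obtain z where "F b - F a = (b - a) * h z"
      using MVT2[OF ab, of F h] assms(1) unfolding is_clock_def by blast
    then show ?thesis using mult_pos_pos[OF _ assms(2)[of z], of "b - a"] ab by linarith
  qed
  then show ?thesis by (metis linorder_less_linear order_less_asym)
qed

lemma clock_periodic:
  assumes "is_clock h F g" "\<And>s. h s > 0" "\<And>s. h (s + p) = h s" "p > 0"
  shows "F p > 0" "g (t + F p) = g t + p"
proof -
  show "F p > 0" using clock_mono[OF assms(1,2), of 0 p] assms(1,4) by (simp add: is_clock_def)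
  have "((\<lambda>s. F (s + p) - F s) has_real_derivative 0) (at s)" for s
  proof -
    have "((\<lambda>s. F (s + p)) has_real_derivative h (s + p)) (at s)"
      using assms(1) DERIV_shift[of F "h (s + p)" s p] unfolding is_clock_def by blast
    from DERIV_diff[OF this, of F "h s"] show ?thesis
      using assms(1,3) unfolding is_clock_def by simp
  qed
  then have "F (s + p) - F s = F (0 + p) - F 0" for s
    using DERIV_isconst_all[of "\<lambda>s. F (s + p) - F s"] by blast
  from this[of "g t"] have "F (g t + p) = t + F p"
    using assms(1) unfolding is_clock_def by simp
  then show "g (t + F p) = g t + p"
    using assms(1) unfolding is_clock_def by metis
qed

text \<open>On the table the radius is at least 1, so there the maximum is the radius. Elsewhere it keeps the
  rate positive, which makes the clock a bijection of the whole line even if the conic degenerates and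
  passes through the centre.\<close>

definition flow_time :: "phase \<Rightarrow> real \<Rightarrow> real" where
  "flow_time w = (SOME F. \<exists>g. is_clock (\<lambda>s. max 1 (flow_rad w s)) F g)"

definition flow_clock :: "phase \<Rightarrow> real \<Rightarrow> real" where
  "flow_clock w = (SOME g. is_clock (\<lambda>s. max 1 (flow_rad w s)) (flow_time w) g)"

lemma flow_clock: "is_clock (\<lambda>s. max 1 (flow_rad w s)) (flow_time w) (flow_clock w)"
proof -
  have "isCont (\<lambda>s. max 1 (flow_rad w s)) s" for s
    using DERIV_isCont[OF flow_rad_derivative] by (intro continuous_intros)
  then have "\<exists>F g. is_clock (\<lambda>s. max 1 (flow_rad w s)) F g"
    by (rule clock_exists[of _ 1]) auto
  then have "\<exists>g. is_clock (\<lambda>s. max 1 (flow_rad w s)) (flow_time w) g"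
    unfolding flow_time_def by (rule someI_ex)
  then show ?thesis unfolding flow_clock_def by (rule someI_ex)
qed

section \<open>Flights between consecutive reflections\<close>

definition height :: "phase \<Rightarrow> real \<Rightarrow> real" where
  "height w s = snd (fst (flow w s))"

lemma height_nonzero: "height w s > 0 \<Longrightarrow> fst (flow w s) \<noteq> 0"
  by (auto simp: height_def)

lemma height_derivative:
  assumes "fst w \<noteq> 0" "energy w < 0" "fst (flow w s) \<noteq> 0"
  shows "(height w has_real_derivative flow_rad w s * snd (snd (flow w s))) (at s)"
proof -
  have "((\<lambda>s. snd (fst (flow w s))) has_vector_derivative
      snd (fst (flow_rad w s *\<^sub>R (snd (flow w s), kepler_force (fst (flow w s)))))) (at s)"
    by (intro bounded_linear.has_vector_derivative[OF bounded_linear_snd]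
        bounded_linear.has_vector_derivative[OF bounded_linear_fst] flow_derivative assms)
  then show ?thesis
    by (simp add: height_def[abs_def] has_real_derivative_iff_has_vector_derivative)
qed

lemma height_continuous: "isCont (height w) s"
  unfolding height_def
  by (intro continuous_intros has_vector_derivative_continuous[OF flow_pos_derivative])

lemma vertical_momentum_derivative:
  assumes "fst w \<noteq> 0" "energy w < 0" "fst (flow w s) \<noteq> 0"
  shows "((\<lambda>s. snd (snd (flow w s))) has_real_derivative - height w s / (flow_rad w s)\<^sup>2) (at s)"
proof -
  have "((\<lambda>s. snd (snd (flow w s))) has_vector_derivative
      snd (snd (flow_rad w s *\<^sub>R (snd (flow w s), kepler_force (fst (flow w s)))))) (at s)"
    by (intro bounded_linear.has_vector_derivative[OF bounded_linear_snd] flow_derivative assms)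
  moreover have "flow_rad w s > 0" using norm_flow[OF assms(1,2), of s] assms(3) by (metis zero_less_norm_iff)
  then have "snd (snd (flow_rad w s *\<^sub>R (snd (flow w s), kepler_force (fst (flow w s))))) =
      - height w s / (flow_rad w s)\<^sup>2"
    by (simp add: height_def kepler_force_def norm_flow[OF assms(1,2)] power2_eq_square power3_eq_cube field_simps)
  ultimately show ?thesis
    by (simp add: has_real_derivative_iff_has_vector_derivative)
qed

text \<open>If the motion stayed above the wall for a full period in fictitious time, the vertical momentum would
  decrease all the time, although it is periodic.\<close>

lemma height_returns:
  assumes w: "snd (fst w) \<ge> 1" "energy w < 0"
    and rise: "\<epsilon> > 0" "\<And>s. 0 < s \<Longrightarrow> s < \<epsilon> \<Longrightarrow> height w s > 1"
  shows "\<exists>S>0. height w S = 1 \<and> (\<forall>s. 0 < s \<and> s < S \<longrightarrow> height w s > 1)"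
proof -
  have w0: "fst w \<noteq> 0" using w by auto
  have k: "freq w > 0" using w freq_pos by simp
  define T where "T = 2 * pi / freq w"
  have T: "T > 0" using k by (simp add: T_def)
  have per: "flow w T = flow w 0" using flow_periodic[of w 0] k by (simp add: T_def)
  have "\<exists>s. 0 < s \<and> s < T \<and> height w s \<le> 1"
  proof (rule ccontr)
    assume n: "\<not> ?thesis"
    have h0: "height w 0 \<ge> 1" using flow_0[OF w0 w(2)] w by (simp add: height_def)
    have hT: "height w T = height w 0" by (simp add: height_def per)
    have h: "height w s > 0" if s: "0 \<le> s" "s \<le> T" for s
    proof (cases "s = 0 \<or> s = T")
      case False
      then have "0 < s" "s < T" using s by auto
      then have "\<not> height w s \<le> 1" using n by blast
      then show ?thesis by linarith
    qed (use h0 hT in auto)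
    obtain z where z: "0 < z" "z < T"
      "snd (snd (flow w T)) - snd (snd (flow w 0)) = (T - 0) * (- height w z / (flow_rad w z)\<^sup>2)"
      using MVT2[OF T, of "\<lambda>s. snd (snd (flow w s))" "\<lambda>s. - height w s / (flow_rad w s)\<^sup>2"]
        vertical_momentum_derivative[OF w0 w(2) height_nonzero] h by auto
    have "flow_rad w z \<noteq> 0" using norm_flow[OF w0 w(2), of z] height_nonzero[of w z] h[of z] z by auto
    moreover have "height w z > 0" using h[of z] z by simp
    ultimately show False using z T per by simp
  qed
  then obtain s0 where s0: "0 < s0" "height w s0 \<le> 1" by blast
  (* The height exceeds 1 up to the left end of the interval, so the least element of Z is the exit. *)
  define Z where "Z = {min \<epsilon> s0 / 2..s0} \<inter> height w -` {..1}"
  have "compact Z"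
    unfolding Z_def
    by (intro compact_Int_closed continuous_closed_vimage height_continuous) auto
  moreover have "s0 \<in> Z" using s0 rise(1) by (auto simp: Z_def)
  ultimately obtain S where S: "S \<in> Z" "\<And>s. s \<in> Z \<Longrightarrow> S \<le> s"
    using compact_attains_inf[of Z] by blast
  have S0: "S > 0" "height w S \<le> 1" "S \<le> s0" using S(1) s0 rise(1) by (auto simp: Z_def)
  have above: "height w s > 1" if "0 < s" "s < S" for s
  proof (rule ccontr)
    assume n: "\<not> height w s > 1"
    then have "s \<ge> \<epsilon>" using rise(2)[of s] that by force
    then have "s \<in> Z" using n that S0 rise(1) by (auto simp: Z_def)
    then show False using S(2) that by force
  qed
  have "height w S = 1"
  proof (rule ccontr)
    assume "height w S \<noteq> 1"
    then have "height w S < 1" using S0 by simp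
    moreover have "height w (S / 2) > 1" using above S0 by simp
    ultimately obtain s where s: "S / 2 \<le> s" "s \<le> S" "height w s = 1"
      using IVT2[of "height w" S 1 "S / 2"] height_continuous S0 by auto
    then have "s \<noteq> S" using \<open>height w S < 1\<close> by auto
    then show False using above[of s] s S0 by simp
  qed
  then show ?thesis using S0 above by blast
qed

definition rising :: "phase \<Rightarrow> bool" where
  "rising w \<longleftrightarrow> snd (fst w) > 1 \<or> snd (fst w) = 1 \<and> snd (snd w) > 0"

lemma rising_imp_above:
  assumes "rising w" "energy w < 0"
  shows "\<exists>\<epsilon>>0. \<forall>s. 0 < s \<and> s < \<epsilon> \<longrightarrow> height w s > 1"
proof -
  have w0: "fst w \<noteq> 0" using assms by (auto simp: rising_def)
  have h0: "height w 0 = snd (fst w)" by (simp add: height_def flow_0[OF w0 assms(2)])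
  show ?thesis
  proof (cases "snd (fst w) > 1")
    case True
    have "((\<lambda>s. height w s) \<longlongrightarrow> height w 0) (at 0)" using height_continuous[where w = w and s = 0] by (simp add: isCont_def)
    then have "\<forall>\<^sub>F s in at 0. height w s > 1" using True by (intro order_tendstoD(1)) (simp_all add: h0)
    then obtain \<epsilon> where \<epsilon>: "\<epsilon> > 0" "\<And>s. s \<noteq> 0 \<Longrightarrow> dist s 0 < \<epsilon> \<Longrightarrow> height w s > 1"
      unfolding eventually_at by auto
    have "height w s > 1" if "0 < s" "s < \<epsilon>" for s using \<epsilon>(2)[of s] that by simp
    then show ?thesis using \<epsilon>(1) by blast
  next
    case False
    then have f: "snd (fst w) = 1" "snd (snd w) > 0" using assms by (auto simp: rising_def)
    have "flow_rad w 0 > 0"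
      using norm_flow[OF w0 assms(2), of 0] w0 flow_0[OF w0 assms(2)] by (metis zero_less_norm_iff)
    then have "flow_rad w 0 * snd (snd (flow w 0)) > 0" using f flow_0[OF w0 assms(2)] by simp
    moreover have "fst (flow w 0) \<noteq> 0" using flow_0[OF w0 assms(2)] w0 by simp
    ultimately obtain d where d: "d > 0" "\<And>e. e > 0 \<Longrightarrow> e < d \<Longrightarrow> height w 0 < height w (0 + e)"
      using DERIV_pos_inc_right[OF height_derivative[OF w0 assms(2), of 0]] by blast
    have "height w s > 1" if "0 < s" "s < d" for s
      using d(2)[of s] that f h0 by simp
    then show ?thesis using d(1) by blast
  qed
qed

definition is_exit :: "phase \<Rightarrow> real \<Rightarrow> bool" where
  "is_exit w S \<longleftrightarrow> S > 0 \<and> height w S = 1 \<and> (\<forall>s. 0 < s \<and> s < S \<longrightarrow> height w s > 1)"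

definition exit_par :: "phase \<Rightarrow> real" where
  "exit_par w = (THE S. is_exit w S)"

lemma exit_unique: "is_exit w S \<Longrightarrow> exit_par w = S"
  unfolding exit_par_def
proof (intro the_equality)
  fix S' assume "is_exit w S" "is_exit w S'"
  then show "S' = S"
    unfolding is_exit_def by (metis less_irrefl linorder_less_linear)
qed

lemma exit_exists:
  assumes "rising w" "energy w < 0"
  shows "is_exit w (exit_par w)"
proof -
  have "snd (fst w) \<ge> 1" using assms(1) by (auto simp: rising_def)
  moreover obtain \<epsilon> where \<epsilon>: "\<epsilon> > 0" "\<And>s. 0 < s \<Longrightarrow> s < \<epsilon> \<Longrightarrow> height w s > 1"
    using rising_imp_above[OF assms] by auto
  ultimately have "\<exists>S. is_exit w S"
    using height_returns[OF _ assms(2) \<epsilon>] unfolding is_exit_def by simp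
  then obtain S where "is_exit w S" by (rule exE)
  then show ?thesis using exit_unique[of w S] by simp
qed

lemma exit_falling:
  assumes "rising w" "energy w < 0" and S: "is_exit w S"
  shows "snd (snd (flow w S)) \<le> 0"
proof (rule ccontr)
  assume n: "\<not> ?thesis"
  have w0: "fst w \<noteq> 0" using assms by (auto simp: rising_def)
  have s0: "fst (flow w S) \<noteq> 0" using S height_nonzero[of w S] by (simp add: is_exit_def)
  then have "flow_rad w S > 0" using norm_flow[OF w0 assms(2), of S] by (metis zero_less_norm_iff)
  then have "flow_rad w S * snd (snd (flow w S)) > 0" using n by simp
  from DERIV_pos_inc_left[OF height_derivative[OF w0 assms(2) s0] this]
  obtain d where d: "d > 0" "\<And>e. e > 0 \<Longrightarrow> e < d \<Longrightarrow> height w (S - e) < height w S" by blast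
  define e where "e = min d S / 2"
  have "0 < e" "e < d" "e < S" using d S by (auto simp: e_def is_exit_def)
  moreover have "height w (S - e) > 1" using S \<open>0 < e\<close> \<open>e < S\<close> by (simp add: is_exit_def)
  ultimately show False using d(2)[of e] S by (simp add: is_exit_def)
qed

definition refl_state :: "phase \<Rightarrow> phase" where
  "refl_state w = (fst w, reflect (snd w))"

lemma refl_state_simps [simp]:
  "fst (refl_state w) = fst w" "fst (snd (refl_state w)) = fst (snd w)"
  "snd (snd (refl_state w)) = - snd (snd w)" "refl_state (refl_state w) = w"
  by (simp_all add: refl_state_def reflect_def prod_eq_iff)

lemma energy_refl_state [simp]: "energy (refl_state w) = energy w"
  by (simp add: energy_def norm_plane)

text \<open>So on the wall of a level set with D + 2 E > 0 the vertical momentum does not vanish: every contact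
  is transversal.\<close>

lemma wall_D_plus_2E:
  assumes "snd (fst w) = 1"
  shows "D_int w + 2 * energy w = (snd (snd w) * norm (fst w))\<^sup>2"
proof -
  have "fst w \<noteq> 0" using assms by auto
  from D_plus_2E[OF this] assms show ?thesis
    by (simp add: ang_mom_def power_mult_distrib norm_plane_sq) (simp add: algebra_simps power2_eq_square)
qed

lemma D_int_refl_state [simp]: "snd (fst w) = 1 \<Longrightarrow> D_int (refl_state w) = D_int w"
  using wall_D_plus_2E[of w] wall_D_plus_2E[of "refl_state w"] by simp

definition outgoing :: "real \<Rightarrow> real \<Rightarrow> phase set" where
  "outgoing E D = {w \<in> level_set E D. snd (fst w) = 1 \<and> snd (snd w) > 0}"

text \<open>The return map of the wall, on the states just after a reflection.\<close>

definition next_out :: "phase \<Rightarrow> phase" where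
  "next_out w = refl_state (flow w (exit_par w))"

context
  fixes E D :: real
  assumes E: "E < 0" and D: "D + 2 * E > 0"
begin

lemma outgoingD:
  assumes "w \<in> outgoing E D"
  shows "energy w = E" "D_int w = D" "fst w \<noteq> 0" "rising w" "energy w < 0" "w \<in> level_set E D"
    "snd (fst w) = 1" "snd (snd w) > 0"
  using assms E by (auto simp: outgoing_def level_set_def rising_def)

lemma level_set_wall:
  assumes "w \<in> level_set E D" "snd (fst w) = 1"
  shows "snd (snd w) \<noteq> 0"
  using wall_D_plus_2E[OF assms(2)] assms(1) D by (auto simp: level_set_def)

lemma refl_state_level_set:
  "w \<in> level_set E D \<Longrightarrow> snd (fst w) = 1 \<Longrightarrow> refl_state w \<in> level_set E D"
  by (simp add: level_set_def phase_space_def)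

lemma level_set_flow:
  assumes "w \<in> level_set E D" "height w s \<ge> 1"
  shows "flow w s \<in> level_set E D"
proof -
  have "fst w \<noteq> 0" "energy w < 0" using assms E by (auto simp: level_set_def phase_space_def table_def)
  from flow_invariants[OF this, of s] show ?thesis
    using assms height_nonzero[of w s] by (auto simp: level_set_def phase_space_def table_def height_def)
qed

lemma outgoing_exit: "w \<in> outgoing E D \<Longrightarrow> is_exit w (exit_par w)"
  using exit_exists outgoingD by blast

lemma exit_incoming:
  assumes w: "w \<in> level_set E D" "rising w" and S: "is_exit w S"
  shows "refl_state (flow w S) \<in> outgoing E D"
proof -
  have e: "energy w < 0" using w E by (simp add: level_set_def)
  have h: "height w S = 1" using S by (simp add: is_exit_def)
  then have l: "flow w S \<in> level_set E D" using level_set_flow w by simp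
  have "snd (snd (flow w S)) \<le> 0" by (rule exit_falling[OF w(2) e S])
  moreover have "snd (snd (flow w S)) \<noteq> 0"
    using level_set_wall[OF l] h by (simp add: height_def)
  ultimately show ?thesis
    using refl_state_level_set[OF l] h by (simp add: outgoing_def height_def)
qed

lemma next_out_outgoing: "w \<in> outgoing E D \<Longrightarrow> next_out w \<in> outgoing E D"
  unfolding next_out_def using exit_incoming outgoingD outgoing_exit by blast

text \<open>By time reversal, which negates the momentum.\<close>

lemma backward_exit:
  assumes v: "v \<in> level_set E D" "rising (fst v, - snd v)"
  shows "\<exists>S>0. flow v (- S) \<in> outgoing E D \<and> flow (flow v (- S)) S = v \<and>
     (\<forall>s. 0 < s \<and> s < S \<longrightarrow> height (flow v (- S)) s > 1) \<and>
     (\<forall>s. height (flow v (- S)) (S + s) = height v s)"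
proof -
  (* u is v with the time reversed: its forward exit is the backward exit of v. *)
  define u where "u = (fst v, - snd v)"
  have v0: "fst v \<noteq> 0" "energy v < 0" using v E by (auto simp: level_set_def phase_space_def table_def)
  have u: "energy u = E" "D_int u = D" "u \<in> level_set E D"
    using v(1) by (auto simp: u_def level_set_def phase_space_def energy_def D_int_def lrl_def ang_mom_def
        power2_eq_square algebra_simps)
  have ru: "rising u" using v by (simp add: u_def)
  define S where "S = exit_par u"
  have S: "is_exit u S" using exit_exists[of u] u ru E by (simp add: S_def)
  have hu: "height u s = height v (- s)" for s
    by (simp add: height_def u_def flow_reverse)
  define w where "w = flow v (- S)"
  have hw: "snd (fst w) = 1" "fst w \<noteq> 0"
    using S height_nonzero[of v "-S"] by (simp_all add: is_exit_def hu w_def) (simp add: height_def)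
  have shift: "flow w s = flow v (s - S)" for s
    unfolding w_def using flow_invariants(6)[OF v0, of "- S" s] hw by (simp add: w_def)
  have hw': "height w s = height u (S - s)" for s by (simp add: height_def[of w] shift hu) (simp add: height_def)
  have "refl_state (flow u S) \<in> outgoing E D" by (rule exit_incoming[OF u(3) ru S])
  then have "snd (snd w) > 0" by (simp add: outgoing_def u_def flow_reverse w_def)
  moreover have "w \<in> level_set E D"
    unfolding w_def using S by (intro level_set_flow v) (simp add: is_exit_def hu)
  ultimately have "w \<in> outgoing E D" using hw by (simp add: outgoing_def)
  moreover have "flow w S = v" by (simp add: shift flow_0[OF v0])
  moreover have "height w s > 1" if "0 < s \<and> s < S" for s using S that by (simp add: hw' is_exit_def)
  moreover have "height w (S + s) = height v s" for s by (simp add: hw' hu)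
  moreover have "S > 0" using S by (simp add: is_exit_def)
  ultimately show ?thesis unfolding w_def by blast
qed

text \<open>The return map is onto, so an outgoing state has a past as well as a future.\<close>

lemma prev_out_exists:
  assumes w: "w \<in> outgoing E D"
  shows "\<exists>w' \<in> outgoing E D. next_out w' = w"
proof -
  define v where "v = refl_state w"
  have v: "v \<in> level_set E D" using refl_state_level_set outgoingD w by (simp add: v_def)
  have "rising (fst v, - snd v)" using outgoingD[OF w] by (simp add: v_def rising_def)
  from backward_exit[OF v this] obtain S where S: "S > 0" "flow v (- S) \<in> outgoing E D"
     "flow (flow v (- S)) S = v" "\<And>s. 0 < s \<Longrightarrow> s < S \<Longrightarrow> height (flow v (- S)) s > 1" by blast
  define w' where "w' = flow v (- S)"
  have "is_exit w' S"
    using S outgoingD[OF w] by (simp add: is_exit_def w'_def height_def v_def)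
  then have "next_out w' = w" using exit_unique[of w' S] S(3) by (simp add: next_out_def w'_def v_def)
  then show ?thesis using S(2) w'_def by blast
qed

text \<open>A point of a level set, followed backwards, comes from the wall. Therefore a level set is known once
  its outgoing wall states are known.\<close>

lemma level_set_cover:
  assumes v: "v \<in> level_set E D"
  shows "\<exists>w \<in> outgoing E D. v = refl_state w \<or> (\<exists>s. 0 \<le> s \<and> s < exit_par w \<and> v = flow w s)"
proof -
  have v0: "fst v \<noteq> 0" "energy v < 0" "snd (fst v) \<ge> 1"
    using v E by (auto simp: level_set_def phase_space_def table_def)
  consider "snd (fst v) = 1" "snd (snd v) > 0" | "snd (fst v) = 1" "snd (snd v) < 0" | "snd (fst v) > 1"
    using level_set_wall[OF v] v0(3) by fastforce
  then show ?thesis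
  proof cases
    case 1
    then have "v \<in> outgoing E D" using v by (simp add: outgoing_def)
    moreover have "exit_par v > 0" using outgoing_exit[OF calculation] by (simp add: is_exit_def)
    ultimately show ?thesis using flow_0[OF v0(1,2)] by (metis order_refl)
  next
    case 2
    then have "refl_state v \<in> outgoing E D"
      using refl_state_level_set[OF v] by (simp add: outgoing_def)
    then show ?thesis by (metis refl_state_simps(4))
  next
    case 3
    then have "rising (fst v, - snd v)" "rising v" by (simp_all add: rising_def)
    from backward_exit[OF v this(1)] obtain S where S: "S > 0" "flow v (- S) \<in> outgoing E D"
      "flow (flow v (- S)) S = v" "\<And>s. 0 < s \<Longrightarrow> s < S \<Longrightarrow> height (flow v (- S)) s > 1"
      "\<And>s. height (flow v (- S)) (S + s) = height v s" by blast
    define w where "w = flow v (- S)"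
    have ev: "is_exit v (exit_par v)" using exit_exists \<open>rising v\<close> v0 by blast
    have "height w s > 1" if "0 < s" "s < S + exit_par v" for s
    proof (cases s S rule: linorder_cases)
      case less then show ?thesis using S(4) that by (simp add: w_def)
    next
      case equal then show ?thesis using S(3) 3 by (simp add: w_def height_def)
    next
      case greater then show ?thesis using S(5)[of "s - S"] ev that by (simp add: w_def is_exit_def)
    qed
    then have "is_exit w (S + exit_par v)"
      using S(1) S(5)[of "exit_par v"] ev by (simp add: is_exit_def w_def)
    then have "exit_par w = S + exit_par v" by (rule exit_unique)
    then have "S < exit_par w" using ev by (simp add: is_exit_def)
    then show ?thesis using S(1-3) by (metis w_def less_imp_le)
  qed
qed

end

definition flight :: "phase \<Rightarrow> real \<Rightarrow> phase" where
  "flight w t = flow w (flow_clock w t)"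

definition flight_time :: "phase \<Rightarrow> real" where
  "flight_time w = flow_time w (exit_par w)"

definition kepler_solution_at :: "(real \<Rightarrow> phase) \<Rightarrow> real \<Rightarrow> bool" where
  "kepler_solution_at z t \<longleftrightarrow>
     (z has_vector_derivative (snd (z t), kepler_force (fst (z t)))) (at t)"

lemma vertical_force:
  assumes "kepler_solution_at z t"
  shows "((\<lambda>t. snd (snd (z t))) has_real_derivative - snd (fst (z t)) / norm (fst (z t)) ^ 3) (at t)"
  using bounded_linear.has_vector_derivative[OF bounded_linear_snd
      bounded_linear.has_vector_derivative[OF bounded_linear_snd assms[unfolded kepler_solution_at_def]]]
  by (simp add: has_real_derivative_iff_has_vector_derivative kepler_force_def divide_inverse mult.commute)

lemma flow_time_less: "flow_time w a < flow_time w b \<longleftrightarrow> a < b"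
  by (rule clock_mono[OF flow_clock]) simp

lemma flow_clock_inverse [simp]:
  "flow_time w (flow_clock w t) = t" "flow_clock w (flow_time w s) = s" "flow_time w 0 = 0"
  "flow_clock w 0 = 0"
  using flow_clock[of w] unfolding is_clock_def by metis+

lemma flow_clock_less: "flow_clock w a < flow_clock w b \<longleftrightarrow> a < b"
  using flow_time_less[of w "flow_clock w a" "flow_clock w b"] by simp

lemma flow_clock_le: "flow_clock w a \<le> flow_clock w b \<longleftrightarrow> a \<le> b"
  using flow_clock_less[of w b a] by linarith

lemma flight_solution:
  assumes w: "fst w \<noteq> 0" "energy w < 0" and h: "snd (fst (flight w t)) \<ge> 1"
  shows "kepler_solution_at (flight w) t"
proof -
  define s where "s = flow_clock w t"
  have s0: "fst (flow w s) \<noteq> 0" using h height_nonzero[of w s] by (simp add: flight_def height_def s_def)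
  have rad: "flow_rad w s \<ge> 1"
    using table_norm_ge_1[OF h] norm_flow[OF w, of s] by (simp add: flight_def s_def)
  then have "(flow_clock w has_vector_derivative 1 / flow_rad w s) (at t)"
    using flow_clock[of w] unfolding is_clock_def has_real_derivative_iff_has_vector_derivative[symmetric] s_def
    by (metis max_absorb2)
  from vector_diff_chain_at[OF this flow_derivative[OF w s0, unfolded s_def]]
  show ?thesis
    using rad by (simp add: kepler_solution_at_def flight_def[abs_def] o_def s_def)
qed

lemma level_set_norm_le:
  assumes E: "E < 0" and v: "v \<in> level_set E D"
  shows "norm (fst v) \<le> - 1 / E"
proof -
  have "norm (fst v) \<ge> 1" using v table_norm_ge_1 by (simp add: level_set_def phase_space_def table_def)
  moreover have "1 / norm (fst v) \<ge> - E"
  proof -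
    have "(norm (snd v))\<^sup>2 / 2 - 1 / norm (fst v) = E" using v by (simp add: level_set_def energy_def)
    then show ?thesis using zero_le_power2[of "norm (snd v)"] by linarith
  qed
  ultimately have "- E * norm (fst v) \<le> 1" by (subst (asm) pos_le_divide_eq) auto
  then show ?thesis using E by (subst neg_le_divide_eq) (simp_all add: mult.commute)
qed

context
  fixes E D :: real
  assumes E: "E < 0" and D: "D + 2 * E > 0"
begin

context
  fixes w assumes w: "w \<in> outgoing E D"
begin

lemma flight_clock_range:
  "0 \<le> t \<Longrightarrow> t \<le> flight_time w \<Longrightarrow> 0 \<le> flow_clock w t \<and> flow_clock w t \<le> exit_par w"
  "0 < t \<Longrightarrow> t < flight_time w \<Longrightarrow> 0 < flow_clock w t \<and> flow_clock w t < exit_par w"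
  using flow_clock_le[of w 0 t] flow_clock_less[of w 0 t] flow_clock_le[of w t "flight_time w"]
    flow_clock_less[of w t "flight_time w"] by (auto simp: flight_time_def)

lemma flight_time_pos: "flight_time w > 0"
  using flow_time_less[of w 0 "exit_par w"] outgoing_exit[OF E D w]
  by (simp add: flight_time_def is_exit_def)

lemma flight_start: "flight w 0 = w"
  using flow_0 outgoingD[OF E D w] by (simp add: flight_def)

lemma flight_end: "flight w (flight_time w) = flow w (exit_par w)"
  by (simp add: flight_def flight_time_def)

lemma flight_end_next: "refl_state (flight w (flight_time w)) = next_out w"
  by (simp add: flight_end next_out_def)

lemma flight_above: "0 < t \<Longrightarrow> t < flight_time w \<Longrightarrow> snd (fst (flight w t)) > 1"
  using outgoing_exit[OF E D w] flight_clock_range(2) by (simp add: is_exit_def flight_def height_def)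

lemma flight_wall: "snd (fst (flight w 0)) = 1" "snd (fst (flight w (flight_time w))) = 1"
  using outgoing_exit[OF E D w] outgoingD[OF E D w]
  by (simp_all add: flight_start flight_end is_exit_def height_def)

lemma flight_table: "0 \<le> t \<Longrightarrow> t \<le> flight_time w \<Longrightarrow> snd (fst (flight w t)) \<ge> 1"
  using flight_wall flight_above[of t] by (cases "t = 0 \<or> t = flight_time w") fastforce+

lemma flight_solves: "0 \<le> t \<Longrightarrow> t \<le> flight_time w \<Longrightarrow> kepler_solution_at (flight w) t"
  using flight_solution flight_table outgoingD[OF E D w] by blast

lemma flight_level_set: "0 \<le> t \<Longrightarrow> t \<le> flight_time w \<Longrightarrow> flight w t \<in> level_set E D"
  unfolding flight_def
  using flight_table[of t] outgoingD[OF E D w]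
  by (intro level_set_flow[OF E D]) (simp_all add: height_def flight_def)

lemma flight_invariants:
  assumes "0 \<le> t" "t \<le> flight_time w"
  shows "ang_mom (flight w t) = ang_mom w" "lrl (flight w t) = lrl w"
proof -
  have "fst (flow w (flow_clock w t)) \<noteq> 0" using flight_table[OF assms] by (auto simp: flight_def)
  from flow_invariants[OF outgoingD(3,5)[OF E D w] this]
  show "ang_mom (flight w t) = ang_mom w" "lrl (flight w t) = lrl w" by (simp_all add: flight_def)
qed

lemma flow_eq_flight:
  assumes "0 \<le> s" "s < exit_par w"
  shows "\<exists>t. 0 \<le> t \<and> t < flight_time w \<and> flow w s = flight w t"
  using assms flow_time_less[of w s "exit_par w"] flow_time_less[of w s 0]
  by (intro exI[of _ "flow_time w s"]) (auto simp: flight_def flight_time_def)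

text \<open>A flight takes the vertical momentum from at least the bound on the right to a negative value, while
  the force is at most 1. The bound does not depend on the flight, so infinitely many flights need
  infinite time.\<close>

lemma flight_time_lower_bound: "flight_time w \<ge> sqrt (D + 2 * E) * (- E)"
proof -
  define T where "T = flight_time w"
  have T: "T > 0" using flight_time_pos by (simp add: T_def)
  define q where "q t = snd (snd (flight w t))" for t
  have dq: "(q has_real_derivative - snd (fst (flight w t)) / norm (fst (flight w t)) ^ 3) (at t)"
    if t: "0 \<le> t" "t \<le> T" for t
    using vertical_force[OF flight_solves[of t]] t by (simp add: T_def q_def[abs_def])
  obtain c where c: "0 < c" "c < T"
    "q T - q 0 = (T - 0) * (- snd (fst (flight w c)) / norm (fst (flight w c)) ^ 3)"
    using MVT2[OF T dq] by auto
  define r where "r = norm (fst (flight w c))"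
  have r: "r \<ge> 1" "snd (fst (flight w c)) \<le> r"
    using flight_table[of c] table_norm_ge_1 snd_le_norm c by (simp_all add: r_def T_def)
  then have "snd (fst (flight w c)) \<le> r ^ 3"
    using power_increasing[of 1 3 r] by simp
  then have "snd (fst (flight w c)) / r ^ 3 \<le> 1" using r by simp
  then have "T * (snd (fst (flight w c)) / r ^ 3) \<le> T" using mult_left_mono[of "snd (fst (flight w c)) / r ^ 3" 1 T] T by simp
  then have "q 0 - q T \<le> T" using c(3) by (simp add: r_def)
  moreover have "q T < 0"
    using next_out_outgoing[OF E D w] unfolding flight_end_next[symmetric]
    by (simp add: outgoing_def q_def T_def)
  moreover have "q 0 \<ge> sqrt (D + 2 * E) * (- E)"
  proof -
    have "D + 2 * E = (q 0 * norm (fst w))\<^sup>2"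
      using wall_D_plus_2E[of w] outgoingD[OF E D w] by (simp add: q_def flight_start)
    moreover have "q 0 > 0" using outgoingD[OF E D w] by (simp add: q_def flight_start)
    ultimately have "sqrt (D + 2 * E) = q 0 * norm (fst w)" by simp
    also have "\<dots> \<le> q 0 * (- 1 / E)"
      using level_set_norm_le[OF E, of w D] outgoingD[OF E D w] \<open>q 0 > 0\<close> by (intro mult_left_mono) auto
    finally show ?thesis using E by (simp add: field_simps)
  qed
  ultimately show ?thesis by (simp add: T_def)
qed

end

end

section \<open>Gluing flights to a bouncing trajectory\<close>

lemma int_step_const:
  fixes d :: "int \<Rightarrow> 'a"
  assumes "\<And>n. d (n + 1) = d n"
  shows "d n = d 0"
proof (induction n rule: int_induct[of _ 0])
  case base show ?case ..
next
  case (step1 i) then show ?case using assms by simp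
next
  case (step2 i) then show ?case using assms[of "i - 1"] by simp
qed

text \<open>Flights f n on the intervals [0, T n], numbered by the integers, such that each begins with the
  reflected final state of the previous one.\<close>

locale bounce_chain =
  fixes f :: "int \<Rightarrow> real \<Rightarrow> phase" and T :: "int \<Rightarrow> real" and \<delta> :: real
  assumes \<delta>: "\<delta> > 0" "\<And>n. \<delta> \<le> T n"
    and solves: "\<And>n t. 0 \<le> t \<Longrightarrow> t \<le> T n \<Longrightarrow> kepler_solution_at (f n) t"
    and above: "\<And>n t. 0 < t \<Longrightarrow> t < T n \<Longrightarrow> snd (fst (f n t)) > 1"
    and on_wall: "\<And>n. snd (fst (f n 0)) = 1"
    and bounce: "\<And>n. f (n + 1) 0 = refl_state (f n (T n))"
begin

lemma T_pos: "T n > 0" using \<delta>(1) \<delta>(2)[of n] by linarith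

text \<open>Flight n starts at this time. For negative n the first sum is empty and the second one counts back
  from 0.\<close>

definition hit_time :: "int \<Rightarrow> real" where
  "hit_time n = (\<Sum>i\<in>{0..<n}. T i) - (\<Sum>i\<in>{n..<0}. T i)"

lemma hit_time_0: "hit_time 0 = 0" by (simp add: hit_time_def)

lemma hit_time_step: "hit_time (n + 1) = hit_time n + T n"
proof (cases "n \<ge> 0")
  case True
  then have "{0..<n + 1} = insert n {0..<n}" by auto
  then show ?thesis using True by (simp add: hit_time_def)
next
  case False
  then have "{n..<0} = insert n {n + 1..<0}" by auto
  then show ?thesis using False by (simp add: hit_time_def)
qed

lemma hit_time_gap: "hit_time m + \<delta> * real k \<le> hit_time (m + int k)"
proof (induction k)
  case (Suc k)
  have "hit_time (m + int (Suc k)) = hit_time (m + int k) + T (m + int k)"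
    using hit_time_step[of "m + int k"] by (simp add: ac_simps)
  then show ?case using Suc \<delta>(2)[of "m + int k"] by (simp add: algebra_simps)
qed simp

lemma hit_time_mono: "m < n \<Longrightarrow> hit_time m < hit_time n"
  using hit_time_gap[of m "nat (n - m)"] mult_pos_pos[OF \<delta>(1), of "real_of_int n - real_of_int m"] by simp

lemma hit_time_less_iff: "hit_time m < hit_time n \<longleftrightarrow> m < n"
  using hit_time_mono[of m n] hit_time_mono[of n m] by (cases m n rule: linorder_cases) auto

lemma hit_time_le_iff: "hit_time m \<le> hit_time n \<longleftrightarrow> m \<le> n"
  using hit_time_less_iff[of n m] by linarith

lemma index_exists: "\<exists>n. hit_time n \<le> t \<and> t < hit_time (n + 1)"
proof -
  obtain k :: nat where k: "\<bar>t\<bar> < real k * \<delta>" using reals_Archimedean3[OF \<delta>(1)] by blast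
  have lo: "hit_time (- int k) \<le> t" using hit_time_gap[of "- int k" k] k by (simp add: hit_time_0 mult.commute)
  have hi: "t < hit_time (int k)" using hit_time_gap[of 0 k] k by (simp add: hit_time_0 mult.commute)
  define N where "N = {n \<in> {- int k..int k}. hit_time n \<le> t}"
  have N: "finite N" "- int k \<in> N"
    using lo by (auto simp: N_def intro: finite_subset[of _ "{- int k..int k}"])
  define n where "n = Max N"
  have n: "n \<in> N" "\<And>m. m \<in> N \<Longrightarrow> m \<le> n" using Max_in[OF N(1)] Max_ge[OF N(1)] N(2) unfolding n_def by blast+
  have "n < int k" using n(1) hi hit_time_less_iff[of n "int k"] by (auto simp: N_def)
  then have "\<not> hit_time (n + 1) \<le> t" using n(2)[of "n + 1"] n(1) by (auto simp: N_def)
  then show ?thesis using n(1) by (intro exI[of _ n]) (auto simp: N_def)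
qed

definition index :: "real \<Rightarrow> int" where
  "index t = (THE n. hit_time n \<le> t \<and> t < hit_time (n + 1))"

lemma index_eq: "hit_time n \<le> t \<Longrightarrow> t < hit_time (n + 1) \<Longrightarrow> index t = n"
  unfolding index_def
proof (intro the_equality conjI; (elim conjE)?)
  fix m assume *: "hit_time n \<le> t" "t < hit_time (n + 1)" "hit_time m \<le> t" "t < hit_time (m + 1)"
  then have "hit_time n < hit_time (m + 1)" "hit_time m < hit_time (n + 1)" by linarith+
  then show "m = n" by (simp add: hit_time_less_iff)
qed

lemma index_bounds: "hit_time (index t) \<le> t" "t < hit_time (index t + 1)"
  using index_exists[of t] index_eq by metis+

definition glued :: "real \<Rightarrow> phase" where
  "glued t = f (index t) (t - hit_time (index t))"

lemma glued_eq: "hit_time n \<le> t \<Longrightarrow> t < hit_time (n + 1) \<Longrightarrow> glued t = f n (t - hit_time n)"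
  by (simp add: glued_def index_eq)

lemma glued_hit: "glued (hit_time n) = f n 0"
  using glued_eq[of n "hit_time n"] by (simp add: hit_time_less_iff)

lemma end_on_wall: "snd (fst (f n (T n))) = 1"
  using on_wall[of "n + 1"] by (simp add: bounce)

lemma flight_table_chain: "0 \<le> t \<Longrightarrow> t \<le> T n \<Longrightarrow> snd (fst (f n t)) \<ge> 1"
  using on_wall[of n] end_on_wall[of n] above[of t n] by (cases "t = 0 \<or> t = T n") fastforce+

lemma hits_glued: "hits glued = range hit_time"
proof (intro set_eqI iffI)
  fix t assume "t \<in> hits glued"
  then have h: "snd (fst (f (index t) (t - hit_time (index t)))) = 1" by (simp add: hits_def glued_def wall_def)
  have "t - hit_time (index t) < T (index t)" using index_bounds(2)[of t] by (simp add: hit_time_step)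
  then have "\<not> 0 < t - hit_time (index t)" using above[of "t - hit_time (index t)" "index t"] h by auto
  then have "t = hit_time (index t)" using index_bounds(1)[of t] by simp
  then show "t \<in> range hit_time" by blast
next
  fix t assume "t \<in> range hit_time"
  then show "t \<in> hits glued" using on_wall by (auto simp: hits_def glued_hit wall_def)
qed

lemma finite_hits: "finite (hits glued \<inter> {a..b})"
proof -
  have "hits glued \<inter> {a..b} \<subseteq> hit_time ` {index a..index b}"
  proof
    fix t assume "t \<in> hits glued \<inter> {a..b}"
    then obtain n where n: "t = hit_time n" "a \<le> hit_time n" "hit_time n \<le> b" by (auto simp: hits_glued)
    have "hit_time (index a) \<le> hit_time n" using index_bounds(1)[of a] n by linarith
    moreover have "hit_time n < hit_time (index b + 1)" using index_bounds(2)[of b] n by linarith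
    ultimately show "t \<in> hit_time ` {index a..index b}" using n(1) by (simp add: hit_time_le_iff hit_time_less_iff)
  qed
  then show ?thesis by (rule finite_subset) simp
qed

lemma glued_solves:
  assumes "t \<notin> hits glued"
  shows "kepler_solution_at glued t"
proof -
  define n where "n = index t"
  have "t \<noteq> hit_time n" using assms by (auto simp: hits_glued)
  then have t: "hit_time n < t" "t < hit_time (n + 1)" using index_bounds[of t] by (auto simp: n_def)
  have "kepler_solution_at (f n) (t - hit_time n)" using t by (intro solves) (simp_all add: hit_time_step)
  then have "(f n has_vector_derivative (snd (glued t), kepler_force (fst (glued t)))) (at (t - hit_time n))"
    using glued_eq[of n t] t by (simp add: kepler_solution_at_def)
  moreover have "((\<lambda>s. s - hit_time n) has_vector_derivative 1) (at t)"
    by (auto intro!: derivative_eq_intros)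
  ultimately have "((f n \<circ> (\<lambda>s. s - hit_time n)) has_vector_derivative (snd (glued t), kepler_force (fst (glued t)))) (at t)"
    using vector_diff_chain_at[of "\<lambda>s. s - hit_time n" 1 t "f n"] by simp
  moreover have "(f n \<circ> (\<lambda>s. s - hit_time n)) s = glued s" if "s \<in> {hit_time n<..<hit_time (n + 1)}" for s
    using that glued_eq[of n s] by simp
  ultimately show ?thesis
    unfolding kepler_solution_at_def
    using has_vector_derivative_transform_within_open[of _ _ t "{hit_time n<..<hit_time (n + 1)}" glued] t
    by auto
qed

lemma f_continuous: "0 \<le> t \<Longrightarrow> t \<le> T n \<Longrightarrow> isCont (f n) t"
  using has_vector_derivative_continuous[OF solves[of t n, unfolded kepler_solution_at_def]] by simp

lemma glued_right: "(glued \<longlongrightarrow> f n 0) (at_right (hit_time n))"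
proof -
  have "((\<lambda>s. f n (s - hit_time n)) \<longlongrightarrow> f n 0) (at_right (hit_time n))"
  proof -
    have "isCont (\<lambda>s. f n (s - hit_time n)) (hit_time n)"
      using f_continuous[of 0 n] T_pos[of n]
      by (intro isCont_o2[where g = "f n" and f = "\<lambda>s. s - hit_time n"]) auto
    then have "((\<lambda>s. f n (s - hit_time n)) \<longlongrightarrow> f n (hit_time n - hit_time n)) (at (hit_time n))"
      by (rule isContD)
    then show ?thesis by (simp add: filterlim_at_split)
  qed
  moreover have "\<forall>\<^sub>F s in at_right (hit_time n). f n (s - hit_time n) = glued s"
    unfolding eventually_at_right_field
    by (rule exI[of _ "hit_time (n + 1)"]) (use glued_eq[of n] hit_time_less_iff[of n "n + 1"] in auto)
  ultimately show ?thesis by (rule Lim_transform_eventually)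
qed

lemma glued_left: "(glued \<longlongrightarrow> f n (T n)) (at_left (hit_time (n + 1)))"
proof -
  have "((\<lambda>s. f n (s - hit_time n)) \<longlongrightarrow> f n (T n)) (at_left (hit_time (n + 1)))"
  proof -
    have "isCont (\<lambda>s. f n (s - hit_time n)) (hit_time (n + 1))"
      using f_continuous[of "T n" n] T_pos[of n]
      by (intro isCont_o2[where g = "f n" and f = "\<lambda>s. s - hit_time n"]) (auto simp: hit_time_step)
    then have "((\<lambda>s. f n (s - hit_time n)) \<longlongrightarrow> f n (hit_time (n + 1) - hit_time n)) (at (hit_time (n + 1)))"
      by (rule isContD)
    then show ?thesis by (simp add: filterlim_at_split hit_time_step)
  qed
  moreover have "\<forall>\<^sub>F s in at_left (hit_time (n + 1)). f n (s - hit_time n) = glued s"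
    unfolding eventually_at_left_field
    by (rule exI[of _ "hit_time n"]) (use glued_eq[of n] hit_time_less_iff[of n "n + 1"] in auto)
  ultimately show ?thesis by (rule Lim_transform_eventually)
qed

theorem glued_bouncing: "bouncing_trajectory glued"
proof -
  have table: "glued t \<in> phase_space" for t
    using index_bounds[of t] flight_table_chain[of "t - hit_time (index t)" "index t"]
    by (simp add: phase_space_def table_def glued_def hit_time_step)
  have left: "(glued \<longlongrightarrow> refl_state (glued (hit_time n))) (at_left (hit_time n))" for n
    using glued_left[of "n - 1"] bounce[of "n - 1"] by (simp add: glued_hit)
  have right: "(glued \<longlongrightarrow> glued (hit_time n)) (at_right (hit_time n))" for n
    using glued_right[of n] by (simp add: glued_hit)
  have "isCont (\<lambda>t. fst (glued t)) t" for t
  proof (cases "t \<in> hits glued")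
    case True
    then obtain n where t: "t = hit_time n" by (auto simp: hits_glued)
    have "((\<lambda>t. fst (glued t)) \<longlongrightarrow> fst (glued t)) (at t)"
      unfolding t filterlim_at_split using tendsto_fst[OF left[of n]] tendsto_fst[OF right[of n]] by simp
    then show ?thesis by (simp add: isCont_def)
  next
    case False
    from glued_solves[OF this] show ?thesis
      unfolding kepler_solution_at_def by (intro continuous_fst has_vector_derivative_continuous)
  qed
  then have "continuous_on UNIV (\<lambda>t. fst (glued t))" by (simp add: continuous_at_imp_continuous_on)
  moreover have "((\<lambda>s. snd (glued s)) \<longlongrightarrow> snd (glued t)) (at_right t)"
    "((\<lambda>s. snd (glued s)) \<longlongrightarrow> reflect (snd (glued t))) (at_left t)" if ht: "t \<in> hits glued" for t
  proof -
    obtain n where t: "t = hit_time n" using ht by (auto simp: hits_glued)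
    show "((\<lambda>s. snd (glued s)) \<longlongrightarrow> snd (glued t)) (at_right t)"
      unfolding t by (rule tendsto_snd[OF right])
    show "((\<lambda>s. snd (glued s)) \<longlongrightarrow> reflect (snd (glued t))) (at_left t)"
      unfolding t using tendsto_snd[OF left[of n]] by (simp add: refl_state_def)
  qed
  ultimately show ?thesis
    unfolding bouncing_trajectory_def
    using table finite_hits glued_solves by (simp add: kepler_solution_at_def)
qed

lemma glued_has_period:
  assumes q: "q > 0" "\<And>n. f (n + q) = f n" "\<And>n. T (n + q) = T n"
  shows "has_period glued (hit_time q)"
proof -
  have shift: "hit_time (n + q) = hit_time n + hit_time q" for n
  proof -
    have "hit_time ((n + 1) + q) - hit_time (n + 1) = hit_time (n + q) - hit_time n" for n
      using hit_time_step[of "n + q"] hit_time_step[of n] q(3)[of n] by (simp add: ac_simps)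
    from int_step_const[of "\<lambda>n. hit_time (n + q) - hit_time n", OF this, of n]
    show ?thesis by (simp add: hit_time_0)
  qed
  have "glued (t + hit_time q) = glued t" for t
  proof -
    define n where "n = index t"
    have "hit_time (n + q) \<le> t + hit_time q" using index_bounds(1)[of t] by (simp add: shift n_def)
    moreover have "t + hit_time q < hit_time (n + q + 1)"
      using index_bounds(2)[of t] shift[of "n + 1"] by (simp add: n_def ac_simps)
    ultimately have "glued (t + hit_time q) = f (n + q) (t + hit_time q - hit_time (n + q))" by (rule glued_eq)
    then show ?thesis by (simp add: q(2) shift glued_def n_def)
  qed
  moreover have "hit_time q > 0" using hit_time_mono[OF q(1)] by (simp add: hit_time_0)
  ultimately show ?thesis by (simp add: has_period_def)
qed

lemma glued_not_constant: "\<not> glued constant_on UNIV"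
proof
  assume "glued constant_on UNIV"
  then have "glued (T 0 / 2) = glued 0" unfolding constant_on_def by auto
  moreover have "hit_time 1 = T 0" using hit_time_step[of 0] by (simp add: hit_time_0)
  then have "glued (T 0 / 2) = f 0 (T 0 / 2)" using glued_eq[of 0 "T 0 / 2"] T_pos[of 0] by (simp add: hit_time_0)
  ultimately show False
    using above[of "T 0 / 2" 0] T_pos[of 0] glued_hit[of 0] on_wall[of 0] by (simp add: hit_time_0)
qed

end

section \<open>Trajectories with a prescribed itinerary\<close>

lemma orbit_eq: "orbit z = range z \<union> refl_state ` {w \<in> range z. snd (fst w) = 1}"
proof -
  have "{(x, reflect p) | x p. (x, p) \<in> S \<and> x \<in> wall} = refl_state ` {w \<in> S. snd (fst w) = 1}" for S
    by (force simp: refl_state_def wall_def)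
  then show ?thesis by (simp add: orbit_def)
qed

lemma fst_orbit: "fst ` orbit z = positions z"
  by (auto simp: orbit_eq positions_def image_iff)

definition itinerary :: "real \<Rightarrow> real \<Rightarrow> (int \<Rightarrow> phase) \<Rightarrow> bool" where
  "itinerary E D \<sigma> \<longleftrightarrow> (\<forall>n. \<sigma> n \<in> outgoing E D \<and> \<sigma> (n + 1) = next_out (\<sigma> n))"

text \<open>The future of a wall state is given by iterating the return map, its past by choosing predecessors.\<close>

lemma itinerary_exists:
  assumes "E < 0" "D + 2 * E > 0" and w: "w \<in> outgoing E D"
  shows "\<exists>\<sigma>. itinerary E D \<sigma> \<and> \<sigma> 0 = w"
proof -
  have "\<forall>w\<in>outgoing E D. \<exists>w'. w' \<in> outgoing E D \<and> next_out w' = w"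
    using prev_out_exists[OF assms(1,2)] by blast
  then obtain pr where pr: "\<And>w. w \<in> outgoing E D \<Longrightarrow> pr w \<in> outgoing E D"
    "\<And>w. w \<in> outgoing E D \<Longrightarrow> next_out (pr w) = w" by metis
  define \<sigma> where "\<sigma> n = (if n \<ge> 0 then (next_out ^^ nat n) w else (pr ^^ nat (- n)) w)" for n :: int
  have fw: "(next_out ^^ k) w \<in> outgoing E D" for k
    by (induction k) (use w next_out_outgoing[OF assms(1,2)] in auto)
  have bw: "(pr ^^ k) w \<in> outgoing E D" for k
    by (induction k) (use w pr in auto)
  have "\<sigma> (n + 1) = next_out (\<sigma> n)" for n
  proof (cases "n \<ge> 0")
    case True
    then have "nat (n + 1) = Suc (nat n)" by simp
    then show ?thesis using True by (simp add: \<sigma>_def)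
  next
    case False
    then have s: "nat (- n) = Suc (nat (- (n + 1)))" by simp
    have "\<sigma> n = pr ((pr ^^ nat (- (n + 1))) w)" using False by (simp add: \<sigma>_def s)
    then have "next_out (\<sigma> n) = (pr ^^ nat (- (n + 1))) w" using pr(2)[OF bw] by simp
    moreover have "\<sigma> (n + 1) = (pr ^^ nat (- (n + 1))) w"
      using False by (cases "n = - 1") (simp_all add: \<sigma>_def)
    ultimately show ?thesis by simp
  qed
  then show ?thesis
    using fw bw by (intro exI[of _ \<sigma>]) (auto simp: itinerary_def \<sigma>_def)
qed

locale bouncing_itinerary =
  fixes E D :: real and \<sigma> :: "int \<Rightarrow> phase"
  assumes E_neg: "E < 0" and D_pos: "D + 2 * E > 0" and it: "itinerary E D \<sigma>"
begin

lemma out: "\<sigma> n \<in> outgoing E D" and step: "\<sigma> (n + 1) = next_out (\<sigma> n)"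
  using it by (auto simp: itinerary_def)

sublocale chain: bounce_chain "\<lambda>n. flight (\<sigma> n)" "\<lambda>n. flight_time (\<sigma> n)" "sqrt (D + 2 * E) * (- E)"
proof
  show "sqrt (D + 2 * E) * - E > 0" using E_neg D_pos by (simp add: mult_pos_neg)
  show "sqrt (D + 2 * E) * - E \<le> flight_time (\<sigma> n)" for n
    by (rule flight_time_lower_bound[OF E_neg D_pos out])
  show "kepler_solution_at (flight (\<sigma> n)) t" if "0 \<le> t" "t \<le> flight_time (\<sigma> n)" for n t
    by (rule flight_solves[OF E_neg D_pos out that])
  show "snd (fst (flight (\<sigma> n) t)) > 1" if "0 < t" "t < flight_time (\<sigma> n)" for n t
    by (rule flight_above[OF E_neg D_pos out that])
  show "snd (fst (flight (\<sigma> n) 0)) = 1" for n by (rule flight_wall[OF E_neg D_pos out])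
  show "flight (\<sigma> (n + 1)) 0 = refl_state (flight (\<sigma> n) (flight_time (\<sigma> n)))" for n
    using flight_start[OF E_neg D_pos out, of "n + 1"] flight_end_next[OF E_neg D_pos out, of n] step[of n] by simp
qed

abbreviation "z \<equiv> chain.glued"

lemma glued_flight: "z t = flight (\<sigma> (chain.index t)) (t - chain.hit_time (chain.index t))"
  by (simp add: chain.glued_def)

lemma glued_flight_range:
  "0 \<le> t - chain.hit_time (chain.index t)"
  "t - chain.hit_time (chain.index t) \<le> flight_time (\<sigma> (chain.index t))"
  using chain.index_bounds[of t] by (simp_all add: chain.hit_time_step)

lemma glued_level_set: "z t \<in> level_set E D"
  unfolding glued_flight by (rule flight_level_set[OF E_neg D_pos out glued_flight_range])

lemma ang_mom_glued: "ang_mom (z t) = ang_mom (\<sigma> (chain.index t))"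
  unfolding glued_flight by (rule flight_invariants[OF E_neg D_pos out glued_flight_range])

lemma glued_hit_state: "z (chain.hit_time n) = \<sigma> n"
  using chain.glued_hit by (simp add: flight_start[OF E_neg D_pos out])

lemma orbit_level_set: "orbit z \<subseteq> level_set E D"
proof
  fix v assume "v \<in> orbit z"
  then consider t where "v = z t" | t where "v = refl_state (z t)" "snd (fst (z t)) = 1"
    by (auto simp: orbit_eq)
  then show "v \<in> level_set E D"
    by cases (auto intro!: glued_level_set refl_state_level_set[OF E_neg D_pos])
qed

lemma flow_in_range:
  assumes "0 \<le> s" "s < exit_par (\<sigma> n)"
  shows "flow (\<sigma> n) s \<in> range z"
proof -
  obtain t where t: "0 \<le> t" "t < flight_time (\<sigma> n)" "flow (\<sigma> n) s = flight (\<sigma> n) t"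
    using flow_eq_flight[OF E_neg D_pos out assms] by blast
  have "z (chain.hit_time n + t) = flight (\<sigma> n) t"
    using chain.glued_eq[of n "chain.hit_time n + t"] t by (simp add: chain.hit_time_step)
  then show ?thesis using t(3) by (metis rangeI)
qed

text \<open>By the cover of the level set by flights, it is enough that the itinerary visits the wall state from
  which the flight through v starts.\<close>

lemma level_set_in_orbit:
  assumes "v \<in> level_set E D"
    and "\<And>w. w \<in> outgoing E D \<Longrightarrow> v = refl_state w \<or> (\<exists>s. 0 \<le> s \<and> s < exit_par w \<and> v = flow w s) \<Longrightarrow> w \<in> range \<sigma>"
  shows "v \<in> orbit z"
proof -
  obtain w where w: "w \<in> outgoing E D" "v = refl_state w \<or> (\<exists>s. 0 \<le> s \<and> s < exit_par w \<and> v = flow w s)"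
    using level_set_cover[OF E_neg D_pos assms(1)] by blast
  then obtain n where n: "w = \<sigma> n" using assms(2) by blast
  from w(2) show ?thesis
  proof
    assume "v = refl_state w"
    moreover have "w \<in> range z" using glued_hit_state[of n] n by (metis rangeI)
    ultimately show ?thesis using outgoingD[OF E_neg D_pos w(1)] by (auto simp: orbit_eq)
  next
    assume "\<exists>s. 0 \<le> s \<and> s < exit_par w \<and> v = flow w s"
    then show ?thesis using flow_in_range n by (auto simp: orbit_eq)
  qed
qed

lemma periodic:
  assumes "q > 0" "\<And>n. \<sigma> (n + q) = \<sigma> n"
  shows "periodic_trajectory z" "has_period z (chain.hit_time q)"
proof -
  show "has_period z (chain.hit_time q)" using assms by (intro chain.glued_has_period) simp_all
  then show "periodic_trajectory z"
    unfolding periodic_trajectory_def trajectory_def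
    using chain.glued_bouncing chain.glued_not_constant by blast
qed

end

section \<open>The orbit on the ellipse centred at the wall\<close>

lemma fst_level_set_nonzero: "w \<in> level_set E D \<Longrightarrow> fst w \<noteq> 0"
  by (auto simp: level_set_def phase_space_def table_def)

lemma closed_segment_vertical:
  "a \<le> b \<Longrightarrow> closed_segment (c, a) (c, b) = {x. fst x = c \<and> a \<le> snd x \<and> snd x \<le> (b::real)}" for c :: real
  using closed_segment_linear_image[of "\<lambda>y. (0::real, y::real)" a b] closed_segment_translation[of "(c, 0)" "(0::real, a)" "(0, b)"]
  by (auto simp: closed_segment_eq_real_ivl linear_iff image_image)

lemma closed_segment_horizontal:
  "a \<le> b \<Longrightarrow> closed_segment (a, c) (b, c) = {x. snd x = c \<and> a \<le> fst x \<and> fst x \<le> (b::real)}" for c :: real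
  using closed_segment_linear_image[of "\<lambda>y. (y::real, 0::real)" a b] closed_segment_translation[of "(0, c)" "(a, 0::real)" "(b, 0)"]
  by (auto simp: closed_segment_eq_real_ivl linear_iff image_image)

context
  fixes E D :: real
  assumes E: "- (1/2) < E" "E < 0" and R: "1 + 2 * D * E + 4 * E\<^sup>2 = 0"
begin

definition half_minor where "half_minor = sqrt (1 / (4 * E\<^sup>2) - 1)"

lemma four_E_sq: "4 * E\<^sup>2 < 1"
proof -
  have "(2 * E)\<^sup>2 < 1" using E by (intro abs_square_less_1[THEN iffD2]) auto
  then show ?thesis by (simp add: power_mult_distrib)
qed

lemma half_minor: "half_minor > 0" "half_minor\<^sup>2 = 1 / (4 * E\<^sup>2) - 1"
proof -
  have "1 / (4 * E\<^sup>2) > 1" using E four_E_sq by simp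
  then show "half_minor > 0" "half_minor\<^sup>2 = 1 / (4 * E\<^sup>2) - 1" by (simp_all add: half_minor_def)
qed

lemma D_of_E: "D = - (1 + 4 * E\<^sup>2) / (2 * E)"
  using R E by (simp add: field_simps)

lemma D_plus_2E_pos: "D + 2 * E > 0"
proof -
  have "D + 2 * E = - 1 / (2 * E)" using E by (simp add: D_of_E field_simps power2_eq_square)
  then show ?thesis using E by simp
qed

text \<open>The circle of second foci is a point here, so all conics of the level set coincide.\<close>

lemma level_set_lrl:
  assumes "w \<in> level_set E D"
  shows "lrl w = (0, 2 * E)" "(ang_mom w)\<^sup>2 = D + 4 * E"
    "norm (fst w) = D + 4 * E - 2 * E * snd (fst w)"
proof -
  have "(fst (lrl w))\<^sup>2 + (snd (lrl w) - 2 * E)\<^sup>2 = 0"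
    using lrl_circle[OF fst_level_set_nonzero[OF assms]] assms R by (simp add: level_set_def mult_ac)
  then show l: "lrl w = (0, 2 * E)" by (simp add: sum_power2_eq_zero_iff prod_eq_iff)
  then show L: "(ang_mom w)\<^sup>2 = D + 4 * E" using assms by (simp add: level_set_def D_int_def)
  show "norm (fst w) = D + 4 * E - 2 * E * snd (fst w)"
    using lrl_products(1)[OF fst_level_set_nonzero[OF assms]] by (simp add: l L inner_prod_def)
qed

lemma D_plus_4E_eq: "D + 4 * E = (4 * E\<^sup>2 - 1) / (2 * E)" "D + 2 * E = - 1 / (2 * E)"
  using E by (simp_all add: D_of_E field_simps power2_eq_square)

text \<open>The ends of the minor axis, for e = 1 and e = - 1, with the velocity orthogonal to the wall.\<close>

definition start_state :: "real \<Rightarrow> phase" where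
  "start_state e = ((e * half_minor, 1), (0, sqrt (- 2 * E)))"

lemma start_state_outgoing: "e\<^sup>2 = 1 \<Longrightarrow> start_state e \<in> outgoing E D"
proof -
  assume e: "e\<^sup>2 = 1"
  have n: "norm (fst (start_state e)) = - 1 / (2 * E)"
  proof -
    have "(e * half_minor)\<^sup>2 + 1 = (- 1 / (2 * E))\<^sup>2"
      by (simp add: power_mult_distrib e half_minor power_divide)
    then show ?thesis using E by (simp add: norm_plane start_state_def real_sqrt_abs)
  qed
  have en: "energy (start_state e) = E"
    unfolding energy_def n by (simp add: start_state_def norm_plane) (use E in \<open>simp\<close>)
  moreover have "D_int (start_state e) + 2 * E = - 1 / (2 * E)"
    using wall_D_plus_2E[of "start_state e"] E unfolding n en
    by (simp add: start_state_def power_mult_distrib power_divide) (simp add: power2_eq_square)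
  ultimately show ?thesis
    using E D_plus_4E_eq(2) by (simp add: outgoing_def level_set_def phase_space_def table_def start_state_def)
qed

lemma outgoing_start_state:
  assumes "w \<in> outgoing E D"
  shows "w = start_state 1 \<or> w = start_state (- 1)"
proof -
  note w = outgoingD[OF E(2) D_plus_2E_pos assms]
  have n: "norm (fst w) = - 1 / (2 * E)"
    using level_set_lrl(3)[OF w(6)] w(7) D_plus_4E_eq by simp
  have "snd (snd w) * ang_mom w = fst (fst w) / norm (fst w)"
    "- fst (snd w) * ang_mom w - 1 / norm (fst w) = 2 * E"
    using level_set_lrl(1)[OF w(6)] lrl_coords[of w] w(7) by simp_all
  then have "fst (snd w) * ang_mom w = 0" by (simp add: n)
  moreover have "ang_mom w \<noteq> 0"
    using level_set_lrl(2)[OF w(6)] four_E_sq E by (auto simp: D_plus_4E_eq)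
  ultimately have p1: "fst (snd w) = 0" by simp
  have "(snd (snd w))\<^sup>2 = - 2 * E"
    using momentum_sq[of w] w(1) by (simp add: n p1 inner_prod_def power2_eq_square)
  then have p2: "snd (snd w) = sqrt (- 2 * E)" using w(8) by (metis abs_of_pos real_sqrt_abs)
  have "(fst (fst w))\<^sup>2 + 1 = (- 1 / (2 * E))\<^sup>2"
    using norm_plane_sq[of "fst w"] w(7) by (simp add: n)
  then have "(fst (fst w))\<^sup>2 = half_minor\<^sup>2" by (simp add: half_minor power_divide power_mult_distrib)
  then have "fst (fst w) = half_minor \<or> fst (fst w) = - half_minor" by (simp add: power2_eq_iff)
  then show ?thesis using p1 p2 w(7) by (auto simp: start_state_def prod_eq_iff)
qed

text \<open>The sign of e is the sign of the angular momentum after the reflection, and the flight conserves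
  the angular momentum: it cannot come back to the end where it started.\<close>

lemma next_start_state:
  assumes "e = 1 \<or> e = - 1"
  shows "next_out (start_state e) = start_state (- e)"
proof -
  define w where "w = start_state e"
  have e: "e\<^sup>2 = 1" using assms by auto
  have w: "w \<in> outgoing E D" using start_state_outgoing e by (simp add: w_def)
  have n: "next_out w \<in> outgoing E D" by (rule next_out_outgoing[OF E(2) D_plus_2E_pos w])
  have "ang_mom (refl_state (next_out w)) = ang_mom w"
    using flight_invariants(1)[OF E(2) D_plus_2E_pos w, of "flight_time w"] flight_time_pos[OF E(2) D_plus_2E_pos w]
    by (simp add: flight_end_next[OF E(2) D_plus_2E_pos w, symmetric])
  then have "next_out w \<noteq> w"
    using half_minor(1) E assms by (auto simp: w_def ang_mom_def start_state_def)
  then show ?thesis using outgoing_start_state[OF n] assms by (auto simp: w_def)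
qed

text \<open>The two outgoing states exchange under the return map. A shorter period would be the time of the
  first hit, where the particle is at the other end.\<close>

lemma two_periodic_orbit:
  "\<exists>z. periodic_trajectory z \<and> n_periodic 2 z \<and> level_set E D = orbit z"
proof -
  define \<sigma> where "\<sigma> n = start_state (if even n then 1 else - 1)" for n :: int
  have "itinerary E D \<sigma>"
    unfolding itinerary_def \<sigma>_def using next_start_state start_state_outgoing by auto
  then interpret bouncing_itinerary E D \<sigma>
    using E D_plus_2E_pos by unfold_locales
  have "v \<in> orbit z" if "v \<in> level_set E D" for v
  proof (rule level_set_in_orbit[OF that])
    fix w assume "w \<in> outgoing E D"
    then have "w = \<sigma> 0 \<or> w = \<sigma> 1" using outgoing_start_state by (simp add: \<sigma>_def)
    then show "w \<in> range \<sigma>" by blast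
  qed
  then have "level_set E D = orbit z" using orbit_level_set by blast
  moreover have per: "\<sigma> (n + 2) = \<sigma> n" for n by (simp add: \<sigma>_def)
  moreover have "n_periodic 2 z"
    unfolding n_periodic_def
  proof (intro conjI exI[of _ "chain.hit_time 2"] allI impI)
    show "bouncing_trajectory z" by (rule chain.glued_bouncing)
    show "has_period z (chain.hit_time 2)" using per by (intro periodic) auto
    show "chain.hit_time 2 \<le> S" if S: "has_period z S" for S
    proof (rule ccontr)
      assume n: "\<not> chain.hit_time 2 \<le> S"
      have S0: "S > 0" "z S = z 0" using S by (auto simp: has_period_def) (metis add_0)
      have z0: "z 0 = \<sigma> 0" using glued_hit_state[of 0] by (simp add: chain.hit_time_0)
      then have "S \<in> hits z" using S0(2) outgoingD(7)[OF E(2) D_plus_2E_pos out[of 0]] by (simp add: hits_def wall_def)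
      then obtain m where m: "S = chain.hit_time m" by (auto simp: chain.hits_glued)
      have "chain.hit_time 0 < chain.hit_time m" "chain.hit_time m < chain.hit_time 2"
        using S0 n m by (simp_all add: chain.hit_time_0)
      then have "m = 1" by (simp add: chain.hit_time_less_iff)
      then have "\<sigma> 1 = \<sigma> 0" using glued_hit_state[of 1] S0(2) m z0 by simp
      then show False using half_minor(1) by (simp add: \<sigma>_def start_state_def)
    qed
    have "hits z \<inter> {0..<chain.hit_time 2} = {chain.hit_time 0, chain.hit_time 1}"
    proof (intro set_eqI iffI)
      fix t assume "t \<in> hits z \<inter> {0..<chain.hit_time 2}"
      then obtain m where m: "t = chain.hit_time m" "chain.hit_time 0 \<le> chain.hit_time m" "chain.hit_time m < chain.hit_time 2"
        by (auto simp: chain.hits_glued chain.hit_time_0)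
      then have "m = 0 \<or> m = 1" by (simp add: chain.hit_time_less_iff chain.hit_time_le_iff) presburger
      then show "t \<in> {chain.hit_time 0, chain.hit_time 1}" using m by auto
    next
      fix t assume "t \<in> {chain.hit_time 0, chain.hit_time 1}"
      then obtain m where m: "t = chain.hit_time m" "0 \<le> m" "m < 2" by fastforce
      then show "t \<in> hits z \<inter> {0..<chain.hit_time 2}"
        using chain.hit_time_le_iff[of 0 m] chain.hit_time_less_iff[of m 2]
        by (simp add: chain.hits_glued chain.hit_time_0)
    qed
    then show "card (hits z \<inter> {0..<chain.hit_time 2}) = 2"
      using chain.hit_time_less_iff[of 0 1] by simp
  qed
  ultimately show ?thesis using periodic(1)[of 2] by auto
qed

text \<open>For the inclusion from right to left, the momentum at a point of the ellipse is found by solving the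
  definition of A = (0, 2 E) for p.\<close>

lemma level_set_positions:
  "fst ` level_set E D = axis_ellipse (0, 1) (half_minor\<^sup>2) (1 / (4 * E\<^sup>2)) \<inter> table"
proof -
  have pos: "1 - 4 * E\<^sup>2 > 0" using four_E_sq by simp
  have eqv: "x\<^sup>2 + y\<^sup>2 = (D + 4 * E - 2 * E * y)\<^sup>2 \<longleftrightarrow> x\<^sup>2 / half_minor\<^sup>2 + (y - 1)\<^sup>2 / (1 / (4 * E\<^sup>2)) = 1" for x y
  proof -
    define e where "e = 4 * E\<^sup>2"
    have e: "e > 0" "1 - e > 0" using E pos by (simp_all add: e_def)
    have hm: "half_minor\<^sup>2 = (1 - e) / e" using e by (simp add: half_minor e_def[symmetric] field_simps)
    have "2 * E * (D + 4 * E - 2 * E * y) = e - 1 - e * y"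
      using E unfolding D_plus_4E_eq e_def by (simp add: field_simps power2_eq_square)
    then have sq: "e * (D + 4 * E - 2 * E * y)\<^sup>2 = (e - 1 - e * y)\<^sup>2"
      unfolding e_def by (metis power_mult_distrib four_x_squared)
    have "x\<^sup>2 + y\<^sup>2 = (D + 4 * E - 2 * E * y)\<^sup>2 \<longleftrightarrow> e * (x\<^sup>2 + y\<^sup>2) = (e - 1 - e * y)\<^sup>2"
      unfolding sq[symmetric] using e by simp
    also have "\<dots> \<longleftrightarrow> x\<^sup>2 * e + (y - 1)\<^sup>2 * e * (1 - e) = 1 - e"
      by (simp add: power2_eq_square algebra_simps)
    also have "\<dots> \<longleftrightarrow> x\<^sup>2 / half_minor\<^sup>2 + (y - 1)\<^sup>2 / (1 / e) = 1"
      unfolding hm using e by (simp add: field_simps) (rule eq_commute)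
    finally show ?thesis unfolding e_def .
  qed
  show ?thesis
  proof (intro set_eqI iffI)
    fix x assume "x \<in> fst ` level_set E D"
    then obtain w where w: "w \<in> level_set E D" "x = fst w" by blast
    have "(fst x)\<^sup>2 + (snd x)\<^sup>2 = (D + 4 * E - 2 * E * snd x)\<^sup>2"
      using level_set_lrl(3)[OF w(1)] norm_plane_sq[of x] w(2) by simp
    then show "x \<in> axis_ellipse (0, 1) (half_minor\<^sup>2) (1 / (4 * E\<^sup>2)) \<inter> table"
      using w by (simp add: eqv axis_ellipse_def level_set_def phase_space_def)
  next
    fix x assume x: "x \<in> axis_ellipse (0, 1) (half_minor\<^sup>2) (1 / (4 * E\<^sup>2)) \<inter> table"
    define r where "r = D + 4 * E - 2 * E * snd x"
    have y: "snd x \<ge> 1" using x by (simp add: table_def)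
    have rr: "(fst x)\<^sup>2 + (snd x)\<^sup>2 = r\<^sup>2"
      using x unfolding r_def eqv by (simp add: axis_ellipse_def)
    have D4p: "D + 4 * E > 0" using pos E by (simp add: D_plus_4E_eq divide_neg_neg)
    have "- 2 * E * snd x > 0" using y E by (simp add: mult_neg_pos)
    then have r: "r > 0" using D4p by (simp add: r_def)
    have nx: "norm x = r" using r rr by (simp add: norm_plane)
    define L where "L = sqrt (D + 4 * E)"
    have L: "L > 0" "L\<^sup>2 = D + 4 * E" using D4p by (simp_all add: L_def)
    define w where "w = (x, (- (2 * E + snd x / r) / L, fst x / (r * L)))"
    have Ey: "2 * E * snd x = L\<^sup>2 - r" by (simp add: r_def L)
    have am: "ang_mom w = L"
    proof -
      have "ang_mom w * (r * L) = (fst x)\<^sup>2 + (snd x)\<^sup>2 + 2 * E * snd x * r"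
        using r L(1) by (simp add: w_def ang_mom_def field_simps power2_eq_square)
      also have "\<dots> = r\<^sup>2 + (L\<^sup>2 - r) * r" by (simp only: rr Ey)
      also have "\<dots> = L * (r * L)" by (simp add: power2_eq_square algebra_simps)
      finally show ?thesis using r L(1) by simp
    qed
    have lr: "lrl w = (0, 2 * E)"
      using r L(1) by (intro prod_eqI) (simp_all add: lrl_coords am, simp_all add: w_def nx)
    have "1 + 2 * energy w * L\<^sup>2 = 4 * E\<^sup>2"
    proof -
      have "x \<noteq> 0" using nx r by auto
      then have "fst w \<noteq> 0" by (simp add: w_def)
      from lrl_products(3)[OF this] show ?thesis by (simp add: lr am inner_prod_def power2_eq_square)
    qed
    moreover have "1 + 2 * E * L\<^sup>2 = 4 * E\<^sup>2" unfolding L(2) D_plus_4E_eq using E by simp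
    ultimately have "2 * energy w * L\<^sup>2 = 2 * E * L\<^sup>2" by linarith
    then have "energy w = E" using L(1) by simp
    moreover have "D_int w = D" by (simp add: D_int_def lr am L(2))
    ultimately have "w \<in> level_set E D" using x by (simp add: level_set_def phase_space_def w_def)
    then show "x \<in> fst ` level_set E D" by (force simp: w_def)
  qed
qed

lemma two_periodic_minor_axis:
  "is_minor_axis (closed_segment (- half_minor, 1) (half_minor, 1))
     (axis_ellipse (0, 1) (half_minor\<^sup>2) (1 / (4 * E\<^sup>2)))"
  "closed_segment (- half_minor, 1) (half_minor, 1) \<subseteq> wall"
proof -
  have "half_minor\<^sup>2 < 1 / (4 * E\<^sup>2)" by (simp add: half_minor)
  then show "is_minor_axis (closed_segment (- half_minor, 1) (half_minor, 1))
     (axis_ellipse (0, 1) (half_minor\<^sup>2) (1 / (4 * E\<^sup>2)))"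
    unfolding is_minor_axis_def using half_minor(1) E
    by (intro exI[of _ "(0, 1)"] exI[of _ "half_minor\<^sup>2"] exI[of _ "1 / (4 * E\<^sup>2)"]) simp
  show "closed_segment (- half_minor, 1) (half_minor, 1) \<subseteq> wall"
    using half_minor(1) by (simp add: closed_segment_horizontal wall_def) auto
qed

end

section \<open>The orbit on the vertical axis\<close>

definition vertical :: "phase \<Rightarrow> bool" where
  "vertical w \<longleftrightarrow> fst (fst w) = 0 \<and> fst (snd w) = 0"

text \<open>If L = 0 and D = 2, then A = (0, - 1). The conic equation reduces to r = x2, and L = 0 leaves only
  vertical momentum.\<close>

lemma ang_mom_zero_iff_vertical:
  assumes w: "w \<in> level_set E 2"
  shows "ang_mom w = 0 \<longleftrightarrow> vertical w"
proof
  assume L: "ang_mom w = 0"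
  note w0 = fst_level_set_nonzero[OF w]
  have A2: "snd (lrl w) = - 1" using w L by (simp add: level_set_def D_int_def)
  have "fst (lrl w) = 0" using lrl_products(3)[OF w0] L A2 by (simp add: inner_prod_def)
  then have r: "norm (fst w) = snd (fst w)"
    using lrl_products(1)[OF w0] L A2 by (simp add: inner_prod_def)
  then have "fst (fst w) = 0" using norm_plane_sq[of "fst w"] by simp
  moreover have "snd (fst w) \<noteq> 0" using r w0 by auto
  ultimately show "vertical w" using L by (simp add: vertical_def ang_mom_def)
qed (simp add: vertical_def ang_mom_def)

text \<open>Elimination of the second component of A from the equation of the eccentricity, by means of D = 2.\<close>

lemma lrl_ang_mom_quartic:
  assumes w: "w \<in> level_set E 2"
  shows "4 * (fst (lrl w))\<^sup>2 + ang_mom w ^ 4 = 4 * ((2 * E + 1) * (ang_mom w)\<^sup>2)"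
proof -
  have s: "snd (lrl w) = ((ang_mom w)\<^sup>2 - 2) / 2" using w by (simp add: level_set_def D_int_def)
  have "(fst (lrl w))\<^sup>2 + (snd (lrl w))\<^sup>2 = 1 + 2 * E * (ang_mom w)\<^sup>2"
    using lrl_products(3)[OF fst_level_set_nonzero[OF w]] w
    by (simp add: inner_prod_def level_set_def power2_eq_square)
  then have "(fst (lrl w))\<^sup>2 + (((ang_mom w)\<^sup>2 - 2) / 2)\<^sup>2 = 1 + 2 * E * (ang_mom w)\<^sup>2" unfolding s .
  then show ?thesis by (simp add: power2_eq_square power4_eq_xxxx field_simps)
qed

text \<open>The right-hand side of the previous identity is negative unless L = 0.\<close>

lemma slow_level_set_vertical:
  assumes E: "E < - (1/2)" and w: "w \<in> level_set E 2"
  shows "vertical w"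
proof (rule ccontr)
  assume "\<not> vertical w"
  then have L: "ang_mom w \<noteq> 0" using ang_mom_zero_iff_vertical[OF w] by simp
  have "(2 * E + 1) * (ang_mom w)\<^sup>2 < 0" using E L by (intro mult_neg_pos) auto
  moreover have "ang_mom w ^ 4 \<ge> 0" by simp
  ultimately show False using lrl_ang_mom_quartic[OF w] zero_le_power2[of "fst (lrl w)"] by linarith
qed

definition vertical_states :: "real \<Rightarrow> phase set" where
  "vertical_states E = {w \<in> level_set E 2. vertical w}"

context
  fixes E :: real
  assumes E: "- 1 < E" "E < 0"
begin

lemma two_plus_2E_pos: "2 + 2 * E > 0" using E by simp

definition vertical_start :: phase where
  "vertical_start = ((0, 1), (0, sqrt (2 * (1 + E))))"

lemma vertical_level_set_iff:
  "((0, y), (0, q)) \<in> level_set E 2 \<longleftrightarrow> y \<ge> 1 \<and> q\<^sup>2 = 2 * (E + 1 / y)"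
  by (auto simp: level_set_def phase_space_def table_def energy_def D_int_def ang_mom_def lrl_coords norm_plane
      add_divide_distrib)

lemma vertical_outgoing: "w \<in> outgoing E 2 \<and> vertical w \<longleftrightarrow> w = vertical_start"
proof -
  have "q > 0 \<and> q\<^sup>2 = 2 * (E + 1) \<longleftrightarrow> q = sqrt (2 * (1 + E))" for q
    using E by (auto simp: add.commute intro: real_sqrt_unique[symmetric])
  note q_iff = this
  obtain x y p q where w: "w = ((x, y), (p, q))" by (metis surj_pair)
  have "w \<in> outgoing E 2 \<and> vertical w \<longleftrightarrow> x = 0 \<and> p = 0 \<and> y = 1 \<and> q > 0 \<and> ((0, y), (0, q)) \<in> level_set E 2"
    by (auto simp: w outgoing_def vertical_def)
  also have "\<dots> \<longleftrightarrow> x = 0 \<and> p = 0 \<and> y = 1 \<and> (q > 0 \<and> q\<^sup>2 = 2 * (E + 1))"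
    unfolding vertical_level_set_iff by auto
  also have "\<dots> \<longleftrightarrow> w = vertical_start"
    unfolding q_iff by (auto simp: w vertical_start_def)
  finally show ?thesis .
qed

lemma vertical_next: "next_out vertical_start = vertical_start"
proof -
  have w: "vertical_start \<in> outgoing E 2" "vertical vertical_start" using vertical_outgoing by blast+
  have n: "next_out vertical_start \<in> outgoing E 2" by (rule next_out_outgoing[OF E(2) two_plus_2E_pos w(1)])
  have "ang_mom (refl_state (next_out vertical_start)) = ang_mom vertical_start"
    using flight_invariants(1)[OF E(2) two_plus_2E_pos w(1), of "flight_time vertical_start"] flight_time_pos[OF E(2) two_plus_2E_pos w(1)]
    by (simp add: flight_end_next[OF E(2) two_plus_2E_pos w(1), symmetric])
  then have "ang_mom (refl_state (next_out vertical_start)) = 0"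
    using w(2) by (simp add: vertical_def ang_mom_def)
  moreover have "refl_state (next_out vertical_start) \<in> level_set E 2"
    using n refl_state_level_set[OF E(2) two_plus_2E_pos] by (simp add: outgoing_def)
  ultimately have "vertical (refl_state (next_out vertical_start))"
    by (simp add: ang_mom_zero_iff_vertical)
  then have "vertical (next_out vertical_start)" by (simp add: vertical_def)
  then show ?thesis using n vertical_outgoing by blast
qed

text \<open>The only vertical outgoing state is a fixed point of the return map.\<close>

lemma vertical_orbit:
  "\<exists>z. periodic_trajectory z \<and> bouncing_trajectory z \<and> orbit z = vertical_states E"
proof -
  define \<sigma> where "\<sigma> n = vertical_start" for n :: int
  have "itinerary E 2 \<sigma>"
    unfolding itinerary_def \<sigma>_def using vertical_next vertical_outgoing[of vertical_start] by simp
  then interpret bouncing_itinerary E 2 \<sigma>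
    using E two_plus_2E_pos by unfold_locales
  have "vertical (z t)" for t
    using ang_mom_zero_iff_vertical[OF glued_level_set] ang_mom_glued[of t]
    by (simp add: \<sigma>_def vertical_start_def ang_mom_def)
  then have "orbit z \<subseteq> vertical_states E"
    using orbit_level_set by (auto simp: vertical_states_def orbit_eq vertical_def)
  moreover have "v \<in> orbit z" if v: "v \<in> vertical_states E" for v
  proof (rule level_set_in_orbit)
    show "v \<in> level_set E 2" using v by (simp add: vertical_states_def)
    fix w assume w: "w \<in> outgoing E 2"
      "v = refl_state w \<or> (\<exists>s. 0 \<le> s \<and> s < exit_par w \<and> v = flow w s)"
    have "vertical w"
    proof (cases "v = refl_state w")
      case True
      then show ?thesis using v by (simp add: vertical_states_def vertical_def)
    next
      case False
      then obtain s where s: "v = flow w s" using w(2) by blast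
      have "fst (flow w s) \<noteq> 0" using v fst_level_set_nonzero[of v E 2] unfolding s by (simp add: vertical_states_def)
      then have "ang_mom v = ang_mom w"
        using flow_invariants(3)[OF outgoingD(3,5)[OF E(2) two_plus_2E_pos w(1)]] s by simp
      then show ?thesis
        using v outgoingD(6)[OF E(2) two_plus_2E_pos w(1)] ang_mom_zero_iff_vertical[of v E] ang_mom_zero_iff_vertical[of w E]
        by (simp add: vertical_states_def)
    qed
    then show "w \<in> range \<sigma>" using w(1) vertical_outgoing[of w] by (auto simp: \<sigma>_def)
  qed
  ultimately have "orbit z = vertical_states E" by blast
  moreover have "periodic_trajectory z" by (rule periodic(1)[of 1]) (simp_all add: \<sigma>_def)
  ultimately show ?thesis using chain.glued_bouncing by blast
qed

lemma vertical_positions: "fst ` vertical_states E = closed_segment (0, 1) (0, - 1 / E)"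
proof -
  have h: "1 \<le> - 1 / E" using E by (subst neg_le_divide_eq) auto
  have "(\<exists>q. ((0, y), (0, q)) \<in> level_set E 2) \<longleftrightarrow> 1 \<le> y \<and> y \<le> - 1 / E" for y
  proof -
    have "(\<exists>q. q\<^sup>2 = 2 * (E + 1 / y)) \<longleftrightarrow> y \<le> - 1 / E" if y: "y \<ge> 1"
    proof -
      have "E + 1 / y \<ge> 0 \<longleftrightarrow> y \<le> - 1 / E"
        using y E by (simp add: neg_le_divide_eq field_simps) linarith
      moreover have "(\<exists>q. q\<^sup>2 = 2 * (E + 1 / y)) \<longleftrightarrow> E + 1 / y \<ge> 0"
      proof
        assume "E + 1 / y \<ge> 0"
        then have "(sqrt (2 * (E + 1 / y)))\<^sup>2 = 2 * (E + 1 / y)" by simp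
        then show "\<exists>q. q\<^sup>2 = 2 * (E + 1 / y)" by blast
      next
        assume "\<exists>q. q\<^sup>2 = 2 * (E + 1 / y)"
        then obtain q where "q\<^sup>2 = 2 * (E + 1 / y)" by blast
        then have "0 \<le> 2 * (E + 1 / y)" using zero_le_power2[of q] by simp
        then show "E + 1 / y \<ge> 0" by simp
      qed
      ultimately show ?thesis by simp
    qed
    then show ?thesis by (auto simp: vertical_level_set_iff)
  qed
  then have "fst ` vertical_states E = {x. fst x = 0 \<and> 1 \<le> snd x \<and> snd x \<le> - 1 / E}"
    by (force simp: vertical_states_def vertical_def image_iff)
  then show ?thesis using closed_segment_vertical[OF h] by simp
qed

end

section \<open>Conservation laws along arbitrary trajectories\<close>

lemma D_int_coords:
  "D_int w = (ang_mom w)\<^sup>2 + 2 * fst (snd w) * ang_mom w + 2 * snd (fst w) / norm (fst w)"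
  by (simp add: D_int_def lrl_coords algebra_simps)

lemma integrals_isCont:
  assumes "fst w \<noteq> 0"
  shows "isCont energy w" "isCont ang_mom w" "isCont D_int w"
  unfolding energy_def[abs_def] D_int_coords[abs_def] ang_mom_def[abs_def]
  using assms by (auto intro!: continuous_intros)

lemma integrals_derivative:
  assumes z: "kepler_solution_at z t" "fst (z t) \<noteq> 0"
  shows "((\<lambda>t. energy (z t)) has_real_derivative 0) (at t)"
    "((\<lambda>t. ang_mom (z t)) has_real_derivative 0) (at t)"
    "((\<lambda>t. D_int (z t)) has_real_derivative 0) (at t)"
proof -
  define x1 where "x1 t = fst (fst (z t))" for t
  define x2 where "x2 t = snd (fst (z t))" for t
  define p1 where "p1 t = fst (snd (z t))" for t
  define p2 where "p2 t = snd (snd (z t))" for t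
  define r where "r = norm (fst (z t))"
  have r: "r > 0" "r = sqrt ((x1 t)\<^sup>2 + (x2 t)\<^sup>2)" "r\<^sup>2 = (x1 t)\<^sup>2 + (x2 t)\<^sup>2"
    using z(2) by (simp add: r_def) (simp_all add: r_def norm_plane x1_def x2_def)
  note Z = z(1)[unfolded kepler_solution_at_def]
  note fstD = bounded_linear.has_vector_derivative[OF bounded_linear_fst]
  note sndD = bounded_linear.has_vector_derivative[OF bounded_linear_snd]
  have d: "(x1 has_real_derivative p1 t) (at t)" "(x2 has_real_derivative p2 t) (at t)"
    "(p1 has_real_derivative - (x1 t / r ^ 3)) (at t)" "(p2 has_real_derivative - (x2 t / r ^ 3)) (at t)"
    using fstD[OF fstD[OF Z]] sndD[OF fstD[OF Z]] fstD[OF sndD[OF Z]] sndD[OF sndD[OF Z]]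
    by (simp_all add: has_real_derivative_iff_has_vector_derivative kepler_force_def
        x1_def[abs_def] x2_def[abs_def] p1_def[abs_def] p2_def[abs_def] r_def divide_inverse mult.commute)
  have dr: "((\<lambda>t. sqrt ((x1 t)\<^sup>2 + (x2 t)\<^sup>2)) has_real_derivative (x1 t * p1 t + x2 t * p2 t) / r) (at t)"
  proof -
    have dsq: "((\<lambda>t. (x1 t)\<^sup>2 + (x2 t)\<^sup>2) has_real_derivative 2 * (x1 t * p1 t + x2 t * p2 t)) (at t)"
      by (auto intro!: derivative_eq_intros d simp: algebra_simps)
    have pos: "(x1 t)\<^sup>2 + (x2 t)\<^sup>2 > 0" unfolding r(3)[symmetric] using r(1) by simp
    note dch = DERIV_chain2[where f = sqrt and g = "\<lambda>t. (x1 t)\<^sup>2 + (x2 t)\<^sup>2", OF DERIV_real_sqrt[OF pos] dsq]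
    have "inverse (sqrt ((x1 t)\<^sup>2 + (x2 t)\<^sup>2)) / 2 * (2 * (x1 t * p1 t + x2 t * p2 t)) = (x1 t * p1 t + x2 t * p2 t) / r"
      unfolding r(2)[symmetric] using r(1) by (simp add: field_simps)
    with dch show ?thesis by metis
  qed
  have L: "((\<lambda>t. x1 t * p2 t - x2 t * p1 t) has_real_derivative 0) (at t)"
    by (auto intro!: derivative_eq_intros d)
  then show "((\<lambda>t. ang_mom (z t)) has_real_derivative 0) (at t)"
    by (simp add: ang_mom_def x1_def x2_def p1_def p2_def)
  have r0: "sqrt ((x1 t)\<^sup>2 + (x2 t)\<^sup>2) \<noteq> 0" unfolding r(2)[symmetric] using r(1) by simp
  have "((\<lambda>t. ((p1 t)\<^sup>2 + (p2 t)\<^sup>2) / 2 - inverse (sqrt ((x1 t)\<^sup>2 + (x2 t)\<^sup>2))) has_real_derivative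
      (2 * p1 t * - (x1 t / r ^ 3) + 2 * p2 t * - (x2 t / r ^ 3)) / 2
       - - (inverse r * ((x1 t * p1 t + x2 t * p2 t) / r) * inverse r)) (at t)"
    using DERIV_inverse'[OF dr r0] unfolding r(2)[symmetric]
    by (intro derivative_intros) (auto intro!: derivative_eq_intros d simp: mult_ac)
  also have "(2 * p1 t * - (x1 t / r ^ 3) + 2 * p2 t * - (x2 t / r ^ 3)) / 2
       - - (inverse r * ((x1 t * p1 t + x2 t * p2 t) / r) * inverse r) = 0"
    using r(1) by (simp add: field_simps power3_eq_cube)
  finally show "((\<lambda>t. energy (z t)) has_real_derivative 0) (at t)"
    by (simp add: energy_def norm_plane_sq norm_plane x1_def x2_def p1_def p2_def inverse_eq_divide)
  define l where "l t = x1 t * p2 t - x2 t * p1 t" for t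
  have l: "(l has_real_derivative 0) (at t)" using L by (simp add: l_def[abs_def])
  define i where "i t = inverse (sqrt ((x1 t)\<^sup>2 + (x2 t)\<^sup>2))" for t
  define K where "K = - (inverse r * ((x1 t * p1 t + x2 t * p2 t) / r) * inverse r)"
  have i: "(i has_real_derivative K) (at t)" "i t = inverse r"
    using DERIV_inverse'[OF dr r0] unfolding r(2)[symmetric] i_def[abs_def] K_def by simp_all
  have "((\<lambda>t. (l t)\<^sup>2 + 2 * p1 t * l t + 2 * (x2 t * i t)) has_real_derivative
      2 * (- (x1 t / r ^ 3)) * l t + 2 * (p2 t * inverse r + x2 t * K)) (at t)"
    unfolding i(2)[symmetric] by (auto intro!: derivative_eq_intros d l i(1) simp: mult_ac)
  also have "2 * (- (x1 t / r ^ 3)) * l t + 2 * (p2 t * inverse r + x2 t * K)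
      = 2 / r ^ 3 * (p2 t * r\<^sup>2 - x1 t * l t - x2 t * (x1 t * p1 t + x2 t * p2 t))"
    using r(1) by (simp add: K_def field_simps power3_eq_cube power2_eq_square)
  also have "p2 t * r\<^sup>2 - x1 t * l t - x2 t * (x1 t * p1 t + x2 t * p2 t) = 0"
    unfolding r(3) l_def by (simp add: algebra_simps power2_eq_square)
  finally show "((\<lambda>t. D_int (z t)) has_real_derivative 0) (at t)"
    by (simp add: D_int_coords ang_mom_def l_def i_def norm_plane x1_def x2_def p1_def p2_def divide_inverse mult.assoc)
qed

lemma bouncing_trajectoryD:
  assumes "bouncing_trajectory y"
  shows "fst (y t) \<noteq> 0" "snd (fst (y t)) \<ge> 1" "t \<notin> hits y \<Longrightarrow> kepler_solution_at y t"
    "(y \<longlongrightarrow> y t) (at_right t)" "t \<in> hits y \<Longrightarrow> (y \<longlongrightarrow> refl_state (y t)) (at_left t)"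
    "t \<notin> hits y \<Longrightarrow> isCont y t" "finite (hits y \<inter> {a..b})" "isCont (\<lambda>t. fst (y t)) t"
proof -
  show h: "snd (fst (y t)) \<ge> 1" using assms by (auto simp: bouncing_trajectory_def phase_space_def table_def)
  then show "fst (y t) \<noteq> 0" by auto
  show s: "kepler_solution_at y t" if "t \<notin> hits y"
    using assms that by (simp add: bouncing_trajectory_def kepler_solution_at_def)
  show c: "isCont y t" if "t \<notin> hits y"
    using s[OF that] unfolding kepler_solution_at_def by (rule has_vector_derivative_continuous)
  show "finite (hits y \<inter> {a..b})" using assms by (simp add: bouncing_trajectory_def)
  show fc: "isCont (\<lambda>t. fst (y t)) t"
    using assms by (simp add: bouncing_trajectory_def continuous_on_eq_continuous_at)
  have fl: "((\<lambda>t. fst (y t)) \<longlongrightarrow> fst (y t)) (at_left t)" "((\<lambda>t. fst (y t)) \<longlongrightarrow> fst (y t)) (at_right t)"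
    using fc by (simp_all add: isCont_def filterlim_at_split)
  show "(y \<longlongrightarrow> y t) (at_right t)"
  proof (cases "t \<in> hits y")
    case True
    then have "((\<lambda>s. snd (y s)) \<longlongrightarrow> snd (y t)) (at_right t)"
      using assms by (simp add: bouncing_trajectory_def)
    from tendsto_Pair[OF fl(2) this] show ?thesis by simp
  next
    case False
    from c[OF this] show ?thesis by (simp add: isCont_def filterlim_at_split)
  qed
  show "(y \<longlongrightarrow> refl_state (y t)) (at_left t)" if "t \<in> hits y"
  proof -
    have "((\<lambda>s. snd (y s)) \<longlongrightarrow> reflect (snd (y t))) (at_left t)"
      using assms that by (simp add: bouncing_trajectory_def)
    from tendsto_Pair[OF fl(1) this] show ?thesis by (simp add: refl_state_def)
  qed
qed

text \<open>The function is continuous at the hits by its invariance under reflection, and the hits are locally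
  finite.\<close>

lemma bouncing_conserved:
  assumes y: "bouncing_trajectory y"
    and G: "\<And>w. fst w \<noteq> 0 \<Longrightarrow> isCont G w" "\<And>w. snd (fst w) = 1 \<Longrightarrow> G (refl_state w) = G w"
      "\<And>t. kepler_solution_at y t \<Longrightarrow> fst (y t) \<noteq> 0 \<Longrightarrow> ((\<lambda>t. G (y t)) has_real_derivative 0) (at t)"
  shows "G (y t) = (G (y s) :: real)"
proof -
  note Y = bouncing_trajectoryD[OF y]
  define a where "a = min s t"
  define b where "b = max s t"
  have "isCont (\<lambda>t. G (y t)) u" for u
  proof (cases "u \<in> hits y")
    case True
    have "((\<lambda>t. G (y t)) \<longlongrightarrow> G (y u)) (at_right u)"
      by (rule isCont_tendsto_compose[OF G(1) Y(4)]) (rule Y)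
    moreover have "((\<lambda>t. G (y t)) \<longlongrightarrow> G (refl_state (y u))) (at_left u)"
      by (rule isCont_tendsto_compose[OF G(1) Y(5)[OF True]]) (simp add: Y)
    moreover have "G (refl_state (y u)) = G (y u)" using True by (intro G(2)) (simp add: hits_def wall_def)
    ultimately show ?thesis by (simp add: isCont_def filterlim_at_split)
  next
    case False
    then show ?thesis using G(1) Y by (intro isCont_o2[where g = G and f = y]) auto
  qed
  then have cont: "continuous_on {a..b} (\<lambda>t. G (y t))" by (simp add: continuous_at_imp_continuous_on)
  have "((\<lambda>t. G (y t)) has_derivative (\<lambda>h. 0)) (at u within {a..b})" if "u \<in> {a..b} - hits y \<inter> {a..b}" for u
    using G(3)[OF Y(3) Y(1), of u] that
    by (auto simp: has_field_derivative_def lambda_zero intro: has_derivative_at_withinI)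
  then have eq: "G (y u) = G (y a)" if "u \<in> {a..b}" for u
    using has_derivative_zero_unique_strong_convex[of "{a..b}" "hits y \<inter> {a..b}" "\<lambda>t. G (y t)" a "G (y a)" u] cont Y(7) that
    by auto
  show ?thesis using eq[of s] eq[of t] by (auto simp: a_def b_def)
qed

lemma bouncing_energy_D:
  assumes "bouncing_trajectory y"
  shows "energy (y t) = energy (y s)" "D_int (y t) = D_int (y s)"
  using assms integrals_isCont integrals_derivative
  by (auto intro!: bouncing_conserved[OF assms])

text \<open>A reflection changes the angular momentum, so it is constant only up to the next hit. The momentum is
  right-continuous, so the initial hit may be included.\<close>

lemma bouncing_ang_mom_arc:
  assumes y: "bouncing_trajectory y" and ab: "hits y \<inter> {a<..<b} = {}" and t: "t \<in> {a..<b}"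
  shows "ang_mom (y t) = ang_mom (y a)"
proof -
  note Y = bouncing_trajectoryD[OF y]
  have "continuous (at u within {a..<b}) (\<lambda>t. ang_mom (y t))" if u: "u \<in> {a..<b}" for u
  proof (cases "u = a")
    case True
    have "((\<lambda>t. ang_mom (y t)) \<longlongrightarrow> ang_mom (y a)) (at_right a)"
      by (rule isCont_tendsto_compose[OF integrals_isCont(2) Y(4)]) (rule Y)
    moreover have "at a within {a..<b} \<le> at_right a"
      unfolding at_within_def by (intro inf_mono) auto
    ultimately show ?thesis using True by (auto simp: continuous_within intro: tendsto_mono)
  next
    case False
    then have "u \<notin> hits y" using u ab by auto
    then have "isCont (\<lambda>t. ang_mom (y t)) u"
      using integrals_isCont(2) Y by (intro isCont_o2[where g = ang_mom and f = y]) auto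
    then show ?thesis by (rule continuous_at_imp_continuous_within)
  qed
  then have cont: "continuous_on {a..<b} (\<lambda>t. ang_mom (y t))" by (simp add: continuous_on_eq_continuous_within)
  have "((\<lambda>t. ang_mom (y t)) has_derivative (\<lambda>h. 0)) (at u within {a..<b})" if u: "u \<in> {a..<b} - {a}" for u
  proof -
    have "u \<notin> hits y" using u ab by auto
    from integrals_derivative(2)[OF Y(3)[OF this] Y(1)]
    show ?thesis by (auto simp: has_field_derivative_def lambda_zero intro: has_derivative_at_withinI)
  qed
  then show ?thesis
    using has_derivative_zero_unique_strong_convex[of "{a..<b}" "{a}" "\<lambda>t. ang_mom (y t)" a "ang_mom (y a)" t] cont t
    by auto
qed

section \<open>Every trajectory keeps returning to the wall\<close>

lemma level_set_norm_ge: "w \<in> level_set E D \<Longrightarrow> norm (fst w) \<ge> 1"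
  using table_norm_ge_1 by (simp add: level_set_def phase_space_def table_def)

lemma level_set_momentum_le:
  assumes "E < 0" "w \<in> level_set E D"
  shows "snd w \<bullet> snd w \<le> 2"
proof -
  have "norm (fst w) \<ge> 1" by (rule level_set_norm_ge[OF assms(2)])
  then have "1 / norm (fst w) \<le> 1" by (intro divide_le_eq_1[THEN iffD2]) auto
  then show ?thesis using momentum_sq[of w] assms by (simp add: level_set_def)
qed

text \<open>The downward force is at least (- E)^3, while the vertical momentum stays between - 2 and 2.\<close>

lemma hit_within:
  assumes y: "bouncing_trajectory y" and l: "range y \<subseteq> level_set E D" and E: "E < 0"
  shows "\<exists>s \<in> hits y. a \<le> s \<and> s \<le> a + 5 / (- E) ^ 3"
proof (rule ccontr)
  assume n: "\<not> ?thesis"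
  note Y = bouncing_trajectoryD[OF y]
  (* In the time M the force changes the vertical momentum by 5, more than the length of [-2, 2]. *)
  define M where "M = 5 / (- E) ^ 3"
  have M: "M > 0" using E by (simp add: M_def)
  define q where "q t = snd (snd (y t))" for t
  have l': "y t \<in> level_set E D" for t using l by blast
  have q: "\<bar>q t\<bar> \<le> 2" for t
  proof -
    have "(q t)\<^sup>2 \<le> 2"
      using level_set_momentum_le[OF E l'[of t]] zero_le_power2[of "fst (snd (y t))"]
      unfolding inner_prod_def q_def power2_eq_square inner_real_def by linarith
    then have "(q t)\<^sup>2 \<le> 2\<^sup>2" by simp
    then show ?thesis by (metis abs_le_square_iff abs_numeral)
  qed
  have dq: "(q has_real_derivative - snd (fst (y t)) / norm (fst (y t)) ^ 3) (at t)"
    if t: "a \<le> t" "t \<le> a + M" for t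
  proof -
    have "t \<notin> hits y" using n t by (auto simp: M_def)
    from vertical_force[OF Y(3)[OF this]] show ?thesis by (simp add: q_def[abs_def])
  qed
  have "a < a + M" using M by simp
  from MVT2[OF this dq] obtain c where c:
    "q (a + M) - q a = (a + M - a) * (- snd (fst (y c)) / norm (fst (y c)) ^ 3)" by auto
  define r where "r = norm (fst (y c))"
  have r: "r \<ge> 1" "r \<le> 1 / (- E)"
    using level_set_norm_ge[OF l'[of c]] level_set_norm_le[OF E l'[of c]] by (auto simp: r_def)
  have "r ^ 3 \<le> (1 / (- E)) ^ 3" using r by (intro power_mono) auto
  then have "(- E) ^ 3 * r ^ 3 \<le> 1" using E by (simp add: power_divide field_simps)
  then have "(- E) ^ 3 \<le> 1 / r ^ 3" using r by (simp add: field_simps)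
  also have "\<dots> \<le> snd (fst (y c)) / r ^ 3" using Y(2)[of c] r by (intro divide_right_mono) auto
  finally have "M * (- E) ^ 3 \<le> M * (snd (fst (y c)) / r ^ 3)" using M by (intro mult_left_mono) auto
  moreover have "M * (- E) ^ 3 = 5" using E by (simp add: M_def)
  ultimately have "q a - q (a + M) \<ge> 5" using c by (simp add: r_def)
  then show False using q[of a] q[of "a + M"] by linarith
qed

lemma between_hits:
  assumes y: "bouncing_trajectory y" and l: "range y \<subseteq> level_set E D" and E: "E < 0"
  shows "\<exists>a b. a \<in> hits y \<and> b \<in> hits y \<and> a \<le> t \<and> t < b \<and> hits y \<inter> {a<..<b} = {}"
proof -
  define M where "M = 5 / (- E) ^ 3"
  define S where "S = hits y \<inter> {t - M..t}"
  define S' where "S' = hits y \<inter> {t<..t + 1 + M}"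
  have S: "finite S" "finite S'"
    using bouncing_trajectoryD(7)[OF y] by (auto simp: S_def S'_def intro: finite_subset[of _ "hits y \<inter> {t..t + 1 + M}"])
  have ne: "S \<noteq> {}" "S' \<noteq> {}"
    using hit_within[OF assms, of "t - M"] hit_within[OF assms, of "t + 1"] by (force simp: S_def S'_def M_def)+
  have a: "Max S \<in> S" "\<And>s. s \<in> S \<Longrightarrow> s \<le> Max S" using S ne by auto
  have b: "Min S' \<in> S'" "\<And>s. s \<in> S' \<Longrightarrow> Min S' \<le> s" using S ne by auto
  have "s \<notin> hits y" if s: "Max S < s" "s < Min S'" for s
  proof
    assume h: "s \<in> hits y"
    show False
    proof (cases "s \<le> t")
      case True
      then have "s \<in> S" using h s a(1) by (auto simp: S_def)
      then show False using a(2) s by force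
    next
      case False
      then have "s \<in> S'" using h s b(1) by (auto simp: S'_def)
      then show False using b(2) s by force
    qed
  qed
  then show ?thesis
    using a(1) b(1) by (intro exI[of _ "Max S"] exI[of _ "Min S'"]) (auto simp: S_def S'_def)
qed

section \<open>Ellipses contain no three collinear points\<close>

text \<open>Equality in the triangle inequality for both foci makes x, y and the foci collinear, with the foci so
  far apart that the ellipse degenerates. In particular a segment is not contained in an ellipse.\<close>

lemma ellipse_midpoint:
  assumes C: "is_ellipse C" and xy: "x \<in> C" "y \<in> C" "(1/2) *\<^sub>R (x + y) \<in> C"
  shows "x = y"
proof (rule ccontr)
  assume ne: "x \<noteq> y"
  obtain f1 f2 s where C': "dist f1 f2 < s" "C = ellipse f1 f2 s" using C by (auto simp: is_ellipse_def)
  define \<alpha> where "\<alpha> = norm (x - f1)"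
  define \<beta> where "\<beta> = norm (y - f1)"
  define \<gamma> where "\<gamma> = norm (x - f2)"
  define \<delta> where "\<delta> = norm (y - f2)"
  have s: "\<alpha> + \<gamma> = s" "\<beta> + \<delta> = s"
    using xy C' by (simp_all add: ellipse_def dist_norm \<alpha>_def \<beta>_def \<gamma>_def \<delta>_def)
  have mid: "norm ((1/2) *\<^sub>R (x + y) - f) = norm ((x - f) + (y - f)) / 2" for f
  proof -
    have "(1/2) *\<^sub>R (x + y) - f = (1/2) *\<^sub>R ((x - f) + (y - f))"
      by (simp add: algebra_simps) (metis scaleR_half_double scaleR_add_right)
    then show ?thesis by simp
  qed
  have "norm ((x - f1) + (y - f1)) / 2 + norm ((x - f2) + (y - f2)) / 2 = s"
    using xy(3) C' by (simp add: ellipse_def dist_norm mid)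
  moreover have "norm ((x - f1) + (y - f1)) \<le> \<alpha> + \<beta>" "norm ((x - f2) + (y - f2)) \<le> \<gamma> + \<delta>"
    unfolding \<alpha>_def \<beta>_def \<gamma>_def \<delta>_def by (rule norm_triangle_ineq)+
  ultimately have "norm ((x - f1) + (y - f1)) = \<alpha> + \<beta>" "norm ((x - f2) + (y - f2)) = \<gamma> + \<delta>"
    using s by linarith+
  then have "\<alpha> *\<^sub>R (y - f1) = \<beta> *\<^sub>R (x - f1)" "\<gamma> *\<^sub>R (y - f2) = \<delta> *\<^sub>R (x - f2)"
    unfolding \<alpha>_def \<beta>_def \<gamma>_def \<delta>_def norm_triangle_eq by auto
  then have "\<alpha> *\<^sub>R (y - f1) + \<gamma> *\<^sub>R (y - f2) = \<beta> *\<^sub>R (x - f1) + \<delta> *\<^sub>R (x - f2)" by simp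
  then have "(\<alpha> + \<gamma>) *\<^sub>R y - (\<beta> + \<delta>) *\<^sub>R x = (\<alpha> - \<beta>) *\<^sub>R f1 + (\<gamma> - \<delta>) *\<^sub>R f2"
    by (simp add: algebra_simps)
  also have "\<gamma> - \<delta> = - (\<alpha> - \<beta>)" using s by simp
  finally have "s *\<^sub>R (y - x) = (\<alpha> - \<beta>) *\<^sub>R (f1 - f2)"
    unfolding s by (simp add: algebra_simps)
  then have "\<bar>s\<bar> * norm (y - x) = \<bar>\<alpha> - \<beta>\<bar> * dist f1 f2" by (metis norm_scaleR dist_norm)
  also have "\<dots> \<le> norm (y - x) * dist f1 f2"
  proof (rule mult_right_mono)
    show "\<bar>\<alpha> - \<beta>\<bar> \<le> norm (y - x)"
      unfolding \<alpha>_def \<beta>_def using norm_triangle_ineq3[of "x - f1" "y - f1"] by (simp add: norm_minus_commute)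
  qed simp
  finally have "\<bar>s\<bar> * norm (y - x) \<le> dist f1 f2 * norm (y - x)" by (simp add: mult.commute)
  then have "\<bar>s\<bar> \<le> dist f1 f2" using ne by simp
  then show False using C'(1) by linarith
qed

section \<open>Asymptotic trajectories and conserved quantities\<close>

text \<open>A sequence of points of the trajectory converges to a point of the compact set, where G is
  continuous.\<close>

lemma asymptotic_conserved:
  fixes z :: "real \<Rightarrow> 'a::euclidean_space" and G :: "'a \<Rightarrow> real"
  assumes \<gamma>: "compact \<gamma>" "\<gamma> \<noteq> {}" and lim: "((\<lambda>t. infdist (z t) \<gamma>) \<longlongrightarrow> 0) at_top"
    and G: "\<And>w. w \<in> \<gamma> \<Longrightarrow> isCont G w" "\<And>w. w \<in> \<gamma> \<Longrightarrow> G w = g" "\<And>t. G (z t) = c"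
  shows "c = g"
proof -
  have "\<forall>n. \<exists>a. a \<in> \<gamma> \<and> infdist (z (real n)) \<gamma> = dist (z (real n)) a"
    using infdist_attains_inf[OF compact_imp_closed[OF \<gamma>(1)] \<gamma>(2)] by metis
  then obtain a where a: "\<And>n. a n \<in> \<gamma>" "\<And>n. infdist (z (real n)) \<gamma> = dist (z (real n)) (a n)" by metis
  obtain l \<rho> where l: "l \<in> \<gamma>" "strict_mono \<rho>" "(a \<circ> \<rho>) \<longlonglongrightarrow> l"
    using \<gamma>(1)[unfolded compact_def] a(1) by blast
  have "(\<lambda>n. dist (z (real n)) (a n)) \<longlonglongrightarrow> 0"
    using filterlim_compose[OF lim filterlim_real_sequentially] a(2) by (simp add: o_def)
  then have "(\<lambda>n. dist (z (real (\<rho> n))) (a (\<rho> n))) \<longlonglongrightarrow> 0"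
    using LIMSEQ_subseq_LIMSEQ[OF _ l(2)] by (fastforce simp: o_def)
  then have "(\<lambda>n. z (real (\<rho> n)) - (a \<circ> \<rho>) n) \<longlonglongrightarrow> 0"
    unfolding dist_norm o_def by (rule tendsto_norm_zero_cancel)
  then have "(\<lambda>n. z (real (\<rho> n))) \<longlonglongrightarrow> l"
    by (rule Lim_transform[OF l(3)])
  then have "(\<lambda>n. G (z (real (\<rho> n)))) \<longlonglongrightarrow> G l"
    by (rule isCont_tendsto_compose[OF G(1)[OF l(1)]])
  then show ?thesis using G(2)[OF l(1)] by (simp add: G(3) LIMSEQ_const_iff)
qed

section \<open>The level sets are compact\<close>

lemma compact_level_set:
  assumes "E < 0"
  shows "compact (level_set E D)"
proof -
  define S where "S = {w :: phase. snd (fst w) \<ge> 1}"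
  have S: "closed S" unfolding S_def by (intro closed_Collect_le continuous_intros)
  have S0: "fst w \<noteq> 0" if "w \<in> S" for w using that by (auto simp: S_def)
  have "continuous_on S energy" "continuous_on S D_int"
    using integrals_isCont S0 by (auto intro!: continuous_at_imp_continuous_on)
  then have "closed {w \<in> S. energy w = E}" "closed {w \<in> S. D_int w = D}"
    using continuous_closed_preimage_constant S by blast+
  then have "closed ({w \<in> S. energy w = E} \<inter> {w \<in> S. D_int w = D})" by (rule closed_Int)
  also have "{w \<in> S. energy w = E} \<inter> {w \<in> S. D_int w = D} = level_set E D"
    by (auto simp: level_set_def phase_space_def table_def S_def)
  finally have "closed (level_set E D)" .
  moreover have "bounded (level_set E D)"
  proof (rule boundedI)
    fix w assume w: "w \<in> level_set E D"
    have "(norm (snd w))\<^sup>2 \<le> 2\<^sup>2" using level_set_momentum_le[OF assms w] by (simp add: power2_norm_eq_inner)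
    then have "norm (snd w) \<le> 2" by (rule power2_le_imp_le) simp
    then show "norm w \<le> - 1 / E + 2"
      using norm_Pair_le[of "fst w" "snd w"] level_set_norm_le[OF assms w] by simp
  qed
  ultimately show ?thesis using compact_eq_bounded_closed by blast
qed

section \<open>Arcs through the mirror point of the centre\<close>

text \<open>The defining property of the ellipse with foci 0 and A / E and major axis - 1 / E.\<close>

lemma second_focus:
  assumes E: "E < 0" and w: "fst w \<noteq> 0" "energy w = E" "norm (fst w) \<le> - 1 / E"
  shows "dist (fst w) 0 + dist (fst w) ((1 / E) *\<^sub>R lrl w) = - 1 / E"
proof -
  define r where "r = norm (fst w)"
  define x where "x = fst w"
  define A where "A = lrl w"
  have xx: "x \<bullet> x = r\<^sup>2" by (simp add: x_def r_def dot_square_norm)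
  have xA: "x \<bullet> A = (ang_mom w)\<^sup>2 - r"
    using lrl_products(1)[OF w(1)] by (simp add: x_def A_def r_def inner_commute)
  have AA: "A \<bullet> A = 1 + 2 * E * (ang_mom w)\<^sup>2"
    using lrl_products(3)[OF w(1)] by (simp add: A_def w)
  have "(x - (1 / E) *\<^sub>R A) \<bullet> (x - (1 / E) *\<^sub>R A) = (- 1 / E - r)\<^sup>2"
    using E by (simp add: inner_diff_left inner_diff_right inner_commute[of A x] xx xA AA)
      (simp add: field_simps power2_eq_square)
  then have "norm (x - (1 / E) *\<^sub>R A) = - 1 / E - r"
    using w(3) by (simp add: norm_eq_sqrt_inner r_def)
  then show ?thesis by (simp add: dist_norm x_def A_def r_def)
qed

text \<open>The eccentricity is less than 1 if the angular momentum does not vanish.\<close>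

lemma orbit_ellipse:
  assumes E: "E < 0" and w: "fst w \<noteq> 0" "energy w = E" and L: "ang_mom w \<noteq> 0"
  shows "is_ellipse (ellipse 0 ((1 / E) *\<^sub>R lrl w) (- 1 / E))"
proof -
  have "(norm (lrl w))\<^sup>2 = 1 + 2 * E * (ang_mom w)\<^sup>2"
    using lrl_products(3)[OF w(1)] w(2) by (simp add: power2_norm_eq_inner)
  also have "\<dots> < 1\<^sup>2" using E L by (simp add: mult_neg_pos)
  finally have "norm (lrl w) < 1" by (rule power2_less_imp_less) simp
  then have "norm ((1 / E) *\<^sub>R lrl w) < - 1 / E"
    using E by (simp add: divide_simps)
  then show ?thesis
    unfolding is_ellipse_def
    by (intro exI[of _ 0] exI[of _ "(1 / E) *\<^sub>R lrl w"] exI[of _ "- 1 / E"]) simp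
qed

context
  fixes E :: real
  assumes E: "- 1 < E" "E < 0"
begin

text \<open>On the positive x2-axis the conic equation reads x2 (1 + A2) = L^2, and D = 2 means
  2 (1 + A2) = L^2.\<close>

lemma axis_crossing:
  assumes w: "w \<in> level_set E 2" and L: "ang_mom w \<noteq> 0" and x: "fst (fst w) = 0"
  shows "fst w = F_pt"
proof -
  have y: "snd (fst w) \<ge> 1" using w by (simp add: level_set_def phase_space_def table_def)
  have "norm (fst w) = snd (fst w)" using x y by (simp add: norm_plane)
  then have "snd (fst w) = (ang_mom w)\<^sup>2 - snd (lrl w) * snd (fst w)"
    using lrl_products(1)[OF fst_level_set_nonzero[OF w]] x by (simp add: inner_prod_def)
  moreover have "(ang_mom w)\<^sup>2 = 2 + 2 * snd (lrl w)" using w by (simp add: level_set_def D_int_def)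
  ultimately have "(ang_mom w)\<^sup>2 * (snd (fst w) - 2) = 0" by (simp add: algebra_simps)
  then have "snd (fst w) = 2" using L by simp
  then show ?thesis using x by (simp add: F_pt_def prod_eq_iff)
qed

text \<open>On which side of the axis the particle is on the wall is determined by the sense of rotation and by
  whether it comes or goes. The reason is that D = 2 makes x1 p2 dominate p1 in
  L = x1 p2 - p1.\<close>

lemma wall_side:
  assumes w: "w \<in> level_set E 2" "snd (fst w) = 1" and L: "ang_mom w \<noteq> 0"
  shows "ang_mom w * fst (fst w) * snd (snd w) > 0"
proof -
  define x where "x = fst (fst w)"
  define p where "p = fst (snd w)"
  define q where "q = snd (snd w)"
  define r where "r = norm (fst w)"
  have r: "r\<^sup>2 = x\<^sup>2 + 1" "r \<ge> 1"
    using norm_plane_sq[of "fst w"] level_set_norm_ge[OF w(1)] w(2) by (simp_all add: r_def x_def)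
  have Lw: "ang_mom w = x * q - p" using w(2) by (simp add: ang_mom_def x_def p_def q_def)
  have "2 = (x * q - p)\<^sup>2 + 2 * p * (x * q - p) + 2 / r"
    using D_int_coords[of w] w by (simp add: level_set_def Lw r_def p_def)
  then have eq: "(x * q)\<^sup>2 - p\<^sup>2 = 2 - 2 / r" by (simp add: power2_eq_square algebra_simps)
  have "r \<noteq> 1"
  proof
    assume r1: "r = 1"
    then have "x = 0" using r by simp
    moreover from this have "p = 0" using eq r1 by simp
    ultimately show False using L Lw by simp
  qed
  then have "2 / r < 2" using r(2) by (simp add: divide_less_eq)
  then have "p\<^sup>2 < (x * q)\<^sup>2" using eq by linarith
  then have "\<bar>p\<bar> < \<bar>x * q\<bar>" by (metis abs_le_square_iff not_le)
  then have "\<bar>p * (x * q)\<bar> < (x * q) * (x * q)"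
    by (metis abs_ge_zero abs_mult abs_mult_self_eq mult_strict_right_mono order_le_less_trans)
  then have "(x * q - p) * (x * q) > 0" by (simp add: left_diff_distrib)
  then show ?thesis by (simp add: Lw x_def q_def mult.assoc)
qed

text \<open>A flight starts and ends on different sides of the axis, so it crosses the axis, and it can do so
  only at F.\<close>

lemma flight_passes_F:
  assumes w: "w \<in> outgoing E 2" and L: "ang_mom w \<noteq> 0"
  shows "\<exists>t. 0 \<le> t \<and> t \<le> flight_time w \<and> fst (flight w t) = F_pt"
proof -
  note two_plus_2E_pos = two_plus_2E_pos[OF E]
  define T where "T = flight_time w"
  define x where "x t = fst (fst (flight w t))" for t
  have T: "T > 0" using flight_time_pos[OF E(2) two_plus_2E_pos w] by (simp add: T_def)
  have cont: "isCont x t" if "0 \<le> t" "t \<le> T" for t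
    using has_vector_derivative_continuous[OF flight_solves[OF E(2) two_plus_2E_pos w, of t, unfolded kepler_solution_at_def]] that
    unfolding x_def[abs_def] by (intro continuous_fst) (simp add: T_def)
  have e: "flight w T \<in> level_set E 2" using flight_level_set[OF E(2) two_plus_2E_pos w] T by (simp add: T_def)
  have Le: "ang_mom (flight w T) = ang_mom w" using flight_invariants(1)[OF E(2) two_plus_2E_pos w] T by (simp add: T_def)
  have q: "snd (snd (flight w T)) < 0"
    using next_out_outgoing[OF E(2) two_plus_2E_pos w] unfolding flight_end_next[OF E(2) two_plus_2E_pos w, symmetric]
    by (simp add: outgoing_def T_def)
  have "ang_mom w * x 0 * snd (snd w) > 0"
    using wall_side[of w] outgoingD[OF E(2) two_plus_2E_pos w] L by (simp add: x_def flight_start[OF E(2) two_plus_2E_pos w])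
  then have s0: "ang_mom w * x 0 > 0" using outgoingD(8)[OF E(2) two_plus_2E_pos w] by (simp add: zero_less_mult_iff)
  have "ang_mom w * x T * snd (snd (flight w T)) > 0"
    using wall_side[OF e] flight_wall(2)[OF E(2) two_plus_2E_pos w] L Le by (simp add: x_def T_def)
  then have sT: "ang_mom w * x T < 0" using q by (simp add: zero_less_mult_iff)
  have "\<exists>t\<ge>0. t \<le> T \<and> ang_mom w * x t = 0"
    using s0 sT T cont by (intro IVT2) (auto intro!: continuous_intros)
  then obtain t where t: "0 \<le> t" "t \<le> T" "x t = 0" using L by auto
  have "flight w t \<in> level_set E 2" "ang_mom (flight w t) = ang_mom w"
    using flight_level_set[OF E(2) two_plus_2E_pos w] flight_invariants(1)[OF E(2) two_plus_2E_pos w] t by (simp_all add: T_def)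
  then have "fst (flight w t) = F_pt" using axis_crossing t(3) L by (simp add: x_def)
  then show ?thesis using t by (auto simp: T_def)
qed

lemma flight_elliptic:
  assumes w: "w \<in> outgoing E 2" and L: "ang_mom w \<noteq> 0"
  shows "elliptic_arc ((\<lambda>t. fst (flight w t)) ` {0..flight_time w})"
proof -
  note two_plus_2E_pos = two_plus_2E_pos[OF E]
  have "(\<lambda>t. fst (flight w t)) ` {0..flight_time w} \<subseteq> ellipse 0 ((1 / E) *\<^sub>R lrl w) (- 1 / E)"
  proof (rule image_subsetI)
    fix t assume "t \<in> {0..flight_time w}"
    then have t: "0 \<le> t" "t \<le> flight_time w" by auto
    have v: "flight w t \<in> level_set E 2" by (rule flight_level_set[OF E(2) two_plus_2E_pos w t])
    have "dist (fst (flight w t)) 0 + dist (fst (flight w t)) ((1 / E) *\<^sub>R lrl (flight w t)) = - 1 / E"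
      using fst_level_set_nonzero[OF v] level_set_norm_le[OF E(2) v] v
      by (intro second_focus E) (auto simp: level_set_def)
    then show "fst (flight w t) \<in> ellipse 0 ((1 / E) *\<^sub>R lrl w) (- 1 / E)"
      using flight_invariants(2)[OF E(2) two_plus_2E_pos w t] by (simp add: ellipse_def)
  qed
  moreover have "is_ellipse (ellipse 0 ((1 / E) *\<^sub>R lrl w) (- 1 / E))"
    using outgoingD[OF E(2) two_plus_2E_pos w] L by (intro orbit_ellipse E) auto
  ultimately show ?thesis unfolding elliptic_arc_def by blast
qed

text \<open>The arc containing a vertical state would be a segment from the wall to F at least.\<close>

lemma elliptic_not_vertical:
  assumes y: "bouncing_trajectory y" and l: "range y \<subseteq> level_set E 2"
    and arcs: "\<And>A. A \<in> arcs y \<Longrightarrow> elliptic_arc A \<and> F_pt \<in> A"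
  shows "\<not> vertical (y t)"
proof
  assume v: "vertical (y t)"
  obtain a b where ab: "a \<in> hits y" "b \<in> hits y" "a \<le> t" "t < b" "hits y \<inter> {a<..<b} = {}"
    using between_hits[OF y l E(2)] by blast
  define A where "A = (\<lambda>t. fst (y t)) ` {a..b}"
  have "A \<in> arcs y" unfolding arcs_def A_def using ab by force
  then have A: "elliptic_arc A" "F_pt \<in> A" using arcs by blast+
  obtain C where C: "is_ellipse C" "A \<subseteq> C" using A(1) by (auto simp: elliptic_arc_def)
  have L0: "ang_mom (y t) = 0" using v by (simp add: vertical_def ang_mom_def)
  have xs: "fst (fst (y s)) = 0" if s: "s \<in> {a..<b}" for s
  proof -
    have "ang_mom (y s) = 0"
      using bouncing_ang_mom_arc[OF y ab(5) s] bouncing_ang_mom_arc[OF y ab(5), of t] ab L0 by simp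
    then show ?thesis using ang_mom_zero_iff_vertical[of "y s" E] l by (auto simp: vertical_def)
  qed
  obtain c where c: "a \<le> c" "c \<le> b" "fst (y c) = F_pt" using A(2) by (auto simp: A_def)
  have wall: "snd (fst (y a)) = 1" "snd (fst (y b)) = 1" using ab by (auto simp: hits_def wall_def)
  have c': "a < c" "c < b" using c wall by (auto simp: F_pt_def order.order_iff_strict)
  have cont: "isCont (\<lambda>s. snd (fst (y s))) s" for s
    by (intro continuous_snd bouncing_trajectoryD(8)[OF y])
  obtain d where d: "a \<le> d" "d \<le> c" "snd (fst (y d)) = 3/2"
    using IVT[of "\<lambda>s. snd (fst (y s))" a "3/2" c] wall c c' cont by (auto simp: F_pt_def)
  have "fst (y a) = (0, 1)" "fst (y d) = (0, 3/2)"
    using xs[of a] xs[of d] d wall c' by (auto simp: prod_eq_iff)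
  moreover have "fst (y a) \<in> C" "fst (y d) \<in> C" "F_pt \<in> C"
    using C(2) A(2) d c' by (auto simp: A_def)
  moreover have "(1/2) *\<^sub>R ((0, 1) + F_pt) = (0 :: real, 3/2 :: real)" by (simp add: F_pt_def)
  ultimately have "(0, 1) = F_pt" using ellipse_midpoint[OF C(1), of "(0, 1)" F_pt] by simp
  then show False by (simp add: F_pt_def)
qed

end

section \<open>The reflection law on the singular level set\<close>

context
  fixes E :: real
  assumes E: "- (1/2) < E" "E < 0"
begin

lemma minus_one_less_E: "- 1 < E" using E by simp

text \<open>The speed at the point F.\<close>

definition speed_F :: real where "speed_F = sqrt (2 * E + 1)"
text \<open>The value of r times the absolute vertical momentum, which is the same at all points of the wall.\<close>

definition wall_root :: real where "wall_root = sqrt (2 + 2 * E)"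

lemma speeds: "speed_F > 0" "speed_F\<^sup>2 = 2 * E + 1" "wall_root > 0" "wall_root\<^sup>2 = 1 + speed_F\<^sup>2" "wall_root > speed_F"
  using E by (simp_all add: speed_F_def wall_root_def)

text \<open>The velocity at F is (- L / 2, A1 / L). If it makes the angle \<phi> with the upward vertical, then
  tau = tan (\<phi> / 2), so tau or its inverse tends to 0 when the arcs approach the axis.\<close>

definition tau :: "phase \<Rightarrow> real" where
  "tau w = 2 * (fst (lrl w) - speed_F * ang_mom w) / (ang_mom w)\<^sup>2"

text \<open>This is sin \<phi> = 2 tan (\<phi> / 2) / (1 + tan (\<phi> / 2)^2), since L = - 2 v sin \<phi> with the speed v at F.\<close>

lemma ang_mom_tau:
  assumes w: "w \<in> level_set E 2" and L: "ang_mom w \<noteq> 0"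
  shows "ang_mom w * (1 + (tau w)\<^sup>2) = - 4 * speed_F * tau w"
proof -
  define L where "L = ang_mom w"
  define A1 where "A1 = fst (lrl w)"
  have "4 * A1\<^sup>2 + L ^ 4 = 4 * ((2 * E + 1) * L\<^sup>2)"
    unfolding A1_def L_def by (rule lrl_ang_mom_quartic[OF w])
  then have A: "L ^ 4 = 4 * (speed_F\<^sup>2 * L\<^sup>2) - 4 * A1\<^sup>2" unfolding speeds by linarith
  have t: "tau w * L\<^sup>2 = 2 * (A1 - speed_F * L)"
    using L by (simp add: tau_def L_def A1_def)
  have "L * (1 + (tau w)\<^sup>2) * L ^ 3 = L ^ 4 + (tau w * L\<^sup>2)\<^sup>2"
    by (simp add: power2_eq_square power3_eq_cube power4_eq_xxxx algebra_simps)
  also have "\<dots> = L ^ 4 + 4 * (A1 - speed_F * L)\<^sup>2"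
    unfolding t power_mult_distrib by simp
  also have "\<dots> = - 8 * speed_F * L * (A1 - speed_F * L)"
    unfolding A by (simp add: power2_eq_square algebra_simps)
  also have "\<dots> = - 4 * speed_F * L * (tau w * L\<^sup>2)"
    unfolding t by simp
  also have "\<dots> = - 4 * speed_F * tau w * L ^ 3"
    by (simp add: power2_eq_square power3_eq_cube)
  finally have "L ^ 3 * (L * (1 + (tau w)\<^sup>2)) = L ^ 3 * (- 4 * speed_F * tau w)" by (simp add: mult_ac)
  moreover have "L ^ 3 \<noteq> 0" using L by (simp add: L_def)
  ultimately have "L * (1 + (tau w)\<^sup>2) = - 4 * speed_F * tau w"
    using mult_left_cancel[of "L ^ 3"] by blast
  then show ?thesis unfolding L_def .
qed

lemma ang_mom_le_tau:
  assumes w: "w \<in> level_set E 2" and L: "ang_mom w \<noteq> 0"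
  shows "tau w \<noteq> 0" "\<bar>ang_mom w\<bar> \<le> 4 * speed_F * \<bar>tau w\<bar>" "\<bar>ang_mom w\<bar> \<le> 4 * speed_F / \<bar>tau w\<bar>"
proof -
  have eq: "\<bar>ang_mom w\<bar> * (1 + (tau w)\<^sup>2) = 4 * speed_F * \<bar>tau w\<bar>"
  proof -
    have "\<bar>ang_mom w * (1 + (tau w)\<^sup>2)\<bar> = \<bar>- 4 * speed_F * tau w\<bar>"
      by (simp only: ang_mom_tau[OF assms])
    moreover have "\<bar>1 + (tau w)\<^sup>2\<bar> = 1 + (tau w)\<^sup>2" by simp
    ultimately show ?thesis using speeds(1) by (simp add: abs_mult)
  qed
  then show t0: "tau w \<noteq> 0" using L by auto
  show "\<bar>ang_mom w\<bar> \<le> 4 * speed_F * \<bar>tau w\<bar>"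
    unfolding eq[symmetric] by (simp add: distrib_left)
  have "\<bar>ang_mom w\<bar> * \<bar>tau w\<bar> * \<bar>tau w\<bar> = \<bar>ang_mom w\<bar> * (tau w)\<^sup>2"
    by (simp add: power2_eq_square mult.assoc)
  also have "\<dots> \<le> 4 * speed_F * \<bar>tau w\<bar>"
    unfolding eq[symmetric] by (simp add: distrib_left)
  finally have "\<bar>ang_mom w\<bar> * \<bar>tau w\<bar> * \<bar>tau w\<bar> \<le> 4 * speed_F * \<bar>tau w\<bar>" .
  then have "\<bar>ang_mom w\<bar> * \<bar>tau w\<bar> \<le> 4 * speed_F" using t0 by (simp add: mult_le_cancel_right)
  then show "\<bar>ang_mom w\<bar> \<le> 4 * speed_F / \<bar>tau w\<bar>" using t0 by (simp add: pos_le_divide_eq)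
qed

text \<open>In the coordinates C = (r + 1) / x1 and Y = p1 r / (r - 1) the wall states form the hyperbola
  v^2 C^2 - Y^2 = 1. Its parameter v C + Y is tau up to a factor that depends only on whether the
  particle comes or goes.\<close>

lemma tau_wall:
  assumes w: "w \<in> level_set E 2" "snd (fst w) = 1" "\<not> vertical w"
  shows "tau w = - (snd (snd w) * norm (fst w) + speed_F) *
    (speed_F * ((norm (fst w) + 1) / fst (fst w)) + fst (snd w) * norm (fst w) / (norm (fst w) - 1))"
proof -
  define x where "x = fst (fst w)"
  define p where "p = fst (snd w)"
  define q where "q = snd (snd w)"
  define r where "r = norm (fst w)"
  define v where "v = speed_F"
  define \<omega> where "\<omega> = q * r"
  define C where "C = (r + 1) / x"
  define Y where "Y = p * r / (r - 1)"
  have L0: "ang_mom w \<noteq> 0" using ang_mom_zero_iff_vertical[OF w(1)] w(3) by simp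
  have Lw: "ang_mom w = x * q - p" using w(2) by (simp add: ang_mom_def x_def p_def q_def)
  have "r \<ge> 1" using level_set_norm_ge[OF w(1)] by (simp add: r_def)
  moreover have xr: "x\<^sup>2 = (r - 1) * (r + 1)"
    using norm_plane_sq[of "fst w"] w(2) by (simp add: r_def x_def power2_eq_square algebra_simps)
  moreover have x0: "x \<noteq> 0" using wall_side[OF minus_one_less_E E(2) w(1,2) L0] by (auto simp: x_def)
  ultimately have r: "r > 1" by (cases "r = 1") auto
  have \<omega>: "\<omega>\<^sup>2 = 1 + v\<^sup>2"
    using wall_D_plus_2E[OF w(2)] w(1) speeds(2) by (simp add: level_set_def \<omega>_def q_def r_def v_def)
  have "p\<^sup>2 + q\<^sup>2 = 2 * E + 2 / r"
    using momentum_sq[of w] w(1) by (simp add: level_set_def inner_prod_def p_def q_def r_def power2_eq_square)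
  then have "(p\<^sup>2 + q\<^sup>2) * r\<^sup>2 = 2 * E * r\<^sup>2 + 2 * r" using r by (simp add: power2_eq_square field_simps)
  then have pr: "(p * r)\<^sup>2 = (v\<^sup>2 - 1) * r\<^sup>2 + 2 * r - (1 + v\<^sup>2)"
    using \<omega> speeds(2) by (simp add: \<omega>_def power_mult_distrib algebra_simps v_def)
  have Csq: "C\<^sup>2 = (r + 1) / (r - 1)"
    unfolding C_def power_divide xr using r by (simp add: power2_eq_square)
  have CY: "v\<^sup>2 * C\<^sup>2 - Y\<^sup>2 = 1"
  proof -
    have C2: "C\<^sup>2 * (r - 1)\<^sup>2 = (r + 1) * (r - 1)"
      unfolding C_def power_divide xr using r by (simp add: power2_eq_square)
    have Y2: "Y\<^sup>2 * (r - 1)\<^sup>2 = (p * r)\<^sup>2"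
      unfolding Y_def power_divide using r by simp
    have "(v\<^sup>2 * C\<^sup>2 - Y\<^sup>2) * (r - 1)\<^sup>2 = v\<^sup>2 * (C\<^sup>2 * (r - 1)\<^sup>2) - Y\<^sup>2 * (r - 1)\<^sup>2"
      by (simp add: algebra_simps)
    also have "\<dots> = v\<^sup>2 * ((r + 1) * (r - 1)) - ((v\<^sup>2 - 1) * r\<^sup>2 + 2 * r - (1 + v\<^sup>2))"
      unfolding C2 Y2 pr ..
    also have "\<dots> = (r - 1)\<^sup>2" by (simp add: power2_eq_square algebra_simps)
    finally show ?thesis using r by simp
  qed
  define N where "N = C\<^sup>2 + 1"
  define M where "M = \<omega> * C - Y"
  have Nr: "N = 2 * r / (r - 1)"
    unfolding N_def Csq using r by (simp add: field_simps)
  have N0: "N \<noteq> 0" using r by (simp add: Nr)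
  have Cx: "C = x / (r - 1)"
    unfolding C_def using x0 r xr by (simp add: frac_eq_eq power2_eq_square mult.commute)
  have L: "ang_mom w * N = 2 * M"
  proof -
    have "M = (q * x - p) * r / (r - 1)"
      unfolding M_def Cx \<omega>_def Y_def times_divide_eq_right diff_divide_distrib[symmetric]
      by (simp add: algebra_simps)
    then show ?thesis by (simp add: Lw Nr mult.commute)
  qed
  have A: "fst (lrl w) * N = (C\<^sup>2 - 1) * \<omega> * ang_mom w - 2 * C"
  proof -
    have A1: "fst (lrl w) = (\<omega> * ang_mom w - x) / r"
      using r by (simp add: lrl_coords \<omega>_def q_def x_def r_def[symmetric] field_simps)
    have Nr': "N / r = C\<^sup>2 - 1"
      unfolding Nr Csq using r by (simp add: field_simps)
    have xN: "x * (N / r) = 2 * C"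
      using r by (simp add: Nr Cx)
    have "fst (lrl w) * N = \<omega> * ang_mom w * (N / r) - x * (N / r)"
      by (simp add: A1 diff_divide_distrib left_diff_distrib)
    also have "\<dots> = (C\<^sup>2 - 1) * \<omega> * ang_mom w - 2 * C"
      unfolding xN by (simp add: Nr' mult_ac)
    finally show ?thesis .
  qed
  have M0: "M \<noteq> 0" using L L0 N0 by auto
  (* With r eliminated, the claim is this identity modulo the hyperbola and \<omega>^2 = 1 + v^2. *)
  have key: "(C\<^sup>2 - 1) * \<omega> * M - N * (C + v * M) = - (\<omega> + v) * (v * C + Y) * M\<^sup>2"
    unfolding M_def N_def using CY \<omega> by algebra
  have "tau w * (2 * M\<^sup>2) = N\<^sup>2 * (fst (lrl w) - v * ang_mom w)"
  proof -
    have "(ang_mom w)\<^sup>2 * N\<^sup>2 = 4 * M\<^sup>2" using L by (metis four_x_squared power_mult_distrib)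
    then have "tau w * (4 * M\<^sup>2) = tau w * (ang_mom w)\<^sup>2 * N\<^sup>2" by simp
    also have "tau w * (ang_mom w)\<^sup>2 = 2 * (fst (lrl w) - v * ang_mom w)" using L0 by (simp add: tau_def v_def)
    finally have "2 * (tau w * (2 * M\<^sup>2)) = 2 * (N\<^sup>2 * (fst (lrl w) - v * ang_mom w))" by (simp add: algebra_simps)
    then show ?thesis by simp
  qed
  also have "\<dots> = N * (fst (lrl w) * N) - v * N * (ang_mom w * N)"
    by (simp add: power2_eq_square algebra_simps)
  also have "\<dots> = (C\<^sup>2 - 1) * \<omega> * (ang_mom w * N) - 2 * C * N - v * N * (ang_mom w * N)"
    unfolding A by (simp add: algebra_simps)
  also have "\<dots> = 2 * ((C\<^sup>2 - 1) * \<omega> * M - N * (C + v * M))"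
    unfolding L by (simp add: algebra_simps)
  finally have "tau w * (2 * M\<^sup>2) = - (\<omega> + v) * (v * C + Y) * (2 * M\<^sup>2)"
    unfolding key by simp
  then have "tau w = - (\<omega> + v) * (v * C + Y)" using M0 by simp
  then show ?thesis by (simp add: \<omega>_def v_def C_def Y_def q_def r_def x_def p_def)
qed

text \<open>A reflection keeps C and Y and changes the sign of the vertical momentum. The factor
  is w - v before and - (w + v) after the reflection, where w^2 - v^2 = 1, so the quotient is
  - (w + v)^2.\<close>

lemma tau_refl_state:
  assumes w: "w \<in> level_set E 2" "snd (fst w) = 1" "\<not> vertical w" and q: "snd (snd w) < 0"
  shows "tau (refl_state w) = - (wall_root + speed_F)\<^sup>2 * tau w"
proof -
  define u where "u = speed_F * ((norm (fst w) + 1) / fst (fst w)) + fst (snd w) * norm (fst w) / (norm (fst w) - 1)"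
  have "(snd (snd w) * norm (fst w))\<^sup>2 = wall_root\<^sup>2"
    using wall_D_plus_2E[OF w(2)] w(1) speeds by (simp add: level_set_def)
  moreover have "snd (snd w) * norm (fst w) \<le> 0" using q by (simp add: mult_nonpos_nonneg)
  ultimately have qr: "snd (snd w) * norm (fst w) = - wall_root"
    using speeds(3) by (smt (verit) power2_eq_iff)
  have t: "tau w = (wall_root - speed_F) * u"
    using tau_wall[OF w] by (simp add: qr u_def)
  have "refl_state w \<in> level_set E 2" using refl_state_level_set[OF E(2) two_plus_2E_pos[OF minus_one_less_E E(2)] w(1,2)] .
  moreover have "\<not> vertical (refl_state w)" using w(3) by (simp add: vertical_def)
  ultimately have "tau (refl_state w) = - (wall_root + speed_F) * u"
    using tau_wall[of "refl_state w"] w(2) by (simp add: qr u_def)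
  moreover have "(wall_root + speed_F) * (wall_root - speed_F) = 1"
    using speeds(4) by (simp add: power2_eq_square algebra_simps)
  moreover have "- (wall_root + speed_F)\<^sup>2 * ((wall_root - speed_F) * u) =
      - (wall_root + speed_F) * ((wall_root + speed_F) * (wall_root - speed_F)) * u"
    by (simp add: power2_eq_square algebra_simps)
  ultimately show ?thesis unfolding t by simp
qed

end

section \<open>The separatrix\<close>

lemma vertical_refl_state [simp]: "vertical (refl_state w) \<longleftrightarrow> vertical w"
  by (simp add: vertical_def)

lemma vertical_states_ang_mom: "vertical_states E = {w \<in> level_set E 2. ang_mom w = 0}"
  by (auto simp: vertical_states_def ang_mom_zero_iff_vertical)

lemma compact_vertical_states:
  assumes "E < 0"
  shows "compact (vertical_states E)"
proof -
  have "closed (level_set E 2)" by (rule compact_imp_closed[OF compact_level_set[OF assms]])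
  moreover have "continuous_on (level_set E 2) ang_mom"
    using integrals_isCont(2) fst_level_set_nonzero by (blast intro: continuous_at_imp_continuous_on)
  ultimately have "closed (vertical_states E)"
    unfolding vertical_states_ang_mom by (intro continuous_closed_preimage_constant)
  then have "compact (level_set E 2 \<inter> vertical_states E)"
    using compact_level_set[OF assms] compact_Int_closed by blast
  also have "level_set E 2 \<inter> vertical_states E = vertical_states E" by (auto simp: vertical_states_def)
  finally show ?thesis .
qed

text \<open>By compactness, since on the level set the angular momentum vanishes exactly at the vertical states.\<close>

lemma near_vertical_states:
  assumes "E < 0" "\<epsilon> > 0"
  shows "\<exists>m>0. \<forall>w\<in>level_set E 2. \<bar>ang_mom w\<bar> < m \<longrightarrow> infdist w (vertical_states E) < \<epsilon>"
proof -
  define K where "K = level_set E 2 \<inter> {w. \<epsilon> \<le> infdist w (vertical_states E)}"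
  have "closed {w. \<epsilon> \<le> infdist w (vertical_states E)}"
    by (intro closed_Collect_le continuous_intros)
  then have K: "compact K" unfolding K_def using compact_level_set[OF assms(1)] by (intro compact_Int_closed)
  show ?thesis
  proof (cases "K = {}")
    case True
    then show ?thesis by (intro exI[of _ 1]) (auto simp: K_def not_le)
  next
    case False
    have "continuous_on K (\<lambda>w. \<bar>ang_mom w\<bar>)"
      using integrals_isCont(2) fst_level_set_nonzero
      by (intro continuous_on_rabs continuous_at_imp_continuous_on) (auto simp: K_def)
    then obtain w0 where w0: "w0 \<in> K" "\<And>w. w \<in> K \<Longrightarrow> \<bar>ang_mom w0\<bar> \<le> \<bar>ang_mom w\<bar>"
      using continuous_attains_inf[OF K False] by blast
    have "ang_mom w0 \<noteq> 0"
    proof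
      assume "ang_mom w0 = 0"
      then have "w0 \<in> vertical_states E" using w0(1) by (simp add: vertical_states_ang_mom K_def)
      then show False using w0(1) assms(2) by (simp add: K_def)
    qed
    then show ?thesis
      using w0(2) by (intro exI[of _ "\<bar>ang_mom w0\<bar>"]) (force simp: K_def not_le)
  qed
qed

context
  fixes E :: real
  assumes E: "- (1/2) < E" "E < 0"
begin

definition bounce_factor :: real where
  "bounce_factor = (wall_root E + speed_F E)\<^sup>2"

lemma bounce_factor_gt_1: "bounce_factor > 1"
proof -
  note sp = speeds[OF E]
  have "wall_root E > 1" using sp(1,3,4) by (smt (verit) one_power2 power2_le_imp_le power_mono zero_less_power)
  then have "wall_root E + speed_F E > 1" using sp(1) by simp
  then show ?thesis unfolding bounce_factor_def by (simp add: one_less_power)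
qed

lemma next_out_nonvertical:
  assumes w: "w \<in> outgoing E 2"
  shows "vertical (next_out w) \<longleftrightarrow> vertical w"
    "\<not> vertical w \<Longrightarrow> tau E (next_out w) = - bounce_factor * tau E w"
proof -
  note ctx = E(2) two_plus_2E_pos[OF minus_one_less_E[OF E] E(2)] w
  define e where "e = flight w (flight_time w)"
  have T: "0 \<le> flight_time w" using flight_time_pos[OF ctx] by simp
  have n: "next_out w = refl_state e" by (simp add: e_def flight_end_next[OF ctx])
  have e: "e \<in> level_set E 2" "snd (fst e) = 1" "ang_mom e = ang_mom w" "lrl e = lrl w"
    using flight_level_set[OF ctx T] flight_wall(2)[OF ctx] flight_invariants[OF ctx T] by (simp_all add: e_def)
  have w': "w \<in> level_set E 2" by (rule outgoingD(6)[OF ctx])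
  have ve: "vertical e \<longleftrightarrow> vertical w"
    using ang_mom_zero_iff_vertical[OF e(1)] ang_mom_zero_iff_vertical[OF w'] e(3) by simp
  then show "vertical (next_out w) \<longleftrightarrow> vertical w" by (simp add: n)
  have "snd (snd e) < 0" using next_out_outgoing[OF ctx] by (simp add: n outgoing_def)
  then show "\<not> vertical w \<Longrightarrow> tau E (next_out w) = - bounce_factor * tau E w"
    using tau_refl_state[OF E e(1,2)] ve e(3,4) by (simp add: n bounce_factor_def tau_def[OF E])
qed

context
  fixes \<sigma> :: "int \<Rightarrow> phase"
  assumes it: "itinerary E 2 \<sigma>" and nv: "\<not> vertical (\<sigma> 0)"
begin

interpretation bouncing_itinerary E 2 \<sigma>
  using E two_plus_2E_pos[OF minus_one_less_E[OF E] E(2)] it by unfold_locales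

lemma itinerary_nonvertical: "\<not> vertical (\<sigma> n)"
  using int_step_const[of "\<lambda>n. vertical (\<sigma> n)" n] next_out_nonvertical(1)[OF out] nv by (simp add: step)

lemma itinerary_ang_mom: "ang_mom (\<sigma> n) \<noteq> 0"
  using itinerary_nonvertical[of n] ang_mom_zero_iff_vertical[OF outgoingD(6)[OF E_neg D_pos out[of n]]]
  by simp

lemma tau_power:
  "\<bar>tau E (\<sigma> (m + int k))\<bar> = bounce_factor ^ k * \<bar>tau E (\<sigma> m)\<bar>"
proof (induction k)
  case (Suc k)
  have "\<sigma> (m + int (Suc k)) = next_out (\<sigma> (m + int k))" using step[of "m + int k"] by (simp add: ac_simps)
  then have "\<bar>tau E (\<sigma> (m + int (Suc k)))\<bar> = bounce_factor * \<bar>tau E (\<sigma> (m + int k))\<bar>"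
    using next_out_nonvertical(2)[OF out itinerary_nonvertical] bounce_factor_gt_1 by (simp add: abs_mult)
  then show ?case using Suc by simp
qed simp

text \<open>The absolute value of tau grows geometrically in the future and decays geometrically in the past, and in both cases L tends
  to 0.\<close>

lemma itinerary_ang_mom_decay:
  "\<exists>B. \<forall>n. \<bar>ang_mom (\<sigma> n)\<bar> \<le> B * (1 / bounce_factor) ^ nat \<bar>n\<bar>"
proof -
  define t0 where "t0 = \<bar>tau E (\<sigma> 0)\<bar>"
  define v where "v = 4 * speed_F E"
  note le = ang_mom_le_tau[OF E outgoingD(6)[OF E_neg D_pos out] itinerary_ang_mom]
  have t0: "t0 > 0" using le(1)[of 0] by (simp add: t0_def)
  have v: "v > 0" using speeds(1)[OF E] by (simp add: v_def)
  have bf: "bounce_factor > 0" using bounce_factor_gt_1 by simp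
  have "\<bar>ang_mom (\<sigma> n)\<bar> \<le> (v / t0 + v * t0) * (1 / bounce_factor) ^ nat \<bar>n\<bar>" for n
  proof (cases "n \<ge> 0")
    case True
    define k where "k = nat n"
    have n: "n = int k" using True by (simp add: k_def)
    have "\<bar>ang_mom (\<sigma> n)\<bar> \<le> v / (bounce_factor ^ k * t0)"
      using le(3)[of n] tau_power[of 0 k] by (simp add: n v_def t0_def)
    also have "\<dots> = v / t0 * (1 / bounce_factor) ^ k" by (simp add: power_divide)
    also have "\<dots> \<le> (v / t0 + v * t0) * (1 / bounce_factor) ^ k"
      using t0 v bf by (intro mult_right_mono) auto
    finally show ?thesis by (simp add: n)
  next
    case False
    define k where "k = nat (- n)"
    have n: "n = - int k" using False by (simp add: k_def)
    have "t0 = bounce_factor ^ k * \<bar>tau E (\<sigma> n)\<bar>" using tau_power[of n k] by (simp add: n t0_def)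
    then have "\<bar>tau E (\<sigma> n)\<bar> = t0 * (1 / bounce_factor) ^ k" using bf by (simp add: power_divide field_simps)
    then have "\<bar>ang_mom (\<sigma> n)\<bar> \<le> v * (t0 * (1 / bounce_factor) ^ k)"
      using le(2)[of n] by (simp add: v_def)
    also have "\<dots> = v * t0 * (1 / bounce_factor) ^ k" by simp
    also have "\<dots> \<le> (v / t0 + v * t0) * (1 / bounce_factor) ^ k"
      using t0 v bf by (intro mult_right_mono) auto
    finally show ?thesis by (simp add: n)
  qed
  then show ?thesis by blast
qed

lemma itinerary_ang_mom_small:
  assumes "m > 0"
  shows "\<exists>K::nat. \<forall>n. \<bar>n\<bar> \<ge> int K \<longrightarrow> \<bar>ang_mom (\<sigma> n)\<bar> < m"
proof -
  obtain B where B: "\<And>n. \<bar>ang_mom (\<sigma> n)\<bar> \<le> B * (1 / bounce_factor) ^ nat \<bar>n\<bar>"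
    using itinerary_ang_mom_decay by blast
  have "(\<lambda>k. (1 / bounce_factor) ^ k) \<longlonglongrightarrow> 0"
    using bounce_factor_gt_1 by (intro LIMSEQ_realpow_zero) simp_all
  then have "(\<lambda>k. B * (1 / bounce_factor) ^ k) \<longlonglongrightarrow> B * 0" by (rule tendsto_mult_left)
  then have "\<forall>\<^sub>F k in sequentially. B * (1 / bounce_factor) ^ k < m"
    using assms by (intro order_tendstoD) auto
  then obtain K where K: "\<And>k. k \<ge> K \<Longrightarrow> B * (1 / bounce_factor) ^ k < m"
    by (auto simp: eventually_sequentially)
  have "\<bar>ang_mom (\<sigma> n)\<bar> < m" if "\<bar>n\<bar> \<ge> int K" for n
    using B[of n] K[of "nat \<bar>n\<bar>"] that by linarith
  then show ?thesis by blast
qed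

lemma itinerary_asymptotic:
  "((\<lambda>t. infdist (z t) (vertical_states E)) \<longlongrightarrow> 0) at_top"
  "((\<lambda>t. infdist (z t) (vertical_states E)) \<longlongrightarrow> 0) at_bot"
proof -
  have close: "\<exists>K::nat. \<forall>t. \<bar>chain.index t\<bar> \<ge> int K \<longrightarrow> infdist (z t) (vertical_states E) < \<epsilon>" if \<epsilon>: "\<epsilon> > 0" for \<epsilon>
  proof -
    obtain m where m: "m > 0" "\<And>w. w \<in> level_set E 2 \<Longrightarrow> \<bar>ang_mom w\<bar> < m \<Longrightarrow> infdist w (vertical_states E) < \<epsilon>"
      using near_vertical_states[OF E(2) \<epsilon>] by blast
    obtain K where K: "\<And>n. \<bar>n\<bar> \<ge> int K \<Longrightarrow> \<bar>ang_mom (\<sigma> n)\<bar> < m"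
      using itinerary_ang_mom_small[OF m(1)] by blast
    show ?thesis
      using m(2)[OF glued_level_set] K ang_mom_glued by (intro exI[of _ K]) auto
  qed
  show "((\<lambda>t. infdist (z t) (vertical_states E)) \<longlongrightarrow> 0) at_top"
  proof (rule tendstoI)
    fix \<epsilon> :: real assume "\<epsilon> > 0"
    then obtain K :: nat where K: "\<And>t. \<bar>chain.index t\<bar> \<ge> int K \<Longrightarrow> infdist (z t) (vertical_states E) < \<epsilon>"
      using close by blast
    have "infdist (z t) (vertical_states E) < \<epsilon>" if t: "t \<ge> chain.hit_time (int K)" for t
    proof -
      have "chain.hit_time (int K) < chain.hit_time (chain.index t + 1)" using chain.index_bounds(2)[of t] t by linarith
      then have "int K \<le> chain.index t" by (simp add: chain.hit_time_less_iff)
      then show ?thesis using K[of t] by simp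
    qed
    then show "\<forall>\<^sub>F t in at_top. dist (infdist (z t) (vertical_states E)) 0 < \<epsilon>"
      unfolding eventually_at_top_linorder by (auto simp: infdist_nonneg)
  qed
  show "((\<lambda>t. infdist (z t) (vertical_states E)) \<longlongrightarrow> 0) at_bot"
  proof (rule tendstoI)
    fix \<epsilon> :: real assume "\<epsilon> > 0"
    then obtain K :: nat where K: "\<And>t. \<bar>chain.index t\<bar> \<ge> int K \<Longrightarrow> infdist (z t) (vertical_states E) < \<epsilon>"
      using close by blast
    have "infdist (z t) (vertical_states E) < \<epsilon>" if t: "t \<le> chain.hit_time (- int K)" for t
    proof -
      have "chain.hit_time (chain.index t) \<le> chain.hit_time (- int K)" using chain.index_bounds(1)[of t] t by linarith
      then have "chain.index t \<le> - int K" by (simp add: chain.hit_time_le_iff)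
      then show ?thesis using K[of t] by simp
    qed
    then show "\<forall>\<^sub>F t in at_bot. dist (infdist (z t) (vertical_states E)) 0 < \<epsilon>"
      unfolding eventually_at_bot_linorder by (auto simp: infdist_nonneg)
  qed
qed

text \<open>An arc is the path of one flight, including both ends.\<close>

lemma itinerary_arcs:
  assumes "A \<in> arcs z"
  shows "elliptic_arc A \<and> F_pt \<in> A"
proof -
  obtain a b where ab: "A = (\<lambda>t. fst (z t)) ` {a..b}" "a \<in> hits z" "b \<in> hits z" "a < b" "hits z \<inter> {a<..<b} = {}"
    using assms by (auto simp: arcs_def)
  obtain n m where nm: "a = chain.hit_time n" "b = chain.hit_time m"
    using ab(2,3) by (auto simp: chain.hits_glued)
  have "n < m" using ab(4) by (simp add: nm chain.hit_time_less_iff)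
  have "m = n + 1"
  proof (rule ccontr)
    assume "m \<noteq> n + 1"
    then have "chain.hit_time (n + 1) \<in> {a<..<b}" using \<open>n < m\<close> by (simp add: nm chain.hit_time_less_iff)
    moreover have "chain.hit_time (n + 1) \<in> hits z" by (simp add: chain.hits_glued)
    ultimately show False using ab(5) by blast
  qed
  have pos: "fst (z (chain.hit_time n + t)) = fst (flight (\<sigma> n) t)" if t: "0 \<le> t" "t \<le> flight_time (\<sigma> n)" for t
  proof (cases "t = flight_time (\<sigma> n)")
    case True
    have "z (chain.hit_time n + t) = z (chain.hit_time (n + 1))" by (simp add: chain.hit_time_step True)
    also have "\<dots> = refl_state (flight (\<sigma> n) t)"
      using glued_hit_state[of "n + 1"] flight_end_next[OF E_neg D_pos out[of n]] by (simp add: step True)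
    finally show ?thesis by simp
  next
    case False
    then show ?thesis
      using chain.glued_eq[of n "chain.hit_time n + t"] t by (simp add: chain.hit_time_step)
  qed
  have ival: "{a..b} = (\<lambda>t. chain.hit_time n + t) ` {0..flight_time (\<sigma> n)}"
    by (simp add: nm \<open>m = n + 1\<close> chain.hit_time_step)
  have "A = (\<lambda>t. fst (z (chain.hit_time n + t))) ` {0..flight_time (\<sigma> n)}"
    unfolding ab(1) ival image_image ..
  also have "\<dots> = (\<lambda>t. fst (flight (\<sigma> n) t)) ` {0..flight_time (\<sigma> n)}"
    using pos by (intro image_cong) auto
  finally have A: "A = (\<lambda>t. fst (flight (\<sigma> n) t)) ` {0..flight_time (\<sigma> n)}" .
  have "elliptic_arc A"
    unfolding A by (rule flight_elliptic[OF minus_one_less_E[OF E] E(2) out itinerary_ang_mom])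
  moreover have "F_pt \<in> A"
    using flight_passes_F[OF minus_one_less_E[OF E] E(2) out[of n] itinerary_ang_mom] unfolding A by force
  ultimately show ?thesis by blast
qed

lemma nonvertical_trajectory:
  "\<exists>y. bouncing_trajectory y \<and> range y \<subseteq> level_set E 2 \<and> \<sigma> 0 \<in> range y \<and>
     (\<forall>s. 0 \<le> s \<and> s < exit_par (\<sigma> 0) \<longrightarrow> flow (\<sigma> 0) s \<in> range y) \<and>
     (\<forall>A \<in> arcs y. elliptic_arc A \<and> F_pt \<in> A) \<and>
     ((\<lambda>t. infdist (y t) (vertical_states E)) \<longlongrightarrow> 0) at_top \<and>
     ((\<lambda>t. infdist (y t) (vertical_states E)) \<longlongrightarrow> 0) at_bot"
  using chain.glued_bouncing glued_level_set flow_in_range[of _ 0] glued_hit_state[of 0]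
    itinerary_arcs itinerary_asymptotic
  by (intro exI[of _ z]) (auto intro: range_eqI[OF sym])

end

lemma separatrix_trajectory:
  assumes w: "w \<in> level_set E 2" "\<not> vertical w"
  shows "\<exists>y. bouncing_trajectory y \<and> range y \<subseteq> level_set E 2 \<and> w \<in> orbit y \<and>
     (\<forall>A \<in> arcs y. elliptic_arc A \<and> F_pt \<in> A) \<and>
     ((\<lambda>t. infdist (y t) (vertical_states E)) \<longlongrightarrow> 0) at_top \<and>
     ((\<lambda>t. infdist (y t) (vertical_states E)) \<longlongrightarrow> 0) at_bot"
proof -
  note ctx = E(2) two_plus_2E_pos[OF minus_one_less_E[OF E] E(2)]
  obtain w0 where w0: "w0 \<in> outgoing E 2" "w = refl_state w0 \<or> (\<exists>s. 0 \<le> s \<and> s < exit_par w0 \<and> w = flow w0 s)"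
    using level_set_cover[OF ctx w(1)] by blast
  note o = outgoingD[OF ctx w0(1)]
  have nv: "\<not> vertical w0"
  proof (cases "w = refl_state w0")
    case True then show ?thesis using w(2) by simp
  next
    case False
    then obtain s where s: "w = flow w0 s" using w0(2) by blast
    have "fst (flow w0 s) \<noteq> 0" using fst_level_set_nonzero[OF w(1)] by (simp add: s)
    then have "ang_mom w = ang_mom w0" using flow_invariants(3)[OF o(3,5)] s by simp
    then show ?thesis using ang_mom_zero_iff_vertical[OF w(1)] ang_mom_zero_iff_vertical[OF o(6)] w(2) by simp
  qed
  obtain \<sigma> where \<sigma>: "itinerary E 2 \<sigma>" "\<sigma> 0 = w0" using itinerary_exists[OF ctx w0(1)] by blast
  obtain y where y: "bouncing_trajectory y" "range y \<subseteq> level_set E 2" "w0 \<in> range y"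
     "\<And>s. 0 \<le> s \<Longrightarrow> s < exit_par w0 \<Longrightarrow> flow w0 s \<in> range y"
     "\<forall>A \<in> arcs y. elliptic_arc A \<and> F_pt \<in> A"
     "((\<lambda>t. infdist (y t) (vertical_states E)) \<longlongrightarrow> 0) at_top"
     "((\<lambda>t. infdist (y t) (vertical_states E)) \<longlongrightarrow> 0) at_bot"
    using nonvertical_trajectory[OF \<sigma>(1)] nv \<sigma>(2) by auto
  have "w \<in> orbit y"
    using w0(2) y(3,4) o(7) by (auto simp: orbit_eq)
  then show ?thesis using y by blast
qed

lemma vertical_states_nonempty: "vertical_start E \<in> vertical_states E"
  using vertical_outgoing[OF minus_one_less_E[OF E] E(2), of "vertical_start E"] by (simp add: vertical_states_def outgoing_def)

text \<open>A trajectory asymptotic to the vertical orbit has the same energy and the same D. Motion along the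
  wall is impossible for it, because there D + 2 E = 0.\<close>

lemma separatrix_vertical_states: "separatrix (vertical_states E) = level_set E 2 - vertical_states E"
proof (intro equalityI subsetI)
  fix w assume "w \<in> separatrix (vertical_states E)"
  then obtain z where w: "w \<in> phase_space" "w \<notin> vertical_states E" and z: "trajectory z" "w \<in> orbit z"
    "((\<lambda>t. infdist (z t) (vertical_states E)) \<longlongrightarrow> 0) at_top"
    unfolding separatrix_def by blast
  note asym = asymptotic_conserved[OF compact_vertical_states[OF E(2)] _ z(3)]
  have ne: "vertical_states E \<noteq> {}" using vertical_states_nonempty by blast
  have g: "fst v \<noteq> 0" "energy v = E" "D_int v = 2" if "v \<in> vertical_states E" for v
    using that fst_level_set_nonzero[of v E 2] by (auto simp: vertical_states_def level_set_def)
  have "bouncing_trajectory z"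
  proof (rule ccontr)
    assume "\<not> bouncing_trajectory z"
    then have "wall_trajectory z" using z(1) by (simp add: trajectory_def)
    then have s: "D_int (z t) + 2 * energy (z t) = 0" for t
      using wall_D_plus_2E[of "z t"] by (simp add: wall_trajectory_def wall_def)
    have "0 = 2 + 2 * E"
    proof (rule asym[where G = "\<lambda>w. D_int w + 2 * energy w", OF ne _ _ s])
      show "isCont (\<lambda>w. D_int w + 2 * energy w) v" if "v \<in> vertical_states E" for v
        using integrals_isCont[OF g(1)[OF that]] by (intro continuous_intros)
      show "D_int v + 2 * energy v = 2 + 2 * E" if "v \<in> vertical_states E" for v
        using g(2,3)[OF that] by simp
    qed
    then show False using E by simp
  qed
  note cons = bouncing_energy_D[OF this]
  have "energy (z 0) = E"
    by (rule asym[where G = energy, OF ne integrals_isCont(1)[OF g(1)] g(2) cons(1)])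
  moreover have "D_int (z 0) = 2"
    by (rule asym[where G = D_int, OF ne integrals_isCont(3)[OF g(1)] g(3) cons(2)])
  ultimately have zt: "energy (z t) = E" "D_int (z t) = 2" for t using cons[of t 0] by simp_all
  have "energy w = E \<and> D_int w = 2" using z(2) zt by (auto simp: orbit_eq)
  then show "w \<in> level_set E 2 - vertical_states E" using w by (simp add: level_set_def)
next
  fix w assume w: "w \<in> level_set E 2 - vertical_states E"
  then have "\<not> vertical w" by (simp add: vertical_states_def)
  then obtain y where "bouncing_trajectory y" "w \<in> orbit y"
    "((\<lambda>t. infdist (y t) (vertical_states E)) \<longlongrightarrow> 0) at_top"
    "((\<lambda>t. infdist (y t) (vertical_states E)) \<longlongrightarrow> 0) at_bot"
    using separatrix_trajectory w by blast
  then show "w \<in> separatrix (vertical_states E)"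
    using w unfolding separatrix_def trajectory_def level_set_def by blast
qed

text \<open>Every nonvertical state has a trajectory with the required arcs; a trajectory with such arcs is never
  vertical.\<close>

lemma separatrix_orbits:
  "level_set E 2 - vertical_states E =
     \<Union> {orbit y | y. bouncing_trajectory y \<and> range y \<subseteq> level_set E 2 \<and>
                    (\<forall>A \<in> arcs y. elliptic_arc A \<and> F_pt \<in> A)}"
proof (intro equalityI subsetI)
  fix w assume "w \<in> level_set E 2 - vertical_states E"
  then have "w \<in> level_set E 2" "\<not> vertical w" by (auto simp: vertical_states_def)
  from separatrix_trajectory[OF this] show "w \<in> \<Union> {orbit y | y. bouncing_trajectory y \<and> range y \<subseteq> level_set E 2 \<and>
                    (\<forall>A \<in> arcs y. elliptic_arc A \<and> F_pt \<in> A)}"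
    by blast
next
  fix w assume "w \<in> \<Union> {orbit y | y. bouncing_trajectory y \<and> range y \<subseteq> level_set E 2 \<and>
                    (\<forall>A \<in> arcs y. elliptic_arc A \<and> F_pt \<in> A)}"
  then obtain y where y: "bouncing_trajectory y" "range y \<subseteq> level_set E 2"
    "\<And>A. A \<in> arcs y \<Longrightarrow> elliptic_arc A \<and> F_pt \<in> A" and w: "w \<in> orbit y" by blast
  have nv: "\<not> vertical (y t)" for t by (rule elliptic_not_vertical[OF minus_one_less_E[OF E] E(2) y])
  from w consider t where "w = y t" | t where "w = refl_state (y t)" "snd (fst (y t)) = 1"
    by (auto simp: orbit_eq)
  then show "w \<in> level_set E 2 - vertical_states E"
  proof cases
    case 1 then show ?thesis using y(2) nv by (auto simp: vertical_states_def)
  next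
    case 2
    then show ?thesis
      using y(2) nv[of t] refl_state_level_set[OF E(2) two_plus_2E_pos[OF minus_one_less_E[OF E] E(2)], of "y t"]
      by (auto simp: vertical_states_def)
  qed
qed

lemma separatrix_nonempty: "level_set E 2 - vertical_states E \<noteq> {}"
proof -
  define w :: phase where "w = (F_pt, (speed_F E, 0))"
  have "energy w = E" using speeds(2)[OF E] E by (simp add: w_def energy_def norm_plane F_pt_def add_divide_distrib)
  moreover have "D_int w = 2"
    by (simp add: w_def D_int_coords ang_mom_def norm_plane F_pt_def power2_eq_square)
  ultimately have "w \<in> level_set E 2" by (simp add: level_set_def phase_space_def table_def w_def F_pt_def)
  moreover have "\<not> vertical w" using speeds(1)[OF E] by (simp add: vertical_def w_def)
  ultimately show ?thesis by (auto simp: vertical_states_def)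
qed

end

section \<open>The limiting motion along the wall\<close>

context
  fixes E :: real
  assumes E: "-1 < E" "E < 0"
begin

definition wall_amp :: real where "wall_amp = sqrt (1 / E\<^sup>2 - 1)"

text \<open>The motion is x'' = - x / r^3 with r^2 = 1 + x^2. Its energy curve is parametrised by an angle
  with x proportional to the sine; \<open>wall_lapse\<close> is dt / d\<theta>. This is the square root of a
  positive quotient, so the turning points need no special treatment.\<close>

definition wall_rad :: "real \<Rightarrow> real" where
  "wall_rad \<theta> = sqrt (1 + (wall_amp * sin \<theta>)\<^sup>2)"

definition wall_lapse :: "real \<Rightarrow> real" where
  "wall_lapse \<theta> = sqrt (wall_rad \<theta> * (wall_rad \<theta> - 1 / E) / (- 2 * E))"

definition wall_state :: "real \<Rightarrow> phase" where
  "wall_state \<theta> = ((wall_amp * sin \<theta>, 1), (wall_amp * cos \<theta> / wall_lapse \<theta>, 0))"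

lemma wall_amp: "wall_amp > 0" "wall_amp\<^sup>2 = 1 / E\<^sup>2 - 1"
proof -
  have "E\<^sup>2 < 1" using E by (intro abs_square_less_1[THEN iffD2]) auto
  then have "1 / E\<^sup>2 > 1" using E by simp
  then show "wall_amp > 0" "wall_amp\<^sup>2 = 1 / E\<^sup>2 - 1" by (simp_all add: wall_amp_def)
qed

lemma wall_rad: "wall_rad \<theta> \<ge> 1" "(wall_rad \<theta>)\<^sup>2 = 1 + (wall_amp * sin \<theta>)\<^sup>2"
  by (simp_all add: wall_rad_def)

text \<open>The maximal radius is - 1 / E, and the amplitude satisfies the same relation as x and r.\<close>

lemma wall_rad_amp: "(wall_amp * cos \<theta>)\<^sup>2 = (- 1 / E - wall_rad \<theta>) * (- 1 / E + wall_rad \<theta>)"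
proof -
  have "(wall_amp * cos \<theta>)\<^sup>2 + (wall_amp * sin \<theta>)\<^sup>2 = wall_amp\<^sup>2"
    by (simp add: power_mult_distrib flip: distrib_left)
  then have "(wall_amp * cos \<theta>)\<^sup>2 = 1 / E\<^sup>2 - (wall_rad \<theta>)\<^sup>2" using wall_amp(2) wall_rad(2)[of \<theta>] by simp
  also have "\<dots> = (- 1 / E - wall_rad \<theta>) * (- 1 / E + wall_rad \<theta>)"
    by (simp add: power2_eq_square algebra_simps)
  finally show ?thesis .
qed

lemma wall_lapse:
  "(wall_lapse \<theta>)\<^sup>2 = wall_rad \<theta> * (wall_rad \<theta> - 1 / E) / (- 2 * E)" "wall_lapse \<theta> \<ge> 1/2"
proof -
  have E1: "- 1 / E > 1" using E by (subst neg_less_divide_eq) auto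
  have "wall_rad \<theta> * (wall_rad \<theta> - 1 / E) \<ge> 1 * 1"
    using wall_rad(1)[of \<theta>] E1 by (intro mult_mono) auto
  moreover have "- 2 * E > 0" "- 2 * E \<le> 2" using E by simp_all
  ultimately have ge: "wall_rad \<theta> * (wall_rad \<theta> - 1 / E) / (- 2 * E) \<ge> 1 / 2"
    by (intro frac_le) auto
  then have "wall_rad \<theta> * (wall_rad \<theta> - 1 / E) / (- 2 * E) \<ge> 0" by linarith
  then show "(wall_lapse \<theta>)\<^sup>2 = wall_rad \<theta> * (wall_rad \<theta> - 1 / E) / (- 2 * E)"
    unfolding wall_lapse_def by (rule real_sqrt_pow2)
  have "(1/2)\<^sup>2 \<le> wall_rad \<theta> * (wall_rad \<theta> - 1 / E) / (- 2 * E)" using ge by (simp add: power2_eq_square)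
  then show "wall_lapse \<theta> \<ge> 1/2" unfolding wall_lapse_def by (rule real_le_rsqrt)
qed

lemma wall_lapse_pos: "wall_lapse \<theta> > 0"
  using wall_lapse(2)[of \<theta>] by linarith

lemma wall_state_norm: "norm (fst (wall_state \<theta>)) = wall_rad \<theta>"
  by (simp add: wall_state_def norm_plane wall_rad_def add.commute)

lemma wall_momentum_sq: "(wall_amp * cos \<theta> / wall_lapse \<theta>)\<^sup>2 = 2 * (E + 1 / wall_rad \<theta>)"
proof -
  define r where "r = wall_rad \<theta>"
  have r: "r \<ge> 1" using wall_rad(1) by (simp add: r_def)
  have "1 / E < 0" using E by simp
  then have s: "r - 1 / E > 0" using r by linarith
  have "(wall_amp * cos \<theta> / wall_lapse \<theta>)\<^sup>2 = (- 1 / E - r) * (r - 1 / E) / (r * (r - 1 / E) / (- 2 * E))"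
    by (simp add: power_divide wall_rad_amp wall_lapse r_def)
  also have "\<dots> = (- 1 / E - r) / (r / (- 2 * E))" using s by simp
  also have "\<dots> = 2 * (E + 1 / r)" using r E by (simp add: field_simps)
  finally show ?thesis by (simp add: r_def)
qed

lemma wall_state_level_set: "wall_state \<theta> \<in> level_set E (- 2 * E)"
proof -
  have e: "energy (wall_state \<theta>) = E"
  proof -
    have "snd (wall_state \<theta>) \<bullet> snd (wall_state \<theta>) = 2 * (E + 1 / wall_rad \<theta>)"
      unfolding wall_momentum_sq[symmetric] by (simp add: wall_state_def inner_prod_def power2_eq_square)
    then show ?thesis using momentum_sq[of "wall_state \<theta>"] by (simp add: wall_state_norm)
  qed
  moreover have "D_int (wall_state \<theta>) + 2 * E = 0"
    using wall_D_plus_2E[of "wall_state \<theta>"] e by (simp add: wall_state_def)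
  ultimately show ?thesis by (simp add: level_set_def phase_space_def table_def wall_state_def)
qed

text \<open>By the energy equation, the two numbers that have to be the cosine and the sine of the angle of a
  state have the sum of squares 1.\<close>

lemma wall_level_set: "level_set E (- 2 * E) = range wall_state"
proof (intro equalityI subsetI)
  fix w assume w: "w \<in> level_set E (- 2 * E)"
  define x where "x = fst (fst w)"
  define p where "p = fst (snd w)"
  define r where "r = norm (fst w)"
  have r: "r \<ge> 1" using level_set_norm_ge[OF w] by (simp add: r_def)
  have "(ang_mom w + p)\<^sup>2 + (snd (snd w))\<^sup>2 + 2 * (snd (fst w) - 1) / r = 0"
    using D_plus_2E[OF fst_level_set_nonzero[OF w]] w by (simp add: level_set_def p_def r_def)
  moreover have "snd (fst w) \<ge> 1" using w by (simp add: level_set_def phase_space_def table_def)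
  then have "2 * (snd (fst w) - 1) / r \<ge> 0" using r by simp
  ultimately have "(snd (snd w))\<^sup>2 = 0 \<and> 2 * (snd (fst w) - 1) / r = 0"
    using zero_le_power2[of "ang_mom w + p"] zero_le_power2[of "snd (snd w)"] by linarith
  then have q: "snd (snd w) = 0" and y: "snd (fst w) = 1" using r by auto
  have rr: "r\<^sup>2 = x\<^sup>2 + 1" using norm_plane_sq[of "fst w"] y by (simp add: r_def x_def)
  have pp: "p\<^sup>2 = 2 * (E + 1 / r)"
    using momentum_sq[of w] w q by (simp add: level_set_def inner_prod_def p_def r_def power2_eq_square)
  define h where "h = sqrt (r * (r - 1 / E) / (- 2 * E))"
  have "1 / E < 0" using E by simp
  then have s: "r - 1 / E > 0" using r by linarith
  have h2: "h\<^sup>2 = r * (r - 1 / E) / (- 2 * E)" using r s E by (simp add: h_def divide_nonneg_neg mult_nonneg_nonneg)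
  have h0: "h > 0" unfolding h_def using r s E by (simp add: divide_pos_neg mult_pos_pos)
  have "p\<^sup>2 * h\<^sup>2 = (E + 1 / r) * r * (r - 1 / E) / (- E)"
  proof -
    have "2 * u * (a / (- 2 * E)) = u * a / (- E)" for u a using E by (simp add: field_simps)
    then show ?thesis unfolding pp h2 by (simp only: mult.assoc)
  qed
  also have "\<dots> = (- 1 / E - r) * (- 1 / E + r)"
    using r E by (simp add: field_simps)
  also have "\<dots> = 1 / E\<^sup>2 - r\<^sup>2" by (simp add: power2_eq_square algebra_simps)
  also have "\<dots> = wall_amp\<^sup>2 - x\<^sup>2" using wall_amp(2) rr by simp
  finally have "(p * h)\<^sup>2 + x\<^sup>2 = wall_amp\<^sup>2" by (simp add: power_mult_distrib)
  then have "(p * h / wall_amp)\<^sup>2 + (x / wall_amp)\<^sup>2 = 1"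
    using wall_amp(1) by (simp add: power_divide flip: add_divide_distrib)
  then obtain \<theta> where \<theta>: "p * h / wall_amp = cos \<theta>" "x / wall_amp = sin \<theta>"
    using sincos_total_2pi by metis
  have x: "x = wall_amp * sin \<theta>" using \<theta>(2) wall_amp(1) by (simp add: field_simps)
  have "wall_rad \<theta> = r" unfolding wall_rad_def x[symmetric] using rr r by (simp add: real_sqrt_unique add.commute)
  then have "wall_lapse \<theta> = h" by (simp add: wall_lapse_def h_def)
  then have "p = wall_amp * cos \<theta> / wall_lapse \<theta>" using \<theta>(1) wall_amp(1) h0 by (simp add: field_simps)
  then have "w = wall_state \<theta>" using x y q by (simp add: wall_state_def prod_eq_iff x_def p_def)
  then show "w \<in> range wall_state" by blast
qed (use wall_state_level_set in auto)

lemma wall_rad_derivative: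
  "(wall_rad has_real_derivative wall_amp\<^sup>2 * sin \<theta> * cos \<theta> / wall_rad \<theta>) (at \<theta>)"
proof -
  have pos: "1 + (wall_amp * sin \<theta>)\<^sup>2 > 0" by (simp add: add_pos_nonneg)
  have d: "((\<lambda>\<theta>. 1 + (wall_amp * sin \<theta>)\<^sup>2) has_real_derivative 2 * (wall_amp\<^sup>2 * sin \<theta> * cos \<theta>)) (at \<theta>)"
    by (auto intro!: derivative_eq_intros simp: power2_eq_square)
  have "((\<lambda>\<theta>. sqrt (1 + (wall_amp * sin \<theta>)\<^sup>2)) has_real_derivative
      inverse (sqrt (1 + (wall_amp * sin \<theta>)\<^sup>2)) / 2 * (2 * (wall_amp\<^sup>2 * sin \<theta> * cos \<theta>))) (at \<theta>)"
    by (rule DERIV_chain2[where f = sqrt and g = "\<lambda>\<theta>. 1 + (wall_amp * sin \<theta>)\<^sup>2", OF DERIV_real_sqrt[OF pos] d])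
  moreover have "inverse (wall_rad \<theta>) / 2 * (2 * (wall_amp\<^sup>2 * sin \<theta> * cos \<theta>)) = wall_amp\<^sup>2 * sin \<theta> * cos \<theta> / wall_rad \<theta>"
    by (simp add: field_simps)
  ultimately show ?thesis unfolding wall_rad_def[abs_def] wall_rad_def by metis
qed

lemma wall_lapse_derivative:
  "(wall_lapse has_real_derivative
     (wall_amp\<^sup>2 * sin \<theta> * cos \<theta> / wall_rad \<theta>) * (2 * wall_rad \<theta> - 1 / E) / (- 4 * E * wall_lapse \<theta>)) (at \<theta>)"
proof -
  define r' where "r' = wall_amp\<^sup>2 * sin \<theta> * cos \<theta> / wall_rad \<theta>"
  have r': "(wall_rad has_real_derivative r') (at \<theta>)" using wall_rad_derivative by (simp add: r'_def)
  define G where "G \<theta> = wall_rad \<theta> * (wall_rad \<theta> - 1 / E) / (- 2 * E)" for \<theta>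
  have pos: "G \<theta> > 0" using wall_lapse(1)[of \<theta>] wall_lapse_pos[of \<theta>] by (metis G_def zero_less_power)
  have d: "(G has_real_derivative (r' * (2 * wall_rad \<theta> - 1 / E) / (- 2 * E))) (at \<theta>)"
    unfolding G_def[abs_def] using E
    by (auto intro!: derivative_eq_intros r' simp: field_simps)
  have "((\<lambda>\<theta>. sqrt (G \<theta>)) has_real_derivative inverse (sqrt (G \<theta>)) / 2 * (r' * (2 * wall_rad \<theta> - 1 / E) / (- 2 * E))) (at \<theta>)"
    by (rule DERIV_chain2[where f = sqrt and g = G, OF DERIV_real_sqrt[OF pos] d])
  moreover have "(\<lambda>\<theta>. sqrt (G \<theta>)) = wall_lapse" by (simp add: G_def[abs_def] wall_lapse_def[abs_def])
  moreover have "sqrt (G \<theta>) = wall_lapse \<theta>" by (simp add: G_def wall_lapse_def)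
  moreover have "inverse (wall_lapse \<theta>) / 2 * (r' * (2 * wall_rad \<theta> - 1 / E) / (- 2 * E)) =
     r' * (2 * wall_rad \<theta> - 1 / E) / (- 4 * E * wall_lapse \<theta>)"
    using wall_lapse_pos[of \<theta>] E by (simp add: inverse_eq_divide)
  ultimately show ?thesis unfolding r'_def by metis
qed

text \<open>The equation of motion in the angle: d / d\<theta> of the momentum is the tangential force times dt / d\<theta>.\<close>

lemma wall_momentum_derivative:
  "((\<lambda>\<theta>. wall_amp * cos \<theta> / wall_lapse \<theta>) has_real_derivative
     - wall_lapse \<theta> * (wall_amp * sin \<theta> / wall_rad \<theta> ^ 3)) (at \<theta>)"
proof -
  define r where "r = wall_rad \<theta>"
  define h where "h = wall_lapse \<theta>"
  define s where "s = sin \<theta>"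
  define c where "c = cos \<theta>"
  define X where "X = wall_amp"
  (* m is the maximal radius, where the particle turns. *)
  define m where "m = - 1 / E"
  have m: "m > 0" "E = - 1 / m" using E by (simp_all add: m_def)
  have r: "r \<ge> 1" and h: "h > 0" using wall_rad(1) wall_lapse_pos by (simp_all add: r_def h_def)
  have h2: "h\<^sup>2 = m * (r * (r + m)) / 2"
    using wall_lapse(1)[of \<theta>] m by (simp add: h_def r_def)
  have Xc: "X\<^sup>2 * c\<^sup>2 = (m - r) * (m + r)"
    unfolding X_def c_def r_def m_def power_mult_distrib[symmetric] by (rule wall_rad_amp)
  define h' where "h' = (X\<^sup>2 * s * c / r) * (2 * r + m) * m / (4 * h)"
  have dh: "(wall_lapse has_real_derivative h') (at \<theta>)"
    using wall_lapse_derivative[of \<theta>] m by (simp add: h'_def X_def s_def c_def r_def h_def mult_ac)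
  have "((\<lambda>\<theta>. wall_amp * cos \<theta> / wall_lapse \<theta>) has_real_derivative (- X * s * h - X * c * h') / (h * h)) (at \<theta>)"
    using h by (auto intro!: derivative_eq_intros dh simp: h_def X_def s_def c_def)
  also have "(- X * s * h - X * c * h') / (h * h) = - h * (X * s / r ^ 3)"
  proof -
    define W where "W = (2 * r + m) * m / (4 * r)"
    have hh': "h * (X * c * h') = X * s * (X\<^sup>2 * c\<^sup>2) * W"
      using h r by (simp add: W_def h'_def power2_eq_square) (simp add: mult_ac)
    have "h * (- X * s * h - X * c * h') = - (X * s * h\<^sup>2) - h * (X * c * h')"
      by (simp add: algebra_simps power2_eq_square)
    also have "\<dots> = - (X * s) * (h\<^sup>2 + X\<^sup>2 * c\<^sup>2 * W)"
      unfolding hh' by (simp add: algebra_simps)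
    also have "h\<^sup>2 + X\<^sup>2 * c\<^sup>2 * W = m\<^sup>2 * (r + m)\<^sup>2 / (4 * r)"
      unfolding h2 Xc W_def using r by (simp add: field_simps) (simp add: power2_eq_square algebra_simps)
    also have "\<dots> = (h\<^sup>2)\<^sup>2 / r ^ 3"
      unfolding h2 using r by (simp add: field_simps power2_eq_square power3_eq_cube)
    finally have "h * (- X * s * h - X * c * h') = h * (h * h) * (- h * (X * s / r ^ 3))"
      by (simp add: power2_eq_square mult_ac)
    then have "- X * s * h - X * c * h' = (h * h) * (- h * (X * s / r ^ 3))"
      using h by (simp only: mult.assoc mult_cancel_left) simp
    then show ?thesis using h by (simp add: nonzero_divide_eq_eq mult.commute)
  qed
  finally show ?thesis by (simp add: h_def X_def s_def r_def)
qed

lemma wall_state_derivative: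
  "(wall_state has_vector_derivative
     wall_lapse \<theta> *\<^sub>R (snd (wall_state \<theta>), (fst (kepler_force (fst (wall_state \<theta>))), 0))) (at \<theta>)"
proof -
  have 1: "((\<lambda>\<theta>. wall_amp * sin \<theta>) has_vector_derivative wall_lapse \<theta> * (wall_amp * cos \<theta> / wall_lapse \<theta>)) (at \<theta>)"
    using wall_lapse_pos[of \<theta>] unfolding has_real_derivative_iff_has_vector_derivative[symmetric]
    by (auto intro!: derivative_eq_intros)
  have 2: "((\<lambda>\<theta>. wall_amp * cos \<theta> / wall_lapse \<theta>) has_vector_derivative
     - wall_lapse \<theta> * (wall_amp * sin \<theta> / wall_rad \<theta> ^ 3)) (at \<theta>)"
    using wall_momentum_derivative unfolding has_real_derivative_iff_has_vector_derivative .
  have "((\<lambda>\<theta>. ((wall_amp * sin \<theta>, 1), (wall_amp * cos \<theta> / wall_lapse \<theta>, 0))) has_vector_derivative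
     ((wall_lapse \<theta> * (wall_amp * cos \<theta> / wall_lapse \<theta>), 0), (- wall_lapse \<theta> * (wall_amp * sin \<theta> / wall_rad \<theta> ^ 3), 0))) (at \<theta>)"
    by (intro has_vector_derivative_Pair 1 2 has_vector_derivative_const)
  then show ?thesis
    by (simp add: wall_state_def[abs_def] kepler_force_def wall_state_norm[of \<theta>, unfolded wall_state_def fst_conv]
        divide_inverse mult_ac)
qed

lemma wall_state_periodic: "wall_state (\<theta> + 2 * pi) = wall_state \<theta>" "wall_lapse (\<theta> + 2 * pi) = wall_lapse \<theta>"
  by (simp_all add: wall_state_def wall_lapse_def wall_rad_def)

lemma wall_positions:
  "fst ` range wall_state = closed_segment (- wall_amp, 1) (wall_amp, 1)"
proof -
  have "closed_segment (- wall_amp, 1 :: real) (wall_amp, 1) = {x. snd x = 1 \<and> - wall_amp \<le> fst x \<and> fst x \<le> wall_amp}"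
    using wall_amp(1) closed_segment_horizontal[of "- wall_amp" wall_amp 1] by simp
  also have "\<dots> = fst ` range wall_state"
  proof (intro equalityI subsetI)
    fix x :: plane assume "x \<in> {x. snd x = 1 \<and> - wall_amp \<le> fst x \<and> fst x \<le> wall_amp}"
    then have x: "snd x = 1" "- 1 \<le> fst x / wall_amp" "fst x / wall_amp \<le> 1"
      using wall_amp(1) by (simp_all add: field_simps)
    then have "x = fst (wall_state (arcsin (fst x / wall_amp)))"
      using wall_amp(1) by (simp add: wall_state_def prod_eq_iff)
    then show "x \<in> fst ` range wall_state" by blast
  next
    fix x assume "x \<in> fst ` range wall_state"
    then obtain \<theta> where "x = fst (wall_state \<theta>)" by blast
    moreover have "\<bar>wall_amp * sin \<theta>\<bar> \<le> wall_amp * 1"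
      using wall_amp(1) abs_sin_le_one by (simp add: abs_mult)
    ultimately show "x \<in> {x. snd x = 1 \<and> - wall_amp \<le> fst x \<and> fst x \<le> wall_amp}"
      by (auto simp: wall_state_def)
  qed
  finally show ?thesis ..
qed

lemma wall_orbit:
  "\<exists>z. periodic_trajectory z \<and> wall_trajectory z \<and> level_set E (- 2 * E) = orbit z \<and>
     positions z = closed_segment (- wall_amp, 1) (wall_amp, 1)"
proof -
  have "isCont wall_lapse \<theta>" for \<theta> using wall_lapse_derivative DERIV_isCont by blast
  then obtain F \<theta> where clk: "is_clock wall_lapse F \<theta>"
    using clock_exists[of wall_lapse "1/2"] wall_lapse(2) by auto
  define z where "z t = wall_state (\<theta> t)" for t
  have "surj \<theta>" by (rule surjI[of \<theta> F]) (use clk in \<open>simp add: is_clock_def\<close>)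
  then have rng: "range z = range wall_state"
    unfolding z_def[abs_def] by (metis image_image)
  have z: "wall_trajectory z"
    unfolding wall_trajectory_def
  proof (intro allI conjI)
    fix t
    show "fst (z t) \<in> wall" "snd (snd (z t)) = 0" by (simp_all add: z_def wall_state_def wall_def)
    have "(\<theta> has_vector_derivative 1 / wall_lapse (\<theta> t)) (at t)"
      using clk unfolding is_clock_def has_real_derivative_iff_has_vector_derivative[symmetric] by blast
    from vector_diff_chain_at[OF this wall_state_derivative]
    show "(z has_vector_derivative (snd (z t), fst (kepler_force (fst (z t))), 0)) (at t)"
      using wall_lapse_pos[of "\<theta> t"] by (simp add: z_def[abs_def] o_def)
  qed
  have "has_period z (F (2 * pi))"
    using clock_periodic[OF clk wall_lapse_pos wall_state_periodic(2), of]
    by (simp add: has_period_def z_def wall_state_periodic(1))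
  moreover have "\<not> z constant_on UNIV"
  proof
    assume "z constant_on UNIV"
    then obtain c where "\<And>t. z t = c" by (auto simp: constant_on_def)
    then have "range wall_state \<subseteq> {c}" using rng by auto
    then have "wall_state 0 = c" "wall_state (pi / 2) = c" by blast+
    then have "wall_state 0 = wall_state (pi / 2)" by simp
    then show False using wall_amp(1) by (simp add: wall_state_def)
  qed
  ultimately have "periodic_trajectory z" using z by (auto simp: periodic_trajectory_def trajectory_def)
  moreover have "orbit z = range z"
  proof -
    have "refl_state w = w" if "w \<in> range z" for w
      using that by (auto simp: z_def wall_state_def refl_state_def reflect_def)
    then show ?thesis unfolding orbit_eq by auto
  qed
  then have "level_set E (- 2 * E) = orbit z" using rng wall_level_set by simp
  moreover have "positions z = closed_segment (- wall_amp, 1) (wall_amp, 1)"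
    using wall_positions fst_orbit[of z] \<open>orbit z = range z\<close> rng by simp
  ultimately show ?thesis using z by blast
qed

lemma wall_minor_axis:
  "is_minor_axis (closed_segment (- wall_amp, 1) (wall_amp, 1)) (E_plus E (- 2 * E))"
proof -
  have "1 + 2 * (- 2 * E) * E + 4 * E\<^sup>2 = 1" by (simp add: power2_eq_square)
  then have "E_plus E (- 2 * E) = axis_ellipse (0, 1) (wall_amp\<^sup>2) (1 / E\<^sup>2)"
    by (simp add: E_plus_def axis_ellipse_def wall_amp(2) power_divide)
  moreover have "wall_amp\<^sup>2 < 1 / E\<^sup>2" by (simp add: wall_amp)
  ultimately show ?thesis
    unfolding is_minor_axis_def using wall_amp(1) E
    by (intro exI[of _ "(0, 1)"] exI[of _ "wall_amp\<^sup>2"] exI[of _ "1 / E\<^sup>2"]) simp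
qed

end

section \<open>The region of singular level sets\<close>

lemma level_set_D_plus_2E:
  assumes "w \<in> level_set E D"
  shows "D + 2 * E \<ge> 0"
proof -
  have "snd (fst w) \<ge> 1" using assms by (simp add: level_set_def phase_space_def table_def)
  then have "2 * (snd (fst w) - 1) / norm (fst w) \<ge> 0" by simp
  then show ?thesis using D_plus_2E[OF fst_level_set_nonzero[OF assms]] assms
    by (simp add: level_set_def)
qed

text \<open>In the case 1 + 2 E D + 4 E^2 = 0 the eccentricity equation for A = (0, 2 E) gives E \<ge> - 1/2; the other
  bounds come from D + 2 E \<ge> 0 and r \<ge> 1.\<close>

lemma singular_region:
  assumes E: "E < 0"
  shows "singular_values E D \<and> level_set E D \<noteq> {} \<longleftrightarrow>
    (D + 2 * E = 0 \<and> 0 < D \<and> D < 2) \<or>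
    (- (1/2) < E \<and> 1 + 2 * D * E + 4 * E\<^sup>2 = 0 \<and> D > 2) \<or>
    (D = 2 \<and> - 1 \<le> E)" (is "?S \<longleftrightarrow> ?R")
proof
  assume S: ?S
  then obtain w where w: "w \<in> level_set E D" by blast
  note w0 = fst_level_set_nonzero[OF w]
  have DE: "D + 2 * E \<ge> 0" by (rule level_set_D_plus_2E[OF w])
  from S consider "D = 2" | "D = - 2" | "1 + 2 * E * D + 4 * E\<^sup>2 = 0" "D \<noteq> 2" | "D + 2 * E = 0" "D \<noteq> 2"
    unfolding singular_values_def using power2_eq_iff[of D 2] by auto
  then show ?R
  proof cases
    case 1 then show ?thesis using DE by simp
  next
    case 2 then show ?thesis using DE E by simp
  next
    case 3
    then have l: "fst (lrl w) = 0" "snd (lrl w) = 2 * E"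
      using lrl_circle[OF w0] w by (simp_all add: level_set_def sum_power2_eq_zero_iff)
    have "4 * E\<^sup>2 = 1 + 2 * E * (ang_mom w)\<^sup>2"
      using lrl_products(3)[OF w0] w by (simp add: l inner_prod_def level_set_def power2_eq_square)
    then have "(2 * E)\<^sup>2 \<le> 1" using E by (simp add: power_mult_distrib mult_nonpos_nonneg)
    then have "\<bar>2 * E\<bar> \<le> 1" unfolding abs_square_le_1 .
    then have E2: "- (1/2) \<le> E" by simp
    have D: "D * (2 * E) = - 1 - 4 * E\<^sup>2" using 3(1) by (simp add: mult_ac)
    then have DD: "(D - 2) * (- 2 * E) = (1 + 2 * E)\<^sup>2" by (simp add: power2_eq_square algebra_simps)
    then have "(D - 2) * (- 2 * E) \<ge> 0" by simp
    then have "D > 2" using E 3(2) by (simp add: mult_le_0_iff)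
    moreover have "E \<noteq> - (1/2)"
    proof
      assume "E = - (1/2)"
      then show False using DD 3(2) by simp
    qed
    ultimately show ?thesis using E2 3(1) by (simp add: mult_ac)
  next
    case 4
    have "1 / norm (fst w) \<le> 1" using level_set_norm_ge[OF w] by (intro divide_le_eq_1[THEN iffD2]) auto
    moreover have "(norm (snd w))\<^sup>2 / 2 - 1 / norm (fst w) = E" using w by (simp add: level_set_def energy_def)
    ultimately have "E \<ge> - 1" using zero_le_power2[of "norm (snd w)"] by linarith
    then show ?thesis using 4 E by auto
  qed
next
  assume R: ?R
  then consider "D + 2 * E = 0" "0 < D" "D < 2" | "- (1/2) < E" "1 + 2 * D * E + 4 * E\<^sup>2 = 0" "D > 2" | "D = 2" "- 1 \<le> E"
    by blast
  then show ?S
  proof cases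
    case 1
    then have "D = - 2 * E" "- 1 < E" by auto
    then have "wall_state E 0 \<in> level_set E D" using wall_state_level_set[of E 0] E by simp
    then show ?thesis using 1 by (auto simp: singular_values_def)
  next
    case 2
    then have "start_state E 1 \<in> level_set E D"
      using start_state_outgoing[of E D 1] E by (simp add: outgoing_def)
    then show ?thesis using 2 by (auto simp: singular_values_def mult_ac)
  next
    case 3
    have "((0, - 1 / E), (0, 0)) \<in> level_set E 2"
    proof -
      have "1 \<le> - 1 / E" using 3 E by (subst neg_le_divide_eq) auto
      then show ?thesis
        using E by (simp add: level_set_def phase_space_def table_def energy_def D_int_coords ang_mom_def norm_plane)
    qed
    then show ?thesis using 3 by (auto simp: singular_values_def)
  qed
qed

section \<open>The singular level sets\<close>

lemma vertical_segment_contains_F: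
  assumes "- (1/2) < E" "E < 0"
  shows "F_pt \<in> open_segment (0, 1) (0, - 1 / E)"
proof -
  have "2 < - 1 / E" using assms by (subst neg_less_divide_eq) auto
  moreover have "F_pt \<in> closed_segment (0, 1) (0, - 1 / E)"
    using calculation closed_segment_vertical[of 1 "- 1 / E" 0] by (simp add: F_pt_def)
  ultimately show ?thesis by (simp add: open_segment_def F_pt_def)
qed

theorem theorem4p1:
  fixes E D :: real
  shows
    "(singular_values E D \<and> E < 0 \<and> level_set E D \<noteq> {} \<longleftrightarrow>
        (D + 2 * E = 0 \<and> 0 < D \<and> D < 2) \<or>
        (- (1/2) < E \<and> E < 0 \<and> 1 + 2 * D * E + 4 * E\<^sup>2 = 0 \<and> D > 2) \<or>
        (D = 2 \<and> -1 < E \<and> E < - (1/2)) \<or>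
        (D = 2 \<and> - (1/2) < E \<and> E < 0) \<or>
        (E, D) \<in> {(-1, 2), (- (1/2), 2)}) \<and>
     (D + 2 * E = 0 \<and> 0 < D \<and> D < 2 \<longrightarrow>
        (\<exists>z. periodic_trajectory z \<and> wall_trajectory z \<and> level_set E D = orbit z \<and>
             is_minor_axis (positions z) (E_plus E D))) \<and>
     (- (1/2) < E \<and> E < 0 \<and> 1 + 2 * D * E + 4 * E\<^sup>2 = 0 \<and> D > 2 \<longrightarrow>
        (\<exists>z. periodic_trajectory z \<and> n_periodic 2 z \<and> level_set E D = orbit z \<and>
             (\<exists>C M. is_minor_axis M C \<and> M \<subseteq> wall \<and> positions z = C \<inter> table))) \<and>
     (D = 2 \<and> -1 < E \<and> E < - (1/2) \<longrightarrow>
        (\<exists>z. periodic_trajectory z \<and> bouncing_trajectory z \<and> level_set E D = orbit z \<and>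
             positions z = closed_segment (0, 1) (0, - 1 / E))) \<and>
     (D = 2 \<and> - (1/2) < E \<and> E < 0 \<longrightarrow>
        (\<exists>z. periodic_trajectory z \<and> bouncing_trajectory z \<and>
             positions z = closed_segment (0, 1) (0, - 1 / E) \<and>
             F_pt \<in> open_segment (0, 1) (0, - 1 / E) \<and>
             level_set E D = orbit z \<union> separatrix (orbit z) \<and>
             separatrix (orbit z) \<noteq> {} \<and>
             separatrix (orbit z) =
               \<Union> {orbit y | y. bouncing_trajectory y \<and> range y \<subseteq> level_set E D \<and>
                              (\<forall>A \<in> arcs y. elliptic_arc A \<and> F_pt \<in> A)}))"
proof (intro conjI impI)
  show "singular_values E D \<and> E < 0 \<and> level_set E D \<noteq> {} \<longleftrightarrow>
        (D + 2 * E = 0 \<and> 0 < D \<and> D < 2) \<or>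
        (- (1/2) < E \<and> E < 0 \<and> 1 + 2 * D * E + 4 * E\<^sup>2 = 0 \<and> D > 2) \<or>
        (D = 2 \<and> -1 < E \<and> E < - (1/2)) \<or>
        (D = 2 \<and> - (1/2) < E \<and> E < 0) \<or>
        (E, D) \<in> {(-1, 2), (- (1/2), 2)}"
  proof (cases "E < 0")
    case True
    have "D = 2 \<and> - 1 \<le> E \<longleftrightarrow> (D = 2 \<and> -1 < E \<and> E < - (1/2)) \<or> (D = 2 \<and> - (1/2) < E \<and> E < 0) \<or>
        (E, D) \<in> {(-1, 2), (- (1/2), 2)}" using True by auto
    then show ?thesis using singular_region[OF True, of D] True by argo
  qed auto
next
  assume A: "D + 2 * E = 0 \<and> 0 < D \<and> D < 2"
  then have E: "-1 < E" "E < 0" and D: "D = - 2 * E" by auto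
  show "\<exists>z. periodic_trajectory z \<and> wall_trajectory z \<and> level_set E D = orbit z \<and>
             is_minor_axis (positions z) (E_plus E D)"
    using wall_orbit[OF E] wall_minor_axis[OF E] unfolding D by metis
next
  assume A: "- (1/2) < E \<and> E < 0 \<and> 1 + 2 * D * E + 4 * E\<^sup>2 = 0 \<and> D > 2"
  then have E: "- (1/2) < E" "E < 0" "1 + 2 * D * E + 4 * E\<^sup>2 = 0" by auto
  obtain z where z: "periodic_trajectory z" "n_periodic 2 z" "level_set E D = orbit z"
    using two_periodic_orbit[OF E] by blast
  have "positions z = axis_ellipse (0, 1) ((half_minor E)\<^sup>2) (1 / (4 * E\<^sup>2)) \<inter> table"
    using level_set_positions[OF E] fst_orbit[of z] z(3) by simp
  then show "\<exists>z. periodic_trajectory z \<and> n_periodic 2 z \<and> level_set E D = orbit z \<and>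
             (\<exists>C M. is_minor_axis M C \<and> M \<subseteq> wall \<and> positions z = C \<inter> table)"
    using z two_periodic_minor_axis[OF E] by blast
next
  assume A: "D = 2 \<and> -1 < E \<and> E < - (1/2)"
  then have E: "-1 < E" "E < 0" and D: "D = 2" by auto
  obtain z where z: "periodic_trajectory z" "bouncing_trajectory z" "orbit z = vertical_states E"
    using vertical_orbit[OF E] by blast
  have "level_set E 2 = vertical_states E"
    using slow_level_set_vertical[of E] A by (auto simp: vertical_states_def)
  moreover have "positions z = closed_segment (0, 1) (0, - 1 / E)"
    using vertical_positions[OF E] fst_orbit[of z] z(3) by simp
  ultimately show "\<exists>z. periodic_trajectory z \<and> bouncing_trajectory z \<and> level_set E D = orbit z \<and>
             positions z = closed_segment (0, 1) (0, - 1 / E)"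
    using z D by auto
next
  assume A: "D = 2 \<and> - (1/2) < E \<and> E < 0"
  then have E: "- (1/2) < E" "E < 0" "-1 < E" and D: "D = 2" by auto
  obtain z where z: "periodic_trajectory z" "bouncing_trajectory z" "orbit z = vertical_states E"
    using vertical_orbit[OF E(3,2)] by blast
  have pos: "positions z = closed_segment (0, 1) (0, - 1 / E)"
    using vertical_positions[OF E(3,2)] fst_orbit[of z] z(3) by simp
  have F: "F_pt \<in> open_segment (0, 1) (0, - 1 / E)" by (rule vertical_segment_contains_F[OF E(1,2)])
  have sep: "separatrix (orbit z) = level_set E 2 - vertical_states E"
    unfolding z(3) by (rule separatrix_vertical_states[OF E(1,2)])
  have lev: "level_set E D = orbit z \<union> separatrix (orbit z)"
    unfolding sep unfolding z(3) D by (auto simp: vertical_states_def)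
  have ne: "separatrix (orbit z) \<noteq> {}"
    unfolding sep by (rule separatrix_nonempty[OF E(1,2)])
  have orb: "separatrix (orbit z) =
               \<Union> {orbit y | y. bouncing_trajectory y \<and> range y \<subseteq> level_set E D \<and>
                              (\<forall>A \<in> arcs y. elliptic_arc A \<and> F_pt \<in> A)}"
    unfolding sep D by (rule separatrix_orbits[OF E(1,2)])
  show "\<exists>z. periodic_trajectory z \<and> bouncing_trajectory z \<and>
             positions z = closed_segment (0, 1) (0, - 1 / E) \<and>
             F_pt \<in> open_segment (0, 1) (0, - 1 / E) \<and>
             level_set E D = orbit z \<union> separatrix (orbit z) \<and>
             separatrix (orbit z) \<noteq> {} \<and>
             separatrix (orbit z) =
               \<Union> {orbit y | y. bouncing_trajectory y \<and> range y \<subseteq> level_set E D \<and>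
                              (\<forall>A \<in> arcs y. elliptic_arc A \<and> F_pt \<in> A)}"
    by (rule exI[of _ z], intro conjI) (fact z(1) z(2) pos F lev ne orb)+
qed

end
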